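(* Let $d\ge1$ and suppose $A \in \mathrm{GL}(2d,\mathbb R)$ is such that $$A^T J A = \begin{pmatrix} 0 & K \\ -K & 0 \end{pmatrix}\quad\text{with } K \text{ a diagonal } d\times d \text{ matrix.}$$ Write $A = \begin{pmatrix} A_{11} & A_{12} \\ A_{21} & A_{22} \end{pmatrix}$ where the $A_{ij}$ are $d \times d$ blocks. Choose any diagonal matrix $D \in \mathrm{GL}(d,\mathbb R)$ and let $$X = \bigl(A_{11} D^2 A_{11}^T + A_{12} (DK)^{-2} A_{12}^T\bigr)^{-1}\quad\text{and}\quad Y = -\bigl(A_{21} D^2 A_{11}^T + A_{22} (DK)^{-2} A_{12}^T\bigr) X,$$ where $X$ is always well-defined. Then, for any constant $C\neq 0$, the Gaussian $$g_{X, Y}(t) = C e^{-\pi t^T(X + i Y)t}\quad (t\in\mathbb R^d)$$ generates a Gabor frame over $A \mathbb Z^{2d}$ if and only if every diagonal entry of $K$ has absolute value $< 1$.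
   Context: $J = \begin{pmatrix} 0 & I \\ -I & 0\end{pmatrix}$ is the standard $2d\times 2d$ symplectic matrix ($I$ the $d\times d$ identity). For $z=(x,\omega)\in\mathbb R^{d}\times\mathbb R^d$, $\pi(z)$ is the time-frequency shift on $L^2(\mathbb R^d)$ given by $\pi(z)f(t)=e^{2\pi i t\cdot\omega}f(t-x)$. A function $g\in L^2(\mathbb R^d)$ generates a Gabor frame over the lattice $A\mathbb Z^{2d}$ if there exist constants $C_1,C_2>0$ such that $C_1\|f\|^2\le\sum_{k\in\mathbb Z^{2d}}|\langle f,\pi(Ak)g\rangle|^2\le C_2\|f\|^2$ for all $f\in L^2(\mathbb R^d)$. *)

theory Defs
  imports "HOL-Analysis.Analysis"
begin

text \<open>
  Phase space \<open>\<real>\<^sup>d \<times> \<real>\<^sup>d\<close> is \<^typ>\<open>real ^ ('d + 'd)\<close>: the \<open>Inl\<close> coordinates are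
  the position \<open>x\<close>, the \<open>Inr\<close> coordinates the frequency \<open>\<omega>\<close>. Correspondingly, the two
  block rows and block columns of a \<open>2d \<times> 2d\<close> matrix are indexed by \<open>Inl\<close> and \<open>Inr\<close>.
\<close>

definition block_matrix ::
    "'a ^ 'd ^ 'd \<Rightarrow> 'a ^ 'd ^ 'd \<Rightarrow> 'a ^ 'd ^ 'd \<Rightarrow> 'a ^ 'd ^ 'd \<Rightarrow> 'a ^ ('d + 'd) ^ ('d + 'd)"
  where "block_matrix P Q R S =
    (\<chi> i j. case (i, j) of
        (Inl a, Inl b) \<Rightarrow> P $ a $ b
      | (Inl a, Inr b) \<Rightarrow> Q $ a $ b
      | (Inr a, Inl b) \<Rightarrow> R $ a $ b
      | (Inr a, Inr b) \<Rightarrow> S $ a $ b)"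

definition symplectic_J :: "real ^ ('d + 'd) ^ ('d::finite + 'd)"
  where "symplectic_J = block_matrix 0 (mat 1) (- mat 1) 0"

definition diagonal_matrix :: "'a::zero ^ 'd ^ 'd \<Rightarrow> bool"
  where "diagonal_matrix M \<longleftrightarrow> (\<forall>i j. i \<noteq> j \<longrightarrow> M $ i $ j = 0)"

text \<open>
  Elements of \<open>L\<^sup>2(\<real>\<^sup>d)\<close> are represented by functions rather than by classes modulo null
  sets; the integrals below do not depend on the representative.
\<close>

definition L2 :: "((real ^ 'd::finite) \<Rightarrow> complex) set"
  where "L2 = {f. f \<in> borel_measurable lebesgue \<and> integrable lebesgue (\<lambda>t. (cmod (f t))\<^sup>2)}"

definition L2_inner :: "((real ^ 'd::finite) \<Rightarrow> complex) \<Rightarrow> (real ^ 'd \<Rightarrow> complex) \<Rightarrow> complex"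
  where "L2_inner f g = (LINT t|lebesgue. f t * cnj (g t))"

definition L2_norm :: "((real ^ 'd::finite) \<Rightarrow> complex) \<Rightarrow> real"
  where "L2_norm f = sqrt (LINT t|lebesgue. (cmod (f t))\<^sup>2)"

definition tf_shift ::
    "real ^ ('d + 'd) \<Rightarrow> (real ^ 'd::finite \<Rightarrow> complex) \<Rightarrow> (real ^ 'd \<Rightarrow> complex)"
  where "tf_shift z f = (\<lambda>t.
    let x = (\<chi> i. z $ Inl i); \<omega> = (\<chi> i. z $ Inr i)
    in exp (2 * complex_of_real pi * \<i> * complex_of_real (t \<bullet> \<omega>)) * f (t - x))"

definition int_vectors :: "(real ^ 'n::finite) set"
  where "int_vectors = {k. \<forall>i. k $ i \<in> \<int>}"

text \<open>
  Summability is required explicitly because \<open>infsum\<close> is 0 for a divergent series. The sum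
  runs over indices \<open>k\<close>, not over lattice points \<open>A k\<close>.
\<close>

definition gabor_frame ::
    "real ^ ('d + 'd) ^ ('d + 'd) \<Rightarrow> (real ^ 'd::finite \<Rightarrow> complex) \<Rightarrow> bool"
  where "gabor_frame A g \<longleftrightarrow> g \<in> L2 \<and>
    (\<exists>C1>0. \<exists>C2>0. \<forall>f\<in>L2.
      (\<lambda>k. (cmod (L2_inner f (tf_shift (A *v k) g)))\<^sup>2) summable_on int_vectors \<and>
      C1 * (L2_norm f)\<^sup>2
        \<le> (\<Sum>\<^sub>\<infinity>k\<in>int_vectors. (cmod (L2_inner f (tf_shift (A *v k) g)))\<^sup>2) \<and>
      (\<Sum>\<^sub>\<infinity>k\<in>int_vectors. (cmod (L2_inner f (tf_shift (A *v k) g)))\<^sup>2)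
        \<le> C2 * (L2_norm f)\<^sup>2)"

definition gen_gaussian ::
    "complex \<Rightarrow> real ^ 'd ^ 'd \<Rightarrow> real ^ 'd ^ 'd \<Rightarrow> (real ^ 'd::finite \<Rightarrow> complex)"
  where "gen_gaussian C X Y = (\<lambda>t.
    C * exp (- complex_of_real pi *
          (complex_of_real (t \<bullet> (X *v t)) + \<i> * complex_of_real (t \<bullet> (Y *v t)))))"

end

theory Submission
  imports Defs "HOL-Complex_Analysis.Complex_Analysis" "HOL-Real_Asymp.Real_Asymp"
begin

text \<open>
  Absorbing \<open>D\<close> and \<open>K\<close> into the blocks of \<open>A\<close> gives a symplectic matrix, and \<open>X + i Y\<close> is the point of
  the Siegel upper half space that it determines. Hence, up to factors \<open>\<theta>\<close> of explicit modulus, the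
  Gram matrix of the time-frequency shifts is \<open>exp (\<pi> \<Sum>\<^sub>i u\<^sub>i(k) cnj (u\<^sub>i(k')))\<close>, the Fock space kernel, where the
  points \<open>u\<^sub>i(k)\<close> run through a rectangular lattice whose cells have area \<open>\<bar>K\<^sub>i\<^sub>i\<bar>\<close>.

  If all areas are less than \<open>1\<close>, Lagrange interpolation with an analogue of the Weierstrass sigma
  function expands every coherent state in the lattice ones with coefficients of Gaussian decay. This bounds
  the short-time Fourier transform at each point by a Gaussian average of the samples, and integrating over
  phase space gives the lower frame bound.

  If some area is at least \<open>1\<close>, a lower frame bound together with the Bessel bound for the shifted
  lattice would dominate the weighted \<open>l\<^sup>2\<close> sums over the shifted planar lattice of any exponential sum by
  those over the lattice itself. Dominated limits extend this to entire functions of growth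
  \<open>exp (\<gamma> \<bar>z\<bar>\<^sup>2)\<close> with \<open>\<gamma> < \<pi>/2\<close>. The sigma function, or at area exactly \<open>1\<close> its dilates \<open>\<sigma>(s z)\<close> with
  \<open>s \<rightarrow> 1\<close>, contradicts it.
\<close>

section \<open>Entire functions vanishing on a rectangular lattice\<close>

text \<open>Two growth rates are compared throughout. The sigma function of a cell of area
  \<open>a * b\<close> grows like \<open>exp (pi / (2 * a * b) * |u|^2)\<close>, while the Fock
  weight tolerates growth strictly below \<open>exp (pi / 2 * |u|^2)\<close>. Below area 1, dividing
  by the derivatives of the sigma function at lattice points gives coefficients that beat the Fock
  weight. Above area 1 the function itself is admissible and vanishes at all samples. At area 1 it
  just fails to be admissible, hence the dilates. Neither the Fock space nor the Bargmann transform
  is constructed: the coherent states enter through their Gram matrix. The price is that expansions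
  of coherent states are first known only weakly, tested against coherent states, and have to be
  upgraded to statements about arbitrary \<open>f\<close>. Since \<open>K\<close> is diagonal, the
  lattice is a product of planar lattices and the kernel a product over coordinates, so complex
  analysis in one variable suffices. \<open>D\<close> affects only the shape of the cells: their
  sides are \<open>|1 / d|\<close> and \<open>|d * k|\<close>, with \<open>d\<close> and
  \<open>k\<close> the diagonal entries of \<open>D\<close> and \<open>K\<close>, so that
  \<open>d\<close> cancels in the area.\<close>

lemma q_pochhammer_exists:
  fixes q :: complex
  assumes q: "cmod q < 1"
  obtains h where "h holomorphic_on UNIV" "h 0 = 1" "\<And>W. h W = (1 - W) * h (q * W)"
proof -
  \<comment> \<open>Partial products of \<open>(W; q)_infinity\<close>. Comparison with a geometric
    series makes them converge uniformly on discs, and splitting off the factor \<open>n = 0\<close>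
    yields the functional equation.\<close>
  define P where "P = (\<lambda>N W. \<Prod>n<N. 1 + (- (q ^ n) * W))"
  have unif: "uniformly_convergent_on (cball 0 R) P" for R
  proof -
    have "uniformly_convergent_on (cball 0 R) (\<lambda>N W. \<Sum>n<N. norm (- (q ^ n) * W))"
    proof (rule Weierstrass_m_test')
      show "norm (norm (- (q ^ n) * W)) \<le> cmod q ^ n * R" if "W \<in> cball 0 R" for n W
        using that by (auto simp: norm_mult norm_power intro!: mult_left_mono)
      show "summable (\<lambda>n. cmod q ^ n * R)"
        using q by (intro summable_mult2 summable_geometric) auto
    qed
    then show ?thesis
      unfolding P_def by (intro uniformly_convergent_on_prod) (auto intro!: continuous_intros)
  qed
  define h where "h = (\<lambda>W. lim (\<lambda>N. P N W))"
  have lim: "uniform_limit (cball 0 R) P h sequentially" for R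
    using unif[of R] unfolding h_def by (rule uniformly_convergent_uniform_limit_iff[THEN iffD1])
  have pt: "(\<lambda>N. P N W) \<longlonglongrightarrow> h W" for W
    by (rule tendsto_uniform_limitI[OF lim[of "cmod W"]]) auto
  show ?thesis
  proof
    show "h holomorphic_on UNIV"
    proof (rule holomorphic_uniform_sequence[where f = P])
      show "P n holomorphic_on UNIV" for n
        unfolding P_def by (intro holomorphic_intros)
      show "\<exists>d>0. cball x d \<subseteq> UNIV \<and> uniform_limit (cball x d) P h sequentially" for x
        by (intro exI[of _ 1] conjI uniform_limit_on_subset[OF lim[of "cmod x + 1"]])
           (auto simp: dist_norm norm_minus_commute, smt (verit) norm_triangle_sub)
    qed auto
    have "P N 0 = 1" for N unfolding P_def by simp
    then show "h 0 = 1" using pt[of 0] by (simp add: LIMSEQ_const_iff)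
    show "h W = (1 - W) * h (q * W)" for W
    proof -
      have "P (Suc N) W = (1 - W) * P N (q * W)" for N
        unfolding P_def by (subst prod.lessThan_Suc_shift) (simp add: algebra_simps)
      then have "(\<lambda>N. (1 - W) * P N (q * W)) \<longlonglongrightarrow> h W"
        using LIMSEQ_Suc[OF pt[of W]] by simp
      moreover have "(\<lambda>N. (1 - W) * P N (q * W)) \<longlonglongrightarrow> (1 - W) * h (q * W)"
        by (intro tendsto_intros pt)
      ultimately show ?thesis by (rule LIMSEQ_unique)
    qed
  qed
qed

text \<open>Iterating the functional equation writes \<open>h W\<close> as a finite product times
  \<open>h (q ^ n * W)\<close>. The last factor tends to \<open>h 0 = 1\<close>, so it is nonzero
  for large \<open>n\<close> and all zeros come from the finite product.\<close>

lemma q_pochhammer_zeros: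
  fixes q :: complex
  assumes q: "cmod q < 1" and h: "h holomorphic_on UNIV" "h 0 = 1" "\<And>W. h W = (1 - W) * h (q * W)"
  shows "h W = 0 \<longleftrightarrow> (\<exists>n::nat. q ^ n * W = 1)"
proof -
  have iter: "h W = (\<Prod>k<n. 1 - q ^ k * W) * h (q ^ n * W)" for n
  proof (induction n)
    case (Suc n)
    then show ?case
      using h(3)[of "q ^ n * W"] by (simp add: mult_ac)
  qed simp
  have "(\<lambda>n. q ^ n * W) \<longlonglongrightarrow> 0 * W"
    by (intro tendsto_intros LIMSEQ_power_zero q)
  moreover have "isCont h 0"
    using h(1) by (metis UNIV_I continuous_on_eq_continuous_at holomorphic_on_imp_continuous_on open_UNIV)
  ultimately have "(\<lambda>n. h (q ^ n * W)) \<longlonglongrightarrow> 1"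
    using h(2) isCont_tendsto_compose[of 0 h "\<lambda>n. q ^ n * W"] by simp
  then have "eventually (\<lambda>n. h (q ^ n * W) \<noteq> 0) sequentially"
    by (rule tendsto_imp_eventually_ne) simp
  then obtain N where N: "h (q ^ N * W) \<noteq> 0"
    using eventually_sequentially by auto
  show ?thesis
  proof
    assume "h W = 0"
    then have "(\<Prod>k<N. 1 - q ^ k * W) = 0" using iter[of N] N by simp
    then show "\<exists>n. q ^ n * W = 1" by auto
  next
    assume "\<exists>n. q ^ n * W = 1"
    then obtain n where n: "q ^ n * W = 1" by auto
    then have "(\<Prod>k<Suc n. 1 - q ^ k * W) = 0" by simp
    then show "h W = 0" using iter[of "Suc n"] by simp
  qed
qed

definition rect_lattice :: "real \<Rightarrow> real \<Rightarrow> complex set" where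
  "rect_lattice a b = {z. \<exists>m n. z = Complex (a * of_int m) (b * of_int n)}"

lemma rect_latticeI: "Complex (a * of_int m) (b * of_int n) \<in> rect_lattice a b"
  by (auto simp: rect_lattice_def)

lemma rect_lattice_add:
  assumes "x \<in> rect_lattice a b" "y \<in> rect_lattice a b"
  shows "x + y \<in> rect_lattice a b"
proof -
  obtain m n k l where "x = Complex (a * of_int m) (b * of_int n)" "y = Complex (a * of_int k) (b * of_int l)"
    using assms by (auto simp: rect_lattice_def)
  then have "x + y = Complex (a * of_int (m + k)) (b * of_int (n + l))"
    by (simp add: distrib_left complex_eq_iff)
  then show ?thesis by (simp only: rect_latticeI)
qed

lemma rect_lattice_uminus:
  assumes "x \<in> rect_lattice a b"
  shows "- x \<in> rect_lattice a b"
proof -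
  obtain m n where "x = Complex (a * of_int m) (b * of_int n)"
    using assms by (auto simp: rect_lattice_def)
  then have "- x = Complex (a * of_int (- m)) (b * of_int (- n))" by (simp add: complex_eq_iff)
  then show ?thesis by (simp only: rect_latticeI)
qed

lemma rect_lattice_0: "0 \<in> rect_lattice a b"
  using rect_latticeI[of a 0 b 0] by (simp add: zero_complex.code)

text \<open>A theta function in the variable \<open>exp (2 pi i u / a)\<close>, corrected by the
  exponential of a quadratic polynomial so that its modulus times a Gaussian is doubly periodic.
  Quasi-periodicity is recorded for the modulus only: every later use is an estimate of absolute
  values, so the phases of the multipliers are irrelevant.\<close>

lemma sigma_function_exists:
  fixes a b :: real
  assumes ab: "a > 0" "b > 0"
  obtains S where "S holomorphic_on UNIV" "\<And>u. S u = 0 \<longleftrightarrow> u \<in> rect_lattice a b"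
    "deriv S 0 \<noteq> 0"
    "\<And>u l. l \<in> rect_lattice a b \<Longrightarrow>
       cmod (S (u + l)) * exp (- pi / (2 * a * b) * (cmod (u + l))\<^sup>2) = cmod (S u) * exp (- pi / (2 * a * b) * (cmod u)\<^sup>2)"
proof -
  \<comment> \<open>Translation by \<open>i b\<close> multiplies \<open>E u\<close> by exactly this
    \<open>q\<close>; translation by \<open>a\<close> leaves \<open>E u\<close> fixed.\<close>
  define q :: complex where "q = of_real (exp (- 2 * pi * b / a))"
  have q1: "cmod q < 1" and q0: "q \<noteq> 0" using ab by (auto simp: q_def)
  obtain h where h: "h holomorphic_on UNIV" "h 0 = 1" "\<And>W. h W = (1 - W) * h (q * W)"
    using q_pochhammer_exists[OF q1] by metis
  note hz = q_pochhammer_zeros[OF q1 h]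
  define E where "E = (\<lambda>u. exp (2 * of_real pi * \<i> * u / of_real a))"
  have E0: "E u \<noteq> 0" for u by (simp add: E_def)
  \<comment> \<open>The theta function in product form, up to a constant. Its two factors vanish at
    the nonpositive and at the positive powers of \<open>q\<close>, respectively.\<close>
  define T where "T = (\<lambda>W. h W * h (q / W))"
  have Tq: "T (q * W) = - T W / W" if "W \<noteq> 0" for W
  \<comment> \<open>The generic argument cancels the factor \<open>1 - W\<close>. At
    \<open>W = 1\<close> both sides vanish because \<open>h 1 = 0\<close>.\<close>
  proof (cases "W = 1")
    case True
    then show ?thesis using h(3)[of 1] q0 by (simp add: T_def)
  next
    case False
    have "h (1 / W) = (1 - 1 / W) * h (q / W)" using h(3)[of "1 / W"] by simp
    then have "(1 - W) * T (q * W) = h W * ((1 - 1 / W) * h (q / W))"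
      using that q0 h(3)[of W] by (simp add: T_def)
    also have "\<dots> = (1 - W) * (- T W / W)" using that by (simp add: T_def field_simps)
    finally show ?thesis using False by (metis eq_iff_diff_eq_0 mult_left_cancel)
  qed
  \<comment> \<open>The quadratic term removes the dependence of the weight exponent on
    \<open>Re u\<close>, which settles translation by \<open>a\<close>. The linear term positions
    the remaining parabola in \<open>Im u\<close> so that translation by \<open>i b\<close>
    compensates the factor \<open>1 / |E u|\<close> of \<open>Tq\<close>.\<close>
  define G where "G = (\<lambda>u. - \<i> * of_real pi * u / of_real a + of_real (pi / (2 * a * b)) * u\<^sup>2)"
  define S where "S = (\<lambda>u. T (E u) * exp (G u))"
  have ReG: "Re (G u) + - pi / (2 * a * b) * (cmod u)\<^sup>2 = pi * Im u / a - pi * (Im u)\<^sup>2 / (a * b)" for u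
  proof -
    have "Re (G u) = pi * Im u / a + pi / (2 * a * b) * ((Re u)\<^sup>2 - (Im u)\<^sup>2)"
      unfolding G_def by (simp add: power2_eq_square Re_divide_of_real)
    moreover have "pi / (2 * a * b) * ((Re u)\<^sup>2 - (Im u)\<^sup>2) + - pi / (2 * a * b) * ((Re u)\<^sup>2 + (Im u)\<^sup>2)
        = - (pi * (Im u)\<^sup>2 / (a * b))"
      using ab by (simp add: field_simps)
    ultimately show ?thesis by (simp add: cmod_power2)
  qed
  have weight: "cmod (S u) * exp (- pi / (2 * a * b) * (cmod u)\<^sup>2)
      = cmod (T (E u)) * exp (pi * Im u / a - pi * (Im u)\<^sup>2 / (a * b))" for u
    unfolding ReG[symmetric] exp_add by (simp add: S_def norm_mult norm_exp_eq_Re)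
  have per1: "cmod (S (u + of_real a)) * exp (- pi / (2 * a * b) * (cmod (u + of_real a))\<^sup>2)
      = cmod (S u) * exp (- pi / (2 * a * b) * (cmod u)\<^sup>2)" for u
  proof -
    have "2 * of_real pi * \<i> * (u + of_real a) / of_real a = 2 * of_real pi * \<i> * u / of_real a + 2 * of_real pi * \<i>"
      using ab by (simp add: distrib_left add_divide_distrib)
    then have "E (u + of_real a) = E u" unfolding E_def by (simp add: exp_add)
    then show ?thesis unfolding weight by simp
  qed
  have per2: "cmod (S (u + \<i> * of_real b)) * exp (- pi / (2 * a * b) * (cmod (u + \<i> * of_real b))\<^sup>2)
      = cmod (S u) * exp (- pi / (2 * a * b) * (cmod u)\<^sup>2)" for u
  proof -
    have "2 * of_real pi * \<i> * (u + \<i> * of_real b) / of_real a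
        = of_real (- 2 * pi * b / a) + 2 * of_real pi * \<i> * u / of_real a"
      using ab by (simp add: complex_eq_iff Re_divide_of_real Im_divide_of_real field_simps)
    then have "E (u + \<i> * of_real b) = q * E u"
      unfolding E_def q_def exp_of_real[symmetric] by (simp only: exp_add)
    then have "T (E (u + \<i> * of_real b)) = - T (E u) / E u" using Tq[OF E0] by simp
    moreover have "cmod (E u) = exp (- (2 * pi * Im u / a))"
      by (simp add: E_def norm_exp_eq_Re Re_divide_of_real)
    ultimately have "cmod (T (E (u + \<i> * of_real b))) = cmod (T (E u)) * exp (2 * pi * Im u / a)"
      by (simp add: norm_divide norm_mult norm_inverse exp_minus divide_inverse)
    moreover have "2 * pi * Im u / a + (pi * (Im u + b) / a - pi * (Im u + b)\<^sup>2 / (a * b))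
        = pi * Im u / a - pi * (Im u)\<^sup>2 / (a * b)"
      using ab by (simp add: field_simps power2_eq_square)
    ultimately show ?thesis
      unfolding weight by (simp add: mult.assoc flip: exp_add)
  qed
  have hol: "S holomorphic_on UNIV"
  proof -
    have "h \<circ> E holomorphic_on UNIV" "h \<circ> (\<lambda>u. q / E u) holomorphic_on UNIV"
      using h(1) ab unfolding E_def by (auto intro!: holomorphic_on_compose holomorphic_intros holomorphic_on_subset[OF h(1)])
    then have "(\<lambda>u. (h \<circ> E) u * (h \<circ> (\<lambda>u. q / E u)) u * exp (G u)) holomorphic_on UNIV"
      unfolding G_def using ab by (intro holomorphic_intros) (auto simp: o_def)
    then show ?thesis by (simp add: S_def T_def)
  qed
  define P where "P = (\<lambda>u. cmod (S u) * exp (- pi / (2 * a * b) * (cmod u)\<^sup>2))"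
  have perR: "P (u + of_real (a * of_nat m)) = P u" for u m
  proof (induction m)
    case (Suc m)
    then show ?case using per1[of "u + of_real (a * of_nat m)"] by (simp add: P_def algebra_simps)
  qed simp
  have perI: "P (u + \<i> * of_real (b * of_nat m)) = P u" for u m
  proof (induction m)
    case (Suc m)
    then show ?case using per2[of "u + \<i> * of_real (b * of_nat m)"] by (simp add: P_def algebra_simps)
  qed simp
  \<comment> \<open>For negative \<open>m\<close> the case of natural numbers is applied at the
    translated point, moving back to \<open>u\<close>.\<close>
  have perR': "P (u + of_real (a * of_int m)) = P u" for u m
    using perR[of u "nat m"] perR[of "u + of_real (a * of_int m)" "nat (- m)"]
    by (cases "m \<ge> 0") (auto simp: of_nat_nat)
  have perI': "P (u + \<i> * of_real (b * of_int m)) = P u" for u m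
    using perI[of u "nat m"] perI[of "u + \<i> * of_real (b * of_int m)" "nat (- m)"]
    by (cases "m \<ge> 0") (auto simp: of_nat_nat)
  have per: "P (u + l) = P u" if l: "l \<in> rect_lattice a b" for u l
  proof -
    obtain m n where "l = Complex (a * of_int m) (b * of_int n)" using l by (auto simp: rect_lattice_def)
    then have ul: "u + l = (u + of_real (a * of_int m)) + \<i> * of_real (b * of_int n)"
      by (simp add: complex_eq_iff)
    show ?thesis unfolding ul by (simp only: perR' perI')
  qed
  have P0: "P u = 0 \<longleftrightarrow> S u = 0" for u by (simp add: P_def)
  have h1: "h 1 = 0" using h(3)[of 1] by simp
  have S0: "S 0 = 0" by (simp add: S_def T_def E_def h1)
  have zero: "S u = 0 \<longleftrightarrow> u \<in> rect_lattice a b" for u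
  proof
    assume "u \<in> rect_lattice a b"
    then show "S u = 0" using per[of u 0] S0 P0[of u] P0[of 0] by simp
  next
    assume "S u = 0"
    then have "h (E u) = 0 \<or> h (q / E u) = 0" by (simp add: S_def T_def)
    \<comment> \<open>The first factor gives \<open>E u = q^(-n)\<close> and the second
      \<open>E u = q^(n+1)\<close> with natural \<open>n\<close>. Together they cover every integer
      exponent once, hence the negative exponent \<open>- Suc n\<close> below.\<close>
    then obtain n :: int where n: "q powi n * E u = 1"
    proof
      assume "h (E u) = 0"
      then obtain n :: nat where "q ^ n * E u = 1" using hz by auto
      then show ?thesis using that[of "int n"] by simp
    next
      assume "h (q / E u) = 0"
      then obtain n :: nat where "q ^ n * (q / E u) = 1" using hz by auto
      then have "q ^ Suc n = E u" using E0 by (simp add: field_simps)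
      then have "inverse (q ^ Suc n) * E u = 1" using E0 q0 by (simp add: field_simps)
      then show ?thesis using that[of "- int (Suc n)"] by (simp only: power_int_minus power_int_of_nat)
    qed
    have qn: "q powi n = exp (of_int n * of_real (- 2 * pi * b / a))"
      unfolding q_def exp_of_real[symmetric]
      by (metis exp_power_int mult.commute)
    have "exp (of_int n * of_real (- 2 * pi * b / a) + 2 * of_real pi * \<i> * u / of_real a) = 1"
      using n by (simp only: qn E_def exp_add)
    then obtain k :: int where
       "Re (of_int n * of_real (- 2 * pi * b / a) + 2 * of_real pi * \<i> * u / of_real a) = 0"
       "Im (of_int n * of_real (- 2 * pi * b / a) + 2 * of_real pi * \<i> * u / of_real a) = of_int (2 * k) * pi"
      unfolding exp_eq_1 by auto
    then have "(2 * pi / a) * (Im u + b * of_int n) = 0" and Re: "Re u = a * of_int k"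
      using ab by (simp_all add: Re_divide_of_real Im_divide_of_real field_simps)
    then have "Im u = b * of_int (- n)" using ab by simp
    then have "u = Complex (a * of_int k) (b * of_int (- n))" using Re by (simp add: complex_eq_iff)
    then show "u \<in> rect_lattice a b" by (simp only: rect_latticeI)
  qed
  have "deriv S 0 \<noteq> 0"
  proof -
    \<comment> \<open>The functional equation of \<open>h\<close> extracts the factor
      \<open>1 - E u\<close>, which has a simple zero at 0, and leaves the cofactor with value
      \<open>h q * h q\<close> at 0.\<close>
    define R where "R = (\<lambda>u. h (q * E u) * h (q / E u) * exp (G u))"
    have "S = (\<lambda>u. (1 - E u) * R u)"
      unfolding S_def T_def R_def by (subst h(3)) (simp add: mult_ac)
    moreover have "R holomorphic_on UNIV"
    proof -
      have "h \<circ> (\<lambda>u. q * E u) holomorphic_on UNIV" "h \<circ> (\<lambda>u. q / E u) holomorphic_on UNIV"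
        using h(1) ab unfolding E_def by (auto intro!: holomorphic_on_compose holomorphic_intros holomorphic_on_subset[OF h(1)])
      then have "(\<lambda>u. (h \<circ> (\<lambda>u. q * E u)) u * (h \<circ> (\<lambda>u. q / E u)) u * exp (G u)) holomorphic_on UNIV"
        unfolding G_def using ab by (intro holomorphic_intros) (auto simp: o_def)
      then show ?thesis by (simp add: R_def)
    qed
    then have R': "(R has_field_derivative deriv R 0) (at 0)"
      by (metis UNIV_I holomorphic_derivI open_UNIV)
    have "((\<lambda>u. 1 - E u) has_field_derivative - (2 * of_real pi * \<i> / of_real a)) (at 0)"
      unfolding E_def using ab by (auto intro!: derivative_eq_intros)
    from DERIV_mult[OF this R'] have "((\<lambda>u. (1 - E u) * R u) has_field_derivative - (2 * of_real pi * \<i> / of_real a) * R 0) (at 0)"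
      by (simp add: E_def)
    ultimately have "deriv S 0 = - (2 * of_real pi * \<i> / of_real a) * R 0"
      using DERIV_imp_deriv by blast
    moreover have "h q \<noteq> 0"
    proof
      assume "h q = 0"
      then obtain n where "q ^ n * q = 1" using hz by auto
      then have "cmod q ^ Suc n = 1" by (metis norm_one norm_power power_Suc2)
      moreover have "cmod q ^ Suc n \<le> cmod q ^ 1" using q1 by (intro power_decreasing) auto
      ultimately show False using q1 by simp
    qed
    ultimately show ?thesis using ab by (simp add: R_def E_def)
  qed
  then show ?thesis using that[of S] hol zero per unfolding P_def by blast
qed

section \<open>Gaussian sums over integers and planar lattices\<close>

lemma int_geometric_sum_bound:
  fixes r :: real
  assumes r: "0 \<le> r" "r < 1" and F: "finite (F :: int set)"
  shows "(\<Sum>m\<in>F. r ^ nat \<bar>m\<bar>) \<le> 2 / (1 - r)"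
proof -
  have nat_bound: "(\<Sum>n\<in>G. r ^ n) \<le> 1 / (1 - r)" if "finite G" for G :: "nat set"
    using sum_le_suminf[OF _ that, of "\<lambda>n. r ^ n"] r suminf_geometric[of r] by (simp add: summable_geometric)
  define F1 F2 where "F1 = {m \<in> F. m \<ge> 0}" and "F2 = {m \<in> F. m < 0}"
  have fin: "finite F1" "finite F2" using F by (auto simp: F1_def F2_def)
  have inj: "inj_on (\<lambda>m::int. nat \<bar>m\<bar>) F1" "inj_on (\<lambda>m::int. nat \<bar>m\<bar>) F2"
    by (auto simp: inj_on_def F1_def F2_def)
  have "(\<Sum>m\<in>F. r ^ nat \<bar>m\<bar>) = (\<Sum>m\<in>F1. r ^ nat \<bar>m\<bar>) + (\<Sum>m\<in>F2. r ^ nat \<bar>m\<bar>)"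
    using fin by (subst sum.union_disjoint[symmetric]) (auto simp: F1_def F2_def intro!: sum.cong)
  also have "\<dots> = (\<Sum>n\<in>(\<lambda>m::int. nat \<bar>m\<bar>) ` F1. r ^ n) + (\<Sum>n\<in>(\<lambda>m::int. nat \<bar>m\<bar>) ` F2. r ^ n)"
    using inj by (simp add: sum.reindex)
  also have "\<dots> \<le> 1 / (1 - r) + 1 / (1 - r)"
    using fin by (intro add_mono nat_bound) auto
  finally show ?thesis by simp
qed

text \<open>The inequality \<open>0 \<le> (s |m| - 1)^2\<close> with
  \<open>s = sqrt \<delta>\<close> dominates the Gaussian by a geometric sequence of ratio
  \<open>exp (- 2 * s)\<close>. The explicit order \<open>1 / sqrt \<delta>\<close> matters: at
  critical density \<open>\<delta>\<close> tends to 0 and a planar sum, having two such factors, may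
  grow only like \<open>1 / \<delta>\<close>.\<close>

lemma int_gauss_sum_bound:
  fixes \<delta> :: real
  assumes \<delta>: "\<delta> > 0" and F: "finite (F :: int set)"
  shows "(\<Sum>m\<in>F. exp (- \<delta> * (of_int m)\<^sup>2)) \<le> exp 1 * (2 + 1 / sqrt \<delta>)"
proof -
  define s where "s = sqrt \<delta>"
  have s: "s > 0" "s\<^sup>2 = \<delta>" using \<delta> by (auto simp: s_def)
  have term_le: "exp (- \<delta> * (of_int m)\<^sup>2) \<le> exp 1 * exp (- 2 * s) ^ nat \<bar>m\<bar>" for m :: int
  proof -
    have "0 \<le> (s * \<bar>of_int m\<bar> - 1)\<^sup>2" by simp
    then have "- \<delta> * (of_int m)\<^sup>2 \<le> 1 + of_nat (nat \<bar>m\<bar>) * (- 2 * s)"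
      by (simp add: power2_diff power_mult_distrib s algebra_simps)
    then show ?thesis by (simp only: exp_le_cancel_iff flip: exp_of_nat_mult exp_add)
  qed
  have "(\<Sum>m\<in>F. exp (- \<delta> * (of_int m)\<^sup>2)) \<le> (\<Sum>m\<in>F. exp 1 * exp (- 2 * s) ^ nat \<bar>m\<bar>)"
    by (intro sum_mono term_le)
  also have "\<dots> = exp 1 * (\<Sum>m\<in>F. exp (- 2 * s) ^ nat \<bar>m\<bar>)"
    by (simp add: sum_distrib_left)
  also have "\<dots> \<le> exp 1 * (2 / (1 - exp (- 2 * s)))"
    using s by (intro mult_left_mono int_geometric_sum_bound F) auto
  also have "2 / (1 - exp (- 2 * s)) \<le> 2 + 1 / s"
  proof -
    have "1 + 2 * s \<le> exp (2 * s)" by (rule exp_ge_add_one_self)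
    then have "exp (- 2 * s) \<le> 1 / (1 + 2 * s)"
      using s by (simp add: exp_minus field_simps)
    then have "2 * s / (1 + 2 * s) \<le> 1 - exp (- 2 * s)"
      using s by (simp add: field_simps)
    then have "2 / (1 - exp (- 2 * s)) \<le> 2 / (2 * s / (1 + 2 * s))"
      using s by (intro divide_left_mono mult_pos_pos) auto
    also have "\<dots> = 2 + 1 / s" using s by (simp add: field_simps)
    finally show ?thesis .
  qed
  finally show ?thesis by (simp add: s_def)
qed

text \<open>A finite set of lattice points lies in a product of two finite sets of integer
  coordinates, over which the Gaussian factors.\<close>

lemma rect_lattice_gauss_sum_bound:
  fixes a b c :: real
  assumes ab: "a > 0" "b > 0" "c > 0" and F: "finite F" "F \<subseteq> rect_lattice a b"
  shows "(\<Sum>l\<in>F. exp (- c * (cmod l)\<^sup>2)) \<le> (exp 1 * (2 + 1 / sqrt (c * a\<^sup>2))) * (exp 1 * (2 + 1 / sqrt (c * b\<^sup>2)))"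
proof -
  define M N where "M = (\<lambda>l. \<lfloor>Re l / a\<rfloor>) ` F" and "N = (\<lambda>l. \<lfloor>Im l / b\<rfloor>) ` F"
  define L where "L = (\<lambda>(m::int, n::int). Complex (a * of_int m) (b * of_int n))"
  have fin: "finite M" "finite N" using F by (auto simp: M_def N_def)
  have sub: "F \<subseteq> L ` (M \<times> N)"
  proof
    fix l assume l: "l \<in> F"
    then obtain m n where mn: "l = Complex (a * of_int m) (b * of_int n)" using F l unfolding rect_lattice_def by blast
    then have "\<lfloor>Re l / a\<rfloor> = m" "\<lfloor>Im l / b\<rfloor> = n" using ab by auto
    then have "m \<in> M" "n \<in> N" using l unfolding M_def N_def by blast+
    then show "l \<in> L ` (M \<times> N)" using mn by (force simp: L_def)
  qed
  have inj: "inj_on L (M \<times> N)" using ab by (auto simp: inj_on_def L_def)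
  have "(\<Sum>l\<in>F. exp (- c * (cmod l)\<^sup>2)) \<le> (\<Sum>l\<in>L ` (M \<times> N). exp (- c * (cmod l)\<^sup>2))"
    using fin sub by (intro sum_mono2) auto
  also have "\<dots> = (\<Sum>(m, n)\<in>M \<times> N. exp (- (c * a\<^sup>2) * (of_int m)\<^sup>2) * exp (- (c * b\<^sup>2) * (of_int n)\<^sup>2))"
    by (subst sum.reindex[OF inj]) (auto intro!: sum.cong simp: L_def cmod_power2 power_mult_distrib algebra_simps simp flip: exp_add)
  also have "\<dots> = (\<Sum>m\<in>M. exp (- (c * a\<^sup>2) * (of_int m)\<^sup>2)) * (\<Sum>n\<in>N. exp (- (c * b\<^sup>2) * (of_int n)\<^sup>2))"
    by (simp add: sum_product sum.cartesian_product)
  also have "\<dots> \<le> (exp 1 * (2 + 1 / sqrt (c * a\<^sup>2))) * (exp 1 * (2 + 1 / sqrt (c * b\<^sup>2)))"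
    using ab fin by (intro mult_mono int_gauss_sum_bound sum_nonneg mult_nonneg_nonneg add_nonneg_nonneg) auto
  finally show ?thesis .
qed

lemma rect_lattice_gauss_summable:
  fixes a b c :: real
  assumes ab: "a > 0" "b > 0" "c > 0"
  shows "(\<lambda>l. exp (- c * (cmod l)\<^sup>2)) summable_on rect_lattice a b"
proof (rule nonneg_bdd_above_summable_on)
  show "bdd_above (sum (\<lambda>l. exp (- c * (cmod l)\<^sup>2)) ` {F. F \<subseteq> rect_lattice a b \<and> finite F})"
    by (rule bdd_aboveI2[OF rect_lattice_gauss_sum_bound[OF ab]]) auto
qed simp

lemma rect_lattice_cell:
  fixes a b :: real
  assumes ab: "a > 0" "b > 0"
  obtains l where "l \<in> rect_lattice a b" "\<bar>Re (u - l)\<bar> \<le> a / 2" "\<bar>Im (u - l)\<bar> \<le> b / 2"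
proof -
  define l where "l = Complex (a * of_int (round (Re u / a))) (b * of_int (round (Im u / b)))"
  have r: "\<bar>x - c * of_int (round (x / c))\<bar> \<le> c / 2" if "c > 0" for x c :: real
  proof -
    have "\<bar>c * (of_int (round (x / c)) - x / c)\<bar> \<le> c * (1 / 2)"
      using of_int_round_abs_le[of "x / c"] that unfolding abs_mult by (intro mult_mono) auto
    then show ?thesis using that by (simp add: right_diff_distrib abs_minus_commute)
  qed
  show ?thesis
    by (rule that[of l]) (use r[OF ab(1), of "Re u"] r[OF ab(2), of "Im u"] in \<open>auto simp: l_def rect_latticeI\<close>)
qed

lemma exp_linear_minus_quadratic_le:
  fixes c k r :: real
  assumes "c > 0"
  shows "exp (k * r - c * r\<^sup>2) \<le> exp (k\<^sup>2 / (2 * c)) * exp (- (c / 2) * r\<^sup>2)"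
proof -
  have "0 \<le> (k - c * r)\<^sup>2 / (2 * c)" using assms by simp
  also have "\<dots> = k\<^sup>2 / (2 * c) + (c / 2) * r\<^sup>2 - k * r"
    using assms by (simp add: power2_eq_square field_simps)
  finally show ?thesis by (simp flip: exp_add)
qed

section \<open>Upper and lower estimates for a fixed sigma function\<close>

locale sigma_function =
  fixes a b :: real and S :: "complex \<Rightarrow> complex"
  assumes ab: "a > 0" "b > 0"
    and hol: "S holomorphic_on UNIV"
    and zero: "\<And>u. S u = 0 \<longleftrightarrow> u \<in> rect_lattice a b"
    and simple: "deriv S 0 \<noteq> 0"
    and periodic: "\<And>u l. l \<in> rect_lattice a b \<Longrightarrow>
       cmod (S (u + l)) * exp (- pi / (2 * a * b) * (cmod (u + l))\<^sup>2) = cmod (S u) * exp (- pi / (2 * a * b) * (cmod u)\<^sup>2)"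
begin

text \<open>A doubly periodic function, by the hypothesis \<open>periodic\<close>.\<close>

definition P where "P u = cmod (S u) * exp (- pi / (2 * a * b) * (cmod u)\<^sup>2)"

lemma P_periodic: "l \<in> rect_lattice a b \<Longrightarrow> P (u + l) = P u"
  using periodic by (simp add: P_def)

lemma P_periodic': "l \<in> rect_lattice a b \<Longrightarrow> P (u - l) = P u"
  using P_periodic[OF rect_lattice_uminus, of l u] by simp

lemma S_eq: "cmod (S u) = P u * exp (pi / (2 * a * b) * (cmod u)\<^sup>2)"
  by (simp add: P_def flip: exp_add)

lemma cont: "continuous_on A S"
  using hol holomorphic_on_imp_continuous_on continuous_on_subset by blast

lemma P_cont: "continuous_on A P"
  unfolding P_def by (intro continuous_intros cont)

lemma P_eq_0: "P u = 0 \<longleftrightarrow> u \<in> rect_lattice a b"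
  by (simp add: P_def zero)

lemma P_nonneg: "P u \<ge> 0"
  by (simp add: P_def)

lemma S_deriv: "(S has_field_derivative deriv S u) (at u)"
  using hol holomorphic_derivI by blast

definition cell where "cell = {u. \<bar>Re u\<bar> \<le> a / 2 \<and> \<bar>Im u\<bar> \<le> b / 2}"

lemma compact_cell: "compact cell"
proof -
  have "cell = cbox (Complex (- a / 2) (- b / 2)) (Complex (a / 2) (b / 2))"
    by (auto simp: cell_def in_cbox_complex_iff)
  then show ?thesis by simp
qed

lemma P_bounded: obtains M where "M > 0" "\<And>u. P u \<le> M"
proof -
  have "bounded (P ` cell)"
    using compact_continuous_image[OF P_cont compact_cell] compact_imp_bounded by blast
  then obtain M where M: "M > 0" "\<And>u. u \<in> cell \<Longrightarrow> P u \<le> M"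
    unfolding bounded_pos by force
  show ?thesis
  proof (rule that[OF M(1)])
    fix u
    obtain l where l: "l \<in> rect_lattice a b" "\<bar>Re (u - l)\<bar> \<le> a / 2" "\<bar>Im (u - l)\<bar> \<le> b / 2"
      using rect_lattice_cell[OF ab] by blast
    then show "P u \<le> M" using M(2)[of "u - l"] P_periodic'[of l u] by (simp add: cell_def)
  qed
qed

text \<open>The horizontal and vertical lines halfway between lattice points avoid the lattice.
  Modulo periods they form a compact set on which the continuous function \<open>P\<close> has no
  zero. These lines carry the contours of the interpolation formula.\<close>

lemma P_grid_bound:
  obtains p where "p > 0"
    "\<And>u m. Re u = a * (of_int m + 1 / 2) \<Longrightarrow> p \<le> P u" "\<And>u n. Im u = b * (of_int n + 1 / 2) \<Longrightarrow> p \<le> P u"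
proof -
  define K where "K = cell \<inter> ({u. Re u = a / 2} \<union> {u. Im u = b / 2})"
  have "compact K" unfolding K_def
    by (intro compact_Int_closed compact_cell closed_Un closed_Collect_eq continuous_intros)
  moreover have "Complex (a / 2) 0 \<in> K" using ab by (simp add: K_def cell_def)
  ultimately obtain u0 where u0: "u0 \<in> K" "\<And>u. u \<in> K \<Longrightarrow> P u0 \<le> P u"
    using continuous_attains_inf[of K P] P_cont by blast
  have half: "c / 2 \<noteq> c * of_int m" if "c > 0" for c :: real and m :: int
  proof
    assume "c / 2 = c * of_int m"
    then have "of_int (2 * m) = (of_int 1 :: real)" using that by simp
    then have "2 * m = 1" by (simp only: of_int_eq_iff)
    then show False by presburger
  qed
  have "P u0 \<noteq> 0"
    using u0(1) half[OF ab(1)] half[OF ab(2)] unfolding P_eq_0 K_def rect_lattice_def by auto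
  then have pos: "P u0 > 0" using P_nonneg[of u0] by simp
  show ?thesis
  proof (rule that[OF pos])
    fix u and m :: int assume Re: "Re u = a * (of_int m + 1 / 2)"
    obtain l where l: "l \<in> rect_lattice a b" "\<bar>Re (u - l)\<bar> \<le> a / 2" "\<bar>Im (u - l)\<bar> \<le> b / 2"
      using rect_lattice_cell[OF ab] by blast
    \<comment> \<open>The nearest lattice point may leave \<open>Re (u - l) = - a / 2\<close>.
      Changing its real part to \<open>a * m\<close> makes the difference exactly
      \<open>a / 2\<close>, the edge included in \<open>K\<close>.\<close>
    define l' where "l' = Complex (a * of_int m) (Im l)"
    have "l' \<in> rect_lattice a b" using l(1) by (auto simp: l'_def rect_lattice_def)
    moreover have "u - l' \<in> K" using l Re ab by (auto simp: K_def cell_def l'_def distrib_left)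
    ultimately show "P u0 \<le> P u" using u0(2)[of "u - l'"] P_periodic' by simp
  next
    fix u and n :: int assume Im: "Im u = b * (of_int n + 1 / 2)"
    obtain l where l: "l \<in> rect_lattice a b" "\<bar>Re (u - l)\<bar> \<le> a / 2" "\<bar>Im (u - l)\<bar> \<le> b / 2"
      using rect_lattice_cell[OF ab] by blast
    define l' where "l' = Complex (Re l) (b * of_int n)"
    have "l' \<in> rect_lattice a b" using l(1) by (auto simp: l'_def rect_lattice_def)
    moreover have "u - l' \<in> K" using l Im ab by (auto simp: K_def cell_def l'_def distrib_left)
    ultimately show "P u0 \<le> P u" using u0(2)[of "u - l'"] P_periodic' by simp
  qed
qed

text \<open>Periodicity compares the difference quotients at \<open>l\<close> and at 0: their moduli
  differ by the factor \<open>exp (c * (|l + h|^2 - |h|^2))\<close> with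
  \<open>c = pi / (2 * a * b)\<close>, whose limit for \<open>h\<close> tending to 0 is the stated
  exponential.\<close>

lemma deriv_lattice:
  assumes l: "l \<in> rect_lattice a b"
  shows "cmod (deriv S l) = cmod (deriv S 0) * exp (pi / (2 * a * b) * (cmod l)\<^sup>2)"
proof -
  have lim: "((\<lambda>h. cmod ((S (x + h) - S x) / h)) \<longlongrightarrow> cmod (deriv S x)) (at 0)" for x
    using S_deriv[of x] unfolding DERIV_def by (rule tendsto_norm)
  have l0: "S l = 0" "S 0 = 0" using zero l rect_lattice_0 by auto
  have "cmod ((S (l + h) - S l) / h) = cmod ((S (0 + h) - S 0) / h) * exp (pi / (2 * a * b) * ((cmod (l + h))\<^sup>2 - (cmod h)\<^sup>2))" for h
    using P_periodic[OF l, of h] S_eq[of "l + h"] S_eq[of h]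
    by (simp add: l0 norm_divide add.commute right_diff_distrib exp_diff)
  moreover have "((\<lambda>h. cmod ((S (0 + h) - S 0) / h) * exp (pi / (2 * a * b) * ((cmod (l + h))\<^sup>2 - (cmod h)\<^sup>2)))
      \<longlongrightarrow> cmod (deriv S 0) * exp (pi / (2 * a * b) * ((cmod (l + 0))\<^sup>2 - (cmod 0)\<^sup>2))) (at 0)"
    by (intro tendsto_mult lim tendsto_intros)
  ultimately have "((\<lambda>h. cmod ((S (l + h) - S l) / h)) \<longlongrightarrow> cmod (deriv S 0) * exp (pi / (2 * a * b) * (cmod l)\<^sup>2)) (at 0)"
    by simp
  from tendsto_unique[OF _ lim[of l] this] show ?thesis by simp
qed

lemma deriv_lattice_nz: "l \<in> rect_lattice a b \<Longrightarrow> deriv S l \<noteq> 0"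
  using deriv_lattice[of l] simple by auto

end

section \<open>Interpolation of exponentials\<close>

context sigma_function
begin

definition c where "c = pi / (2 * a * b)"

lemma c_pos: "c > 0" using ab by (simp add: c_def)

text \<open>All decay in \<open>l\<close> comes from \<open>1 / S'(l)\<close>. The rest is uniform
  because \<open>S\<close> vanishes at \<open>l\<close>, so \<open>S v / (v - l)\<close> stays
  bounded even when \<open>v\<close> approaches the lattice.\<close>

lemma lagrange_coeff_bound:
  obtains B where "B > 0"
   "\<And>v l. v \<in> cball 0 R \<Longrightarrow> v \<notin> rect_lattice a b \<Longrightarrow> l \<in> rect_lattice a b \<Longrightarrow>
      cmod (S v / (deriv S l * (v - l))) \<le> B * exp (- c * (cmod l)\<^sup>2)"
proof -
  have "compact (S ` cball 0 R)" by (intro compact_continuous_image cont) auto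
  then obtain M where M: "M > 0" "\<And>v. v \<in> cball 0 R \<Longrightarrow> cmod (S v) \<le> M"
    by (auto simp: bounded_pos dest!: compact_imp_bounded)
  have "continuous_on (cball 0 (R + 1)) (deriv S)"
    by (meson hol holomorphic_deriv holomorphic_on_imp_continuous_on continuous_on_subset open_UNIV subset_UNIV)
  then have "compact (deriv S ` cball 0 (R + 1))" by (intro compact_continuous_image) auto
  then obtain L where L: "L > 0" "\<And>v. v \<in> cball 0 (R + 1) \<Longrightarrow> cmod (deriv S v) \<le> L"
    by (auto simp: bounded_pos dest!: compact_imp_bounded)
  define B where "B = (M + L) / cmod (deriv S 0)"
  show ?thesis
  proof
    show "B > 0" using M L simple by (simp add: B_def)
    fix v l assume v: "v \<in> cball 0 R" "v \<notin> rect_lattice a b" and l: "l \<in> rect_lattice a b"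
    have ne: "v - l \<noteq> 0" using v l by auto
    have "cmod (S v) \<le> (M + L) * cmod (v - l)"
    \<comment> \<open>At distance at least 1 the bound \<open>M\<close> on \<open>S\<close>
      suffices. Closer to \<open>l\<close> the mean value inequality applies on the disc of radius
      \<open>R + 1\<close>, which then contains \<open>l\<close>.\<close>
    proof (cases "cmod (v - l) \<ge> 1")
      case True
      have "cmod (S v) \<le> M * 1" using M v by simp
      also have "\<dots> \<le> (M + L) * cmod (v - l)" using True M L by (intro mult_mono) auto
      finally show ?thesis .
    next
      case False
      then have "l \<in> cball 0 (R + 1)"
        using v norm_triangle_sub[of l v] by (auto simp: dist_norm norm_minus_commute)
      moreover have "v \<in> cball 0 (R + 1)" using v by auto
      ultimately have "cmod (S v - S l) \<le> L * cmod (v - l)"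
        using field_differentiable_bound[of "cball 0 (R + 1)" S "deriv S" L v l] L
          has_field_derivative_at_within[OF S_deriv] by auto
      moreover have "S l = 0" using zero l by simp
      moreover have "L * cmod (v - l) \<le> (M + L) * cmod (v - l)" using M by (intro mult_right_mono) auto
      ultimately show ?thesis by simp
    qed
    then have "cmod (S v) / cmod (v - l) \<le> M + L" using ne by (simp add: pos_divide_le_eq)
    then have "cmod (S v) / cmod (v - l) / cmod (deriv S l) \<le> (M + L) / cmod (deriv S l)"
      by (rule divide_right_mono) simp
    then have "cmod (S v) / (cmod (deriv S l) * cmod (v - l)) \<le> (M + L) / cmod (deriv S l)"
      by (subst mult.commute) (simp only: divide_divide_eq_left)
    moreover have "(M + L) / cmod (deriv S l) = B * exp (- c * (cmod l)\<^sup>2)"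
    proof -
      have "exp (- c * (cmod l)\<^sup>2) = 1 / exp (c * (cmod l)\<^sup>2)"
        by (simp add: exp_minus inverse_eq_divide)
      then show ?thesis by (simp only: deriv_lattice[OF l] B_def c_def times_divide_times_eq mult_1_right)
    qed
    ultimately show "cmod (S v / (deriv S l * (v - l))) \<le> B * exp (- c * (cmod l)\<^sup>2)"
      by (simp only: norm_divide norm_mult)
  qed
qed

text \<open>The residue theorem for \<open>exp (w * z) / (S z * (z - u))\<close> on growing
  rectangles: the residue at \<open>u\<close> gives the value to be interpolated, those at lattice
  points the terms of the series. On the contour \<open>1 / |S|\<close> decays like a Gaussian,
  which beats both \<open>exp (|w| |z|)\<close> and the perimeter.\<close>

lemma lagrange_interpolation:
  assumes u: "u \<notin> rect_lattice a b"
  shows "((\<lambda>l. S u / (deriv S l * (u - l)) * exp (w * l)) has_sum exp (w * u)) (rect_lattice a b)"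
proof -
  define f where "f = (\<lambda>l. S u / (deriv S l * (u - l)) * exp (w * l))"
  have c: "c > 0" by (rule c_pos)
  have exp_le: "exp (cmod w * r) * exp (- c * r\<^sup>2) \<le> exp ((cmod w)\<^sup>2 / (2 * c)) * exp (- (c / 2) * r\<^sup>2)" for r
    using exp_linear_minus_quadratic_le[OF c, of "cmod w" r] by (simp add: exp_diff exp_minus field_simps)
  have expw: "cmod (exp (w * z)) \<le> exp (cmod w * cmod z)" for z
    by (metis norm_exp norm_mult)
  obtain B where B: "B > 0" "\<And>v l. v \<in> cball 0 (cmod u) \<Longrightarrow> v \<notin> rect_lattice a b \<Longrightarrow> l \<in> rect_lattice a b \<Longrightarrow>
      cmod (S v / (deriv S l * (v - l))) \<le> B * exp (- c * (cmod l)\<^sup>2)"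
    using lagrange_coeff_bound[of "cmod u"] by blast
  \<comment> \<open>Unconditional summability comes first, so that the sum may be evaluated along
    the particular exhaustion by rectangles.\<close>
  have "f summable_on rect_lattice a b"
  proof (rule abs_summable_summable, rule summable_on_comparison_test)
    show "(\<lambda>l. B * exp ((cmod w)\<^sup>2 / (2 * c)) * exp (- (c / 2) * (cmod l)\<^sup>2)) summable_on rect_lattice a b"
      using c by (intro summable_on_cmult_right rect_lattice_gauss_summable ab) auto
    fix l assume l: "l \<in> rect_lattice a b"
    have "cmod (f l) \<le> (B * exp (- c * (cmod l)\<^sup>2)) * exp (cmod w * cmod l)"
      unfolding f_def norm_mult[of _ "exp _"] using B u l expw by (intro mult_mono) auto
    also have "\<dots> \<le> B * (exp ((cmod w)\<^sup>2 / (2 * c)) * exp (- (c / 2) * (cmod l)\<^sup>2))"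
      using exp_le[of "cmod l"] B(1) by (simp add: mult_ac)
    finally show "cmod (f l) \<le> B * exp ((cmod w)\<^sup>2 / (2 * c)) * exp (- (c / 2) * (cmod l)\<^sup>2)" by (simp add: mult_ac)
  qed auto
  then obtain s where s: "(f has_sum s) (rect_lattice a b)" by (auto simp: summable_on_def)
  define L where "L = (\<lambda>N::nat. (\<lambda>(m, n). Complex (a * of_int m) (b * of_int n)) ` ({- int N..int N} \<times> {- int N..int N}))"
  have finL: "finite (L N)" for N by (auto simp: L_def)
  have subL: "L N \<subseteq> rect_lattice a b" for N by (auto simp: L_def rect_lattice_def)
  \<comment> \<open>The contour has half sides \<open>a * (N + 1/2)\<close> and
    \<open>b * (N + 1/2)\<close>. With \<open>N + 3/4\<close> instead, the open box contains the
    contour but no lattice point outside \<open>L N\<close>; any value strictly between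
    \<open>N + 1/2\<close> and \<open>N + 1\<close> would do.\<close>
  have L_iff: "l \<in> L N \<longleftrightarrow> l \<in> rect_lattice a b \<and> \<bar>Re l\<bar> < a * (real N + 3 / 4) \<and> \<bar>Im l\<bar> < b * (real N + 3 / 4)" for l N
  proof -
    have 1: "\<bar>x * of_int m\<bar> < x * (real N + 3 / 4) \<longleftrightarrow> m \<in> {- int N..int N}" if "x > 0" for x m
    proof -
      have "\<bar>x * of_int m\<bar> < x * (real N + 3 / 4) \<longleftrightarrow> \<bar>of_int m\<bar> < real N + 3 / 4"
        using that by (simp add: abs_mult)
      also have "\<dots> \<longleftrightarrow> m \<in> {- int N..int N}" by (auto simp: abs_less_iff)
      finally show ?thesis .
    qed
    show ?thesis
    proof
      assume "l \<in> L N"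
      then obtain p where p: "p \<in> {- int N..int N} \<times> {- int N..int N}"
          "l = (\<lambda>(m, n). Complex (a * of_int m) (b * of_int n)) p"
        unfolding L_def by blast
      define m n where "m = fst p" and "n = snd p"
      have "l = Complex (a * of_int m) (b * of_int n)" "m \<in> {- int N..int N}" "n \<in> {- int N..int N}"
        using p by (simp_all add: m_def n_def case_prod_unfold mem_Times_iff)
      then show "l \<in> rect_lattice a b \<and> \<bar>Re l\<bar> < a * (real N + 3 / 4) \<and> \<bar>Im l\<bar> < b * (real N + 3 / 4)"
        using 1[OF ab(1), of m] 1[OF ab(2), of n] by (simp add: rect_latticeI)
    next
      assume l: "l \<in> rect_lattice a b \<and> \<bar>Re l\<bar> < a * (real N + 3 / 4) \<and> \<bar>Im l\<bar> < b * (real N + 3 / 4)"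
      then obtain m n where mn: "l = Complex (a * of_int m) (b * of_int n)" unfolding rect_lattice_def by blast
      then have "(m, n) \<in> {- int N..int N} \<times> {- int N..int N}"
        using 1[OF ab(1), of m] 1[OF ab(2), of n] l by simp
      then show "l \<in> L N" unfolding L_def mn by (rule rev_image_eqI) simp
    qed
  qed
  have "filterlim L (finite_subsets_at_top (rect_lattice a b)) sequentially"
    unfolding filterlim_finite_subsets_at_top
  proof (intro allI impI)
    fix X assume X: "finite X \<and> X \<subseteq> rect_lattice a b"
    have "\<forall>l\<in>X. \<forall>\<^sub>F N in sequentially. l \<in> L N"
    proof
      fix l assume "l \<in> X"
      then have l: "l \<in> rect_lattice a b" using X by auto
      have "\<forall>\<^sub>F N in sequentially. \<bar>Re l\<bar> < a * (real N + 3 / 4)" "\<forall>\<^sub>F N in sequentially. \<bar>Im l\<bar> < b * (real N + 3 / 4)"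
        using ab by real_asymp+
      then show "\<forall>\<^sub>F N in sequentially. l \<in> L N"
        by eventually_elim (use l L_iff in auto)
    qed
    then have "\<forall>\<^sub>F N in sequentially. \<forall>l\<in>X. l \<in> L N" using X by (intro eventually_ball_finite) auto
    then show "\<forall>\<^sub>F N in sequentially. finite (L N) \<and> X \<subseteq> L N \<and> L N \<subseteq> rect_lattice a b"
      by eventually_elim (use finL subL in auto)
  qed
  then have lim1: "(\<lambda>N. sum f (L N)) \<longlonglongrightarrow> s"
    using s unfolding has_sum_def by (rule filterlim_compose[rotated])
  obtain p where p: "p > 0"
    "\<And>u m. Re u = a * (of_int m + 1 / 2) \<Longrightarrow> p \<le> P u" "\<And>u n. Im u = b * (of_int n + 1 / 2) \<Longrightarrow> p \<le> P u"
    using P_grid_bound by blast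
  define \<mu> where "\<mu> = min a b"
  have \<mu>: "\<mu> > 0" "\<mu> \<le> a" "\<mu> \<le> b" using ab by (auto simp: \<mu>_def)
  define K where "K = cmod (S u) * (exp ((cmod w)\<^sup>2 / (2 * c)) / p)"
  have K: "K \<ge> 0" using p by (simp add: K_def)
  define E where "E = (\<lambda>N. 4 * (K * exp (- (c / 2) * (\<mu> * (real N + 1 / 2))\<^sup>2)) * ((a + b) * (2 * real N + 1)))"
  have bound: "cmod (exp (w * u) - sum f (L N)) \<le> E N"
    if N: "\<bar>Re u\<bar> < a * (real N + 1 / 2)" "\<bar>Im u\<bar> < b * (real N + 1 / 2)" "cmod u + 1 \<le> \<mu> * (real N + 1 / 2)" for N
  proof -
    define F where "F = (\<lambda>z. exp (w * z) / (S z * (z - u)))"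
    define h where "h = real N + 1 / 2"
    have h: "h > 0" by (simp add: h_def)
    define a1 a3 where "a1 = Complex (- a * h) (- b * h)" and "a3 = Complex (a * h) (b * h)"
    define a2 a4 where "a2 = Complex (a * h) (- b * h)" and "a4 = Complex (- a * h) (b * h)"
    define D where "D = box (Complex (- a * (real N + 3 / 4)) (- b * (real N + 3 / 4))) (Complex (a * (real N + 3 / 4)) (b * (real N + 3 / 4)))"
    have D_iff: "z \<in> D \<longleftrightarrow> \<bar>Re z\<bar> < a * (real N + 3 / 4) \<and> \<bar>Im z\<bar> < b * (real N + 3 / 4)" for z
      by (auto simp: D_def in_box_complex_iff)
    have hD: "a * h < a * (real N + 3 / 4)" "b * h < b * (real N + 3 / 4)" using ab by (auto simp: h_def)
    have le: "Re a1 < Re a3" "Im a1 < Im a3" using mult_pos_pos[OF ab(1) h] mult_pos_pos[OF ab(2) h] by (simp_all add: a1_def a3_def)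
    have pimg: "path_image (rectpath a1 a3) =
           {z. (Re z = - a * h \<or> Re z = a * h) \<and> \<bar>Im z\<bar> \<le> b * h} \<union> {z. (Im z = - b * h \<or> Im z = b * h) \<and> \<bar>Re z\<bar> \<le> a * h}"
    proof -
      have abs: "\<bar>x\<bar> \<le> y \<longleftrightarrow> x \<in> {- y..y}" for x y :: real by auto
      show ?thesis unfolding abs using le by (simp add: path_image_rectpath a1_def a3_def)
    qed
    have Lbox: "\<bar>Re l\<bar> < a * h \<and> \<bar>Im l\<bar> < b * h" if lN: "l \<in> L N" for l
    proof -
      obtain m n where mn: "l = Complex (a * of_int m) (b * of_int n)" "- int N \<le> m" "m \<le> int N" "- int N \<le> n" "n \<le> int N"
        using lN ab by (auto simp: L_def)
      have "\<bar>real_of_int m\<bar> < h" "\<bar>real_of_int n\<bar> < h" using mn(2-5) by (auto simp: h_def abs_less_iff)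
      then show ?thesis using ab by (simp add: mn abs_mult)
    qed
    have inbox: "z \<in> box a1 a3 \<longleftrightarrow> \<bar>Re z\<bar> < a * h \<and> \<bar>Im z\<bar> < b * h" for z
      by (auto simp: in_box_complex_iff a1_def a3_def)
    have uL: "u \<notin> L N" using u subL by auto
    have Sz: "S z \<noteq> 0" if "z \<in> D" "z \<notin> L N" for z using that zero L_iff D_iff by auto
    have holF: "F holomorphic_on A" if "A \<subseteq> D - insert u (L N)" for A
      unfolding F_def using that Sz by (intro holomorphic_intros holomorphic_on_subset[OF hol]) auto
    have inner: "\<bar>Re z\<bar> < a * h \<and> \<bar>Im z\<bar> < b * h" if "z \<in> insert u (L N)" for z
      using that Lbox N(1,2) unfolding h_def by auto
    have edge: "(\<bar>Re z\<bar> = a * h \<or> \<bar>Im z\<bar> = b * h) \<and> \<bar>Re z\<bar> \<le> a * h \<and> \<bar>Im z\<bar> \<le> b * h"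
      if "z \<in> path_image (rectpath a1 a3)" for z
      using that mult_pos_pos[OF ab(1) h] mult_pos_pos[OF ab(2) h] unfolding pimg by auto
    have pD: "path_image (rectpath a1 a3) \<subseteq> D - insert u (L N)"
    proof
      fix z assume z: "z \<in> path_image (rectpath a1 a3)"
      have "z \<in> D" using edge[OF z] hD unfolding D_iff by linarith
      moreover have "z \<notin> insert u (L N)" using edge[OF z] inner[of z] by linarith
      ultimately show "z \<in> D - insert u (L N)" by simp
    qed
    have "contour_integral (rectpath a1 a3) F = 2 * pi * \<i> * (\<Sum>z\<in>insert u (L N). winding_number (rectpath a1 a3) z * residue F z)"
    proof (rule Residue_theorem[where S = D])
      show "open D" "connected D" by (auto simp: D_def convex_connected)
      show "F holomorphic_on D - insert u (L N)" by (rule holF) simp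
      show "\<forall>z. z \<notin> D \<longrightarrow> winding_number (rectpath a1 a3) z = 0"
      proof (intro allI impI winding_number_rectpath_outside)
        show "Re a1 \<le> Re a3" "Im a1 \<le> Im a3" using le by auto
        show "z \<notin> cbox a1 a3" if "z \<notin> D" for z
          using that hD by (auto simp: D_iff in_cbox_complex_iff a1_def a3_def)
      qed
    qed (use finL pD in auto)
    also have "(\<Sum>z\<in>insert u (L N). winding_number (rectpath a1 a3) z * residue F z) = (\<Sum>z\<in>insert u (L N). residue F z)"
    proof (intro sum.cong refl)
      fix z assume "z \<in> insert u (L N)"
      then have "z \<in> box a1 a3" using inner[of z] by (simp add: inbox)
      then show "winding_number (rectpath a1 a3) z * residue F z = residue F z"
        by (simp add: winding_number_rectpath)
    qed
    also have "\<dots> = residue F u + (\<Sum>z\<in>L N. residue F z)" using uL finL by simp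
    also have "residue F u = exp (w * u) / S u"
    proof -
      have "open (D - L N)" using finL by (intro open_Diff finite_imp_closed) (auto simp: D_def)
      moreover have "u \<in> D - L N" using uL inner[of u] hD by (auto simp: D_iff)
      moreover have "(\<lambda>z. exp (w * z) / S z) holomorphic_on (D - L N)"
        using Sz by (intro holomorphic_intros holomorphic_on_subset[OF hol]) auto
      ultimately have "residue (\<lambda>z. exp (w * z) / S z / (z - u)) u = exp (w * u) / S u"
        by (rule residue_simple)
      then show ?thesis by (simp add: F_def)
    qed
    also have "(\<Sum>z\<in>L N. residue F z) = (\<Sum>z\<in>L N. - (f z / S u))"
    proof (intro sum.cong refl)
      fix l assume l: "l \<in> L N"
      then have lu: "l \<noteq> u" using uL by auto
      have "residue (\<lambda>z. (exp (w * z) / (z - u)) / S z) l = (exp (w * l) / (l - u)) / deriv S l"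
      proof (rule residue_simple_pole_deriv[where s = "ball l (dist l u)"])
        show "(\<lambda>z. exp (w * z) / (z - u)) holomorphic_on ball l (dist l u)"
          by (intro holomorphic_intros) auto
        show "S l = 0" "deriv S l \<noteq> 0" using zero l subL deriv_lattice_nz by auto
      qed (use lu S_deriv hol in \<open>auto intro: holomorphic_on_subset\<close>)
      also have "\<dots> = - (f l / S u)"
        using zero[of u] u by (subst minus_diff_eq[symmetric, of l u]) (simp del: minus_diff_eq add: mult.commute f_def)
      finally show "residue F l = - (f l / S u)" by (simp add: F_def field_simps)
    qed
    finally have int: "contour_integral (rectpath a1 a3) F = 2 * pi * \<i> * ((exp (w * u) - sum f (L N)) / S u)"
      by (simp add: sum_negf sum_divide_distrib diff_divide_distrib)
    \<comment> \<open>Contour points have modulus at least \<open>\<mu> * h\<close>. Completing the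
      square spends half of the Gaussian decay on \<open>exp (|w| |z|)\<close> and leaves the rate
      \<open>c / 2\<close>.\<close>
    define G where "G = exp ((cmod w)\<^sup>2 / (2 * c)) / p * exp (- (c / 2) * (\<mu> * h)\<^sup>2)"
    have G: "G \<ge> 0" using p by (simp add: G_def)
    have Fb: "cmod (F z) \<le> G" if z: "z \<in> path_image (rectpath a1 a3)" for z
    proof -
      have "p \<le> P z"
        using z unfolding pimg h_def
        using p(2)[of z "- int N - 1"] p(2)[of z "int N"] p(3)[of z "- int N - 1"] p(3)[of z "int N"]
        by (auto simp: algebra_simps)
      then have "p * exp (c * (cmod z)\<^sup>2) \<le> cmod (S z)" by (simp add: S_eq c_def)
      \<comment> \<open>Each side lies at distance at least \<open>\<mu> * h\<close> from the
        origin. This also keeps the contour at distance at least 1 from \<open>u\<close>, by the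
        third assumption on \<open>N\<close>.\<close>
      moreover have zh: "\<mu> * h \<le> cmod z"
      proof -
        have "\<mu> * h \<le> a * h" "\<mu> * h \<le> b * h" using \<mu> h by (auto intro!: mult_right_mono)
        moreover have "a * h \<le> cmod z \<or> b * h \<le> cmod z"
          using z abs_Re_le_cmod[of z] abs_Im_le_cmod[of z] unfolding pimg by auto
        ultimately show ?thesis by auto
      qed
      moreover have "1 \<le> cmod (z - u)"
        using zh N(3) norm_triangle_ineq2[of z u] by (simp add: h_def)
      ultimately have "p * exp (c * (cmod z)\<^sup>2) * 1 \<le> cmod (S z) * cmod (z - u)"
        using p by (intro mult_mono) auto
      then have "cmod (F z) \<le> exp (cmod w * cmod z) / (p * exp (c * (cmod z)\<^sup>2) * 1)"
        unfolding F_def norm_divide norm_mult[of "S z"] using p expw by (intro frac_le) auto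
      also have "\<dots> = (exp (cmod w * cmod z) * exp (- c * (cmod z)\<^sup>2)) / p"
        by (simp add: exp_minus field_simps)
      also have "\<dots> \<le> (exp ((cmod w)\<^sup>2 / (2 * c)) * exp (- (c / 2) * (cmod z)\<^sup>2)) / p"
        using p exp_le by (intro divide_right_mono) auto
      also have "\<dots> \<le> (exp ((cmod w)\<^sup>2 / (2 * c)) * exp (- (c / 2) * (\<mu> * h)\<^sup>2)) / p"
        using p c zh h \<mu> by (intro divide_right_mono mult_left_mono) (auto intro!: power_mono mult_left_mono)
      finally show ?thesis by (simp add: G_def)
    qed
    have rp: "rectpath a1 a3 = linepath a1 a2 +++ linepath a2 a3 +++ linepath a3 a4 +++ linepath a4 a1"
      by (simp add: rectpath_def Let_def a1_def a2_def a3_def a4_def)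
    have pi: "path_image (rectpath a1 a3) = closed_segment a1 a2 \<union> closed_segment a2 a3 \<union> closed_segment a3 a4 \<union> closed_segment a4 a1"
      unfolding rp by (simp add: path_image_join Un_assoc)
    have contF: "continuous_on (closed_segment x y) F" if "closed_segment x y \<subseteq> path_image (rectpath a1 a3)" for x y
      by (rule holomorphic_on_imp_continuous_on[OF holF]) (use that pD in blast)
    have ci: "F contour_integrable_on linepath x y" if "closed_segment x y \<subseteq> path_image (rectpath a1 a3)" for x y
      by (rule contour_integrable_continuous_linepath[OF contF[OF that]])
    have seg: "cmod (contour_integral (linepath x y) F) \<le> G * ((a + b) * (2 * h))"
      if "closed_segment x y \<subseteq> path_image (rectpath a1 a3)" "cmod (y - x) \<le> (a + b) * (2 * h)" for x y
    proof -
      have "cmod (contour_integral (linepath x y) F) \<le> G * cmod (y - x)"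
        using that(1) Fb by (intro contour_integral_bound_linepath ci G) auto
      also have "\<dots> \<le> G * ((a + b) * (2 * h))" using that(2) G by (rule mult_left_mono)
      finally show ?thesis .
    qed
    have len: "cmod z \<le> (a + b) * (2 * h)" if "\<bar>Re z\<bar> \<le> 2 * (a * h)" "\<bar>Im z\<bar> \<le> 2 * (b * h)" for z
      using cmod_le[of z] that by (simp add: algebra_simps)
    have lens: "cmod (a2 - a1) \<le> (a + b) * (2 * h)" "cmod (a3 - a2) \<le> (a + b) * (2 * h)"
      "cmod (a4 - a3) \<le> (a + b) * (2 * h)" "cmod (a1 - a4) \<le> (a + b) * (2 * h)"
      using mult_pos_pos[OF ab(1) h] mult_pos_pos[OF ab(2) h]
      unfolding a1_def a2_def a3_def a4_def by (auto intro!: len)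
    have "contour_integral (rectpath a1 a3) F = contour_integral (linepath a1 a2) F + (contour_integral (linepath a2 a3) F
        + (contour_integral (linepath a3 a4) F + contour_integral (linepath a4 a1) F))"
    proof -
      have "F contour_integrable_on linepath a1 a2" "F contour_integrable_on linepath a2 a3"
        "F contour_integrable_on linepath a3 a4" "F contour_integrable_on linepath a4 a1"
        by (rule ci; use pi in blast)+
      then show ?thesis unfolding rp by (simp add: contour_integrable_joinI)
    qed
    also have "cmod \<dots> \<le> G * ((a + b) * (2 * h)) + (G * ((a + b) * (2 * h)) + (G * ((a + b) * (2 * h)) + G * ((a + b) * (2 * h))))"
      using pi lens by (intro order_trans[OF norm_triangle_ineq] add_mono seg) auto
    finally have "cmod (contour_integral (rectpath a1 a3) F) \<le> 4 * G * ((a + b) * (2 * h))" by (simp add: mult_ac)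
    then have "2 * pi * (cmod (exp (w * u) - sum f (L N)) / cmod (S u)) \<le> 4 * G * ((a + b) * (2 * h))"
      by (simp add: int norm_mult norm_divide)
    moreover have "1 * (cmod (exp (w * u) - sum f (L N)) / cmod (S u)) \<le> 2 * pi * (cmod (exp (w * u) - sum f (L N)) / cmod (S u))"
      using pi_gt3 by (intro mult_right_mono) auto
    ultimately have "cmod (exp (w * u) - sum f (L N)) / cmod (S u) \<le> 4 * G * ((a + b) * (2 * h))" by linarith
    then have "cmod (exp (w * u) - sum f (L N)) \<le> cmod (S u) * (4 * G * ((a + b) * (2 * h)))"
      using zero[of u] u by (simp add: pos_divide_le_eq mult.commute)
    also have "\<dots> = E N" by (simp add: E_def G_def K_def h_def mult_ac distrib_left)
    finally show ?thesis .
  qed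
  have "E \<longlonglongrightarrow> 0"
  proof -
    have "(\<lambda>N. 4 * (K * exp (- (c / 2) * (\<mu> * (real N + 1 / 2))\<^sup>2)) * ((a + b) * (2 * real N + 1))) \<longlonglongrightarrow> 0"
      using c \<mu> by real_asymp
    then show ?thesis by (simp add: E_def)
  qed
  moreover have "\<forall>\<^sub>F N in sequentially. norm (sum f (L N) - exp (w * u)) \<le> E N"
  proof -
    have "\<forall>\<^sub>F N in sequentially. \<bar>Re u\<bar> < a * (real N + 1 / 2)" "\<forall>\<^sub>F N in sequentially. \<bar>Im u\<bar> < b * (real N + 1 / 2)"
      "\<forall>\<^sub>F N in sequentially. cmod u + 1 \<le> \<mu> * (real N + 1 / 2)"
      using ab \<mu> by real_asymp+
    then show ?thesis by eventually_elim (use bound in \<open>simp add: norm_minus_commute\<close>)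
  qed
  ultimately have "(\<lambda>N. sum f (L N) - exp (w * u)) \<longlonglongrightarrow> 0"
    by (rule Lim_null_comparison[rotated])
  then have "(\<lambda>N. sum f (L N)) \<longlonglongrightarrow> exp (w * u)" by (rule LIM_zero_cancel)
  then have "s = exp (w * u)" by (rule LIMSEQ_unique[OF lim1])
  with s have "(f has_sum exp (w * u)) (rect_lattice a b)" by (simp only:)
  then show ?thesis unfolding f_def .
qed

end

context sigma_function
begin

text \<open>For \<open>u\<close> in the basic cell the Lagrange coefficients work, since their decay
  rate \<open>c\<close> exceeds \<open>\<alpha> / 2\<close> and the surplus pays for the factor in
  \<open>|u - l|\<close>. Other \<open>u\<close> are reached by a lattice translation combined with
  multiplication by an exponential, the Fock space translation for the weight with parameter
  \<open>\<alpha>\<close>, which keeps the constants \<open>B\<close> and \<open>\<epsilon>\<close>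
  independent of \<open>u\<close>.\<close>

lemma exponential_interpolation:
  assumes \<alpha>: "0 \<le> \<alpha>" "\<alpha> < pi / (a * b)"
  obtains B \<epsilon> where "B > 0" "\<epsilon> > 0"
    "\<And>u. \<exists>\<beta>. (\<forall>l\<in>rect_lattice a b. cmod (\<beta> l) \<le> B * exp (\<alpha> / 2 * ((cmod u)\<^sup>2 - (cmod l)\<^sup>2)) * exp (- \<epsilon> * (cmod (u - l))\<^sup>2)) \<and>
       (\<forall>w. ((\<lambda>l. \<beta> l * exp (w * l)) has_sum exp (w * u)) (rect_lattice a b))"
proof -
  \<comment> \<open>Chosen so that \<open>c = 2 * \<epsilon> + \<alpha> / 2\<close>. The factor 2 is
    lost in \<open>|v - l|^2 \<le> 2 |v|^2 + 2 |l|^2\<close>.\<close>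
  define \<epsilon> where "\<epsilon> = (2 * c - \<alpha>) / 4"
  have "2 * c = pi / (a * b)" by (simp add: c_def)
  then have \<epsilon>: "\<epsilon> > 0" using \<alpha> by (simp add: \<epsilon>_def)
  define R where "R = a / 2 + b / 2"
  have R: "R > 0" using ab by (simp add: R_def)
  obtain B0 where B0: "B0 > 0" "\<And>v l. v \<in> cball 0 R \<Longrightarrow> v \<notin> rect_lattice a b \<Longrightarrow> l \<in> rect_lattice a b \<Longrightarrow>
      cmod (S v / (deriv S l * (v - l))) \<le> B0 * exp (- c * (cmod l)\<^sup>2)"
    using lagrange_coeff_bound by blast
  define B where "B = 1 + B0 * exp (2 * \<epsilon> * R\<^sup>2)"
  have B: "B > 0" "B \<ge> 1" "B0 * exp (2 * \<epsilon> * R\<^sup>2) \<le> B" using B0 by (auto simp: B_def add_pos_nonneg)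
  have cell: "\<exists>\<beta>. (\<forall>l\<in>rect_lattice a b. cmod (\<beta> l) \<le> B * exp (\<alpha> / 2 * ((cmod v)\<^sup>2 - (cmod l)\<^sup>2)) * exp (- \<epsilon> * (cmod (v - l))\<^sup>2)) \<and>
       (\<forall>w. ((\<lambda>l. \<beta> l * exp (w * l)) has_sum exp (w * v)) (rect_lattice a b))"
    if v: "v \<in> cball 0 R" for v
  \<comment> \<open>At a lattice point the Lagrange coefficient of that point is
    \<open>0 / 0\<close>; the Kronecker delta replaces it. This is why \<open>B\<close> is made at
    least 1.\<close>
  proof (cases "v \<in> rect_lattice a b")
    case True
    have "((\<lambda>l. (if l = v then 1 else 0) * exp (w * l)) has_sum exp (w * v)) (rect_lattice a b)" for w
      using has_sum_finite_neutralI[of "{v}" "rect_lattice a b" "\<lambda>l. (if l = v then 1 else 0) * exp (w * l)" "exp (w * v)"] True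
      by auto
    then show ?thesis using B by (intro exI[of _ "\<lambda>l. if l = v then 1 else 0"]) auto
  next
    case False
    have "cmod (S v / (deriv S l * (v - l))) \<le> B * exp (\<alpha> / 2 * ((cmod v)\<^sup>2 - (cmod l)\<^sup>2)) * exp (- \<epsilon> * (cmod (v - l))\<^sup>2)"
      if l: "l \<in> rect_lattice a b" for l
    proof -
      have "(cmod (v - l))\<^sup>2 \<le> 2 * (cmod v)\<^sup>2 + 2 * (cmod l)\<^sup>2"
      proof -
        have "(cmod (v - l))\<^sup>2 \<le> (cmod v + cmod l)\<^sup>2" by (intro power_mono norm_triangle_ineq4) auto
        also have "\<dots> \<le> 2 * (cmod v)\<^sup>2 + 2 * (cmod l)\<^sup>2"
          using sum_squares_bound[of "cmod v" "cmod l"] by (simp add: power2_sum)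
        finally show ?thesis .
      qed
      moreover have "(cmod v)\<^sup>2 \<le> R\<^sup>2" using v by (intro power_mono) auto
      ultimately have "\<epsilon> * (cmod (v - l))\<^sup>2 \<le> \<epsilon> * (2 * R\<^sup>2 + 2 * (cmod l)\<^sup>2)"
        using \<epsilon> by (intro mult_left_mono) auto
      moreover have "0 \<le> \<alpha> / 2 * (cmod v)\<^sup>2" using \<alpha> by simp
      moreover have "c * (cmod l)\<^sup>2 = 2 * \<epsilon> * (cmod l)\<^sup>2 + \<alpha> / 2 * (cmod l)\<^sup>2"
      proof -
        have "c = 2 * \<epsilon> + \<alpha> / 2" by (simp add: \<epsilon>_def field_simps)
        then show ?thesis by (subst \<open>c = _\<close>) (rule distrib_right)
      qed
      ultimately have "- c * (cmod l)\<^sup>2 \<le> 2 * \<epsilon> * R\<^sup>2 + (\<alpha> / 2 * ((cmod v)\<^sup>2 - (cmod l)\<^sup>2) + - \<epsilon> * (cmod (v - l))\<^sup>2)"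
        by (simp add: algebra_simps)
      then have "B0 * exp (- c * (cmod l)\<^sup>2) \<le> B0 * exp (2 * \<epsilon> * R\<^sup>2 + (\<alpha> / 2 * ((cmod v)\<^sup>2 - (cmod l)\<^sup>2) + - \<epsilon> * (cmod (v - l))\<^sup>2))"
        using B0(1) by (intro mult_left_mono) auto
      also have "\<dots> = B0 * exp (2 * \<epsilon> * R\<^sup>2) * (exp (\<alpha> / 2 * ((cmod v)\<^sup>2 - (cmod l)\<^sup>2)) * exp (- \<epsilon> * (cmod (v - l))\<^sup>2))"
        by (simp only: exp_add mult.assoc)
      also have "\<dots> \<le> B * (exp (\<alpha> / 2 * ((cmod v)\<^sup>2 - (cmod l)\<^sup>2)) * exp (- \<epsilon> * (cmod (v - l))\<^sup>2))"
        by (rule mult_right_mono[OF B(3)]) simp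
      finally show ?thesis using B0(2)[OF v False l] by (simp only: mult.assoc)
    qed
    then show ?thesis
      by (intro exI[of _ "\<lambda>l. S v / (deriv S l * (v - l))"] conjI ballI allI lagrange_interpolation[OF False])
  qed
  show ?thesis
  proof (rule that[OF B(1) \<epsilon>])
    fix u
    obtain l0 where l0: "l0 \<in> rect_lattice a b" "\<bar>Re (u - l0)\<bar> \<le> a / 2" "\<bar>Im (u - l0)\<bar> \<le> b / 2"
      using rect_lattice_cell[OF ab] by blast
    define v where "v = u - l0"
    have "v \<in> cball 0 R" using l0 cmod_le[of v] by (simp add: v_def R_def)
    then obtain \<beta> where \<beta>: "\<And>l. l \<in> rect_lattice a b \<Longrightarrow> cmod (\<beta> l) \<le> B * exp (\<alpha> / 2 * ((cmod v)\<^sup>2 - (cmod l)\<^sup>2)) * exp (- \<epsilon> * (cmod (v - l))\<^sup>2)"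
       "\<And>w. ((\<lambda>l. \<beta> l * exp (w * l)) has_sum exp (w * v)) (rect_lattice a b)"
      using cell by blast
    \<comment> \<open>This exponent makes
      \<open>\<alpha> / 2 * (|v|^2 - |l - l0|^2) + Re (k * (u - l))\<close> equal to
      \<open>\<alpha> / 2 * (|u|^2 - |l|^2)\<close>. The interpolation identity at \<open>v\<close>
      is then used with parameter \<open>w - k\<close> in place of \<open>w\<close>.\<close>
    define k where "k = of_real \<alpha> * cnj l0"
    define \<gamma> where "\<gamma> = (\<lambda>l. \<beta> (l - l0) * exp (k * (u - l)))"
    have bij: "bij_betw (\<lambda>l. l - l0) (rect_lattice a b) (rect_lattice a b)"
      by (rule bij_betwI[where g = "\<lambda>l. l + l0"]) (use l0 rect_lattice_add rect_lattice_uminus[OF l0(1)] in \<open>force+\<close>)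
    have "((\<lambda>l. \<gamma> l * exp (w * l)) has_sum exp (w * u)) (rect_lattice a b)" for w
    proof -
      have "((\<lambda>l. exp (k * v) * exp (w * l0) * (\<beta> l * exp ((w - k) * l))) has_sum exp (k * v) * exp (w * l0) * exp ((w - k) * v)) (rect_lattice a b)"
        by (intro has_sum_cmult_right \<beta>)
      then have "((\<lambda>l. exp (k * v) * exp (w * l0) * (\<beta> (l - l0) * exp ((w - k) * (l - l0)))) has_sum exp (k * v) * exp (w * l0) * exp ((w - k) * v)) (rect_lattice a b)"
        using has_sum_reindex_bij_betw[OF bij, of "\<lambda>l. exp (k * v) * exp (w * l0) * (\<beta> l * exp ((w - k) * l))"] by simp
      moreover have "exp (k * v) * exp (w * l0) * (\<beta> (l - l0) * exp ((w - k) * (l - l0))) = \<gamma> l * exp (w * l)" for l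
      proof -
        have "exp (k * v) * exp (w * l0) * exp ((w - k) * (l - l0)) = exp (k * (u - l)) * exp (w * l)"
          by (simp add: v_def algebra_simps flip: exp_add)
        then show ?thesis by (simp add: \<gamma>_def mult_ac)
      qed
      moreover have "exp (k * v) * exp (w * l0) * exp ((w - k) * v) = exp (w * u)"
        by (simp add: v_def algebra_simps flip: exp_add)
      ultimately show ?thesis by simp
    qed
    moreover have "cmod (\<gamma> l) \<le> B * exp (\<alpha> / 2 * ((cmod u)\<^sup>2 - (cmod l)\<^sup>2)) * exp (- \<epsilon> * (cmod (u - l))\<^sup>2)"
      if l: "l \<in> rect_lattice a b" for l
    proof -
      have l': "l - l0 \<in> rect_lattice a b" using rect_lattice_add[OF l rect_lattice_uminus[OF l0(1)]] by simp
      have sq: "(cmod z)\<^sup>2 = (cmod (z - l0))\<^sup>2 + 2 * Re (cnj l0 * (z - l0)) + (cmod l0)\<^sup>2" for z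
        unfolding cmod_power2 by (simp add: power2_eq_square algebra_simps)
      have "\<alpha> / 2 * ((cmod v)\<^sup>2 - (cmod (l - l0))\<^sup>2) + Re (k * (u - l)) = \<alpha> / 2 * ((cmod u)\<^sup>2 - (cmod l)\<^sup>2)"
        unfolding sq[of u] sq[of l] by (simp add: k_def v_def algebra_simps)
      then have e: "exp (\<alpha> / 2 * ((cmod v)\<^sup>2 - (cmod (l - l0))\<^sup>2)) * exp (Re (k * (u - l))) = exp (\<alpha> / 2 * ((cmod u)\<^sup>2 - (cmod l)\<^sup>2))"
        by (simp flip: exp_add)
      have "cmod (\<gamma> l) = cmod (\<beta> (l - l0)) * exp (Re (k * (u - l)))"
        by (simp add: \<gamma>_def norm_mult norm_exp_eq_Re)
      also have "\<dots> \<le> B * exp (\<alpha> / 2 * ((cmod v)\<^sup>2 - (cmod (l - l0))\<^sup>2)) * exp (- \<epsilon> * (cmod (v - (l - l0)))\<^sup>2) * exp (Re (k * (u - l)))"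
        using \<beta>(1)[OF l'] by (intro mult_right_mono) auto
      also have "\<dots> = B * exp (\<alpha> / 2 * ((cmod u)\<^sup>2 - (cmod l)\<^sup>2)) * exp (- \<epsilon> * (cmod (u - l))\<^sup>2)"
        unfolding e[symmetric] by (simp add: v_def)
      finally show ?thesis .
    qed
    ultimately show "\<exists>\<beta>. (\<forall>l\<in>rect_lattice a b. cmod (\<beta> l) \<le> B * exp (\<alpha> / 2 * ((cmod u)\<^sup>2 - (cmod l)\<^sup>2)) * exp (- \<epsilon> * (cmod (u - l))\<^sup>2)) \<and>
       (\<forall>w. ((\<lambda>l. \<beta> l * exp (w * l)) has_sum exp (w * u)) (rect_lattice a b))"
      by (intro exI[of _ \<gamma>] conjI ballI allI)
  qed
qed

end

lemma sigma_function_obtain: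
  assumes "a > 0" "b > 0"
  obtains S where "sigma_function a b S"
proof -
  obtain S where S: "S holomorphic_on UNIV" "\<And>u. S u = 0 \<longleftrightarrow> u \<in> rect_lattice a b" "deriv S 0 \<noteq> 0"
    "\<And>u l. l \<in> rect_lattice a b \<Longrightarrow>
       cmod (S (u + l)) * exp (- pi / (2 * a * b) * (cmod (u + l))\<^sup>2) = cmod (S u) * exp (- pi / (2 * a * b) * (cmod u)\<^sup>2)"
    by (rule sigma_function_exists[OF assms]) (rule that)
  have "sigma_function a b S" by (rule sigma_function.intro[OF assms S])
  then show ?thesis by (rule that)
qed

section \<open>The space \<open>L\<^sup>2\<close>\<close>

lemma L2_I: "f \<in> borel_measurable lebesgue \<Longrightarrow> integrable lebesgue (\<lambda>t. (cmod (f t))\<^sup>2) \<Longrightarrow> f \<in> L2"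
  by (simp add: L2_def)

lemma L2_D: "f \<in> L2 \<Longrightarrow> f \<in> borel_measurable lebesgue" "f \<in> L2 \<Longrightarrow> integrable lebesgue (\<lambda>t. (cmod (f t))\<^sup>2)"
  by (simp_all add: L2_def)

lemma sum_square_norm_bound: "(cmod (x + y))\<^sup>2 \<le> 2 * (cmod x)\<^sup>2 + 2 * (cmod y)\<^sup>2"
proof -
  have "(cmod (x + y))\<^sup>2 \<le> (cmod x + cmod y)\<^sup>2" by (intro power_mono norm_triangle_ineq) auto
  also have "\<dots> \<le> 2 * (cmod x)\<^sup>2 + 2 * (cmod y)\<^sup>2"
    using sum_squares_bound[of "cmod x" "cmod y"] by (simp add: power2_sum)
  finally show ?thesis .
qed

lemma L2_integrable_product:
  assumes f: "f \<in> L2" and g: "g \<in> L2"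
  shows "integrable lebesgue (\<lambda>t. f t * cnj (g t))"
proof (rule Bochner_Integration.integrable_bound)
  show "integrable lebesgue (\<lambda>t. (cmod (f t))\<^sup>2 + (cmod (g t))\<^sup>2)"
    using f g by (intro Bochner_Integration.integrable_add L2_D)
  have "cnj \<in> borel_measurable borel" by (intro borel_measurable_continuous_onI continuous_intros)
  then have "(\<lambda>t. cnj (g t)) \<in> borel_measurable lebesgue"
    by (rule measurable_compose[OF L2_D(1)[OF g]])
  then show "(\<lambda>t. f t * cnj (g t)) \<in> borel_measurable lebesgue"
    by (rule borel_measurable_times[OF L2_D(1)[OF f]])
  show "AE t in lebesgue. norm (f t * cnj (g t)) \<le> norm ((cmod (f t))\<^sup>2 + (cmod (g t))\<^sup>2)"
  proof (intro AE_I2)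
    fix t
    have "cmod (f t) * cmod (g t) \<le> (cmod (f t))\<^sup>2 + (cmod (g t))\<^sup>2"
      using sum_squares_bound[of "cmod (f t)" "cmod (g t)"] mult_nonneg_nonneg[of "cmod (f t)" "cmod (g t)"]
      using norm_ge_zero[of "f t"] norm_ge_zero[of "g t"] by linarith
    then show "norm (f t * cnj (g t)) \<le> norm ((cmod (f t))\<^sup>2 + (cmod (g t))\<^sup>2)" by (simp add: norm_mult)
  qed
qed

lemma L2_add:
  assumes f: "f \<in> L2" and g: "g \<in> L2"
  shows "(\<lambda>t. f t + g t) \<in> L2"
proof (rule L2_I)
  show m: "(\<lambda>t. f t + g t) \<in> borel_measurable lebesgue"
    using f g by (intro borel_measurable_add L2_D)
  show "integrable lebesgue (\<lambda>t. (cmod (f t + g t))\<^sup>2)"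
  proof (rule Bochner_Integration.integrable_bound)
    show "integrable lebesgue (\<lambda>t. 2 * (cmod (f t))\<^sup>2 + 2 * (cmod (g t))\<^sup>2)"
      using f g by (intro Bochner_Integration.integrable_add integrable_mult_right L2_D)
    show "(\<lambda>t. (cmod (f t + g t))\<^sup>2) \<in> borel_measurable lebesgue"
      using m by measurable
  qed (simp add: sum_square_norm_bound)
qed

lemma L2_cmult: "f \<in> L2 \<Longrightarrow> (\<lambda>t. c * f t) \<in> L2"
  by (rule L2_I) (auto dest: L2_D simp: norm_mult power_mult_distrib)

lemma L2_zero: "(\<lambda>t. 0) \<in> L2"
  by (rule L2_I) auto

lemma L2_sum: "(\<And>j. j \<in> J \<Longrightarrow> G j \<in> L2) \<Longrightarrow> (\<lambda>t. \<Sum>j\<in>J. c j * G j t) \<in> L2"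
proof (induction J rule: infinite_finite_induct)
  case (insert x F)
  then have "(\<lambda>t. c x * G x t + (\<Sum>j\<in>F. c j * G j t)) \<in> L2"
    by (intro L2_add[of "\<lambda>t. c x * G x t"] L2_cmult) auto
  then show ?case using insert by simp
qed (simp_all add: L2_zero)

lemma L2_diff: "f \<in> L2 \<Longrightarrow> g \<in> L2 \<Longrightarrow> (\<lambda>t. f t - g t) \<in> L2"
  using L2_add[of f "\<lambda>t. (- 1) * g t"] L2_cmult[of g "- 1"] by simp

lemma L2_inner_commute: "L2_inner g f = cnj (L2_inner f g)"
proof -
  have "cnj (L2_inner f g) = (LINT t|lebesgue. cnj (f t * cnj (g t)))"
    unfolding L2_inner_def by (rule Bochner_Integration.integral_cnj[symmetric])
  then show ?thesis by (simp add: L2_inner_def mult.commute)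
qed

lemma L2_inner_diff_right:
  assumes "f \<in> L2" "g \<in> L2" "h \<in> L2"
  shows "L2_inner h (\<lambda>t. f t - g t) = L2_inner h f - L2_inner h g"
  unfolding L2_inner_def complex_cnj_diff right_diff_distrib
  by (rule Bochner_Integration.integral_diff) (intro L2_integrable_product assms)+

lemma L2_inner_sum_left:
  assumes "\<And>j. j \<in> J \<Longrightarrow> G j \<in> L2" "h \<in> L2"
  shows "L2_inner (\<lambda>t. \<Sum>j\<in>J. c j * G j t) h = (\<Sum>j\<in>J. c j * L2_inner (G j) h)"
proof -
  have "L2_inner (\<lambda>t. \<Sum>j\<in>J. c j * G j t) h = (LINT t|lebesgue. (\<Sum>j\<in>J. c j * (G j t * cnj (h t))))"
    by (simp add: L2_inner_def sum_distrib_right mult.assoc)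
  also have "\<dots> = (\<Sum>j\<in>J. c j * L2_inner (G j) h)"
  proof -
    have "integrable lebesgue (\<lambda>t. c j * (G j t * cnj (h t)))" if "j \<in> J" for j
      by (rule integrable_mult_right, rule L2_integrable_product) (use assms that in blast)+
    then have "(LINT t|lebesgue. (\<Sum>j\<in>J. c j * (G j t * cnj (h t)))) = (\<Sum>j\<in>J. LINT t|lebesgue. c j * (G j t * cnj (h t)))"
      by (rule Bochner_Integration.integral_sum)
    also have "\<dots> = (\<Sum>j\<in>J. c j * L2_inner (G j) h)"
      unfolding L2_inner_def by (intro sum.cong refl integral_mult_right_zero)
    finally show ?thesis .
  qed
  finally show ?thesis .
qed

lemma L2_inner_sum_right:
  assumes "\<And>j. j \<in> J \<Longrightarrow> G j \<in> L2" "h \<in> L2"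
  shows "L2_inner h (\<lambda>t. \<Sum>j\<in>J. c j * G j t) = (\<Sum>j\<in>J. cnj (c j) * L2_inner h (G j))"
proof -
  have "L2_inner h (\<lambda>t. \<Sum>j\<in>J. c j * G j t) = cnj (L2_inner (\<lambda>t. \<Sum>j\<in>J. c j * G j t) h)"
    by (rule L2_inner_commute)
  also have "\<dots> = (\<Sum>j\<in>J. cnj (c j) * cnj (L2_inner (G j) h))"
  proof -
    have "L2_inner (\<lambda>t. \<Sum>j\<in>J. c j * G j t) h = (\<Sum>j\<in>J. c j * L2_inner (G j) h)"
      by (rule L2_inner_sum_left[OF assms])
    then show ?thesis by (simp only: cnj_sum complex_cnj_mult)
  qed
  also have "\<dots> = (\<Sum>j\<in>J. cnj (c j) * L2_inner h (G j))"
    by (simp only: L2_inner_commute[symmetric])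
  finally show ?thesis .
qed

lemma L2_norm_nonneg: "L2_norm f \<ge> 0"
  by (simp add: L2_norm_def)

lemma L2_norm_power2: "(L2_norm f)\<^sup>2 = (LINT t|lebesgue. (cmod (f t))\<^sup>2)"
  by (simp add: L2_norm_def)

lemma L2_inner_self: "L2_inner f f = of_real ((L2_norm f)\<^sup>2)"
proof -
  have "f t * cnj (f t) = of_real ((cmod (f t))\<^sup>2)" for t
    by (simp add: complex_norm_square flip: of_real_power)
  then show ?thesis unfolding L2_inner_def L2_norm_power2 by (simp only: integral_complex_of_real)
qed

text \<open>Integrating the weighted inequality \<open>2 x y \<le> s x^2 + y^2 / s\<close> gives a
  bound for every \<open>s > 0\<close>, optimal at the ratio of the norms. Adding \<open>e\<close>
  to both norms keeps that ratio defined and positive when a norm is 0; then \<open>e\<close> tends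
  to 0.\<close>

lemma L2_Cauchy_Schwarz:
  assumes f: "f \<in> L2" and g: "g \<in> L2"
  shows "cmod (L2_inner f g) \<le> L2_norm f * L2_norm g"
proof -
  define F H where "F = L2_norm f" and "H = L2_norm g"
  have nn: "F \<ge> 0" "H \<ge> 0" by (simp_all add: F_def H_def L2_norm_nonneg)
  define x where "x = cmod (L2_inner f g)"
  have bound: "2 * x \<le> s * F\<^sup>2 + H\<^sup>2 / s" if s: "s > 0" for s
  proof -
    have "2 * x \<le> 2 * (LINT t|lebesgue. cmod (f t * cnj (g t)))"
      unfolding x_def L2_inner_def using integral_norm_bound[of lebesgue "\<lambda>t. f t * cnj (g t)"] by simp
    also have "\<dots> = (LINT t|lebesgue. 2 * cmod (f t * cnj (g t)))" by simp
    also have "\<dots> \<le> (LINT t|lebesgue. s * (cmod (f t))\<^sup>2 + (cmod (g t))\<^sup>2 / s)"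
    proof (rule integral_mono)
      show "integrable lebesgue (\<lambda>t. 2 * cmod (f t * cnj (g t)))"
        by (intro integrable_mult_right integrable_norm L2_integrable_product f g)
      show "integrable lebesgue (\<lambda>t. s * (cmod (f t))\<^sup>2 + (cmod (g t))\<^sup>2 / s)"
        by (intro Bochner_Integration.integrable_add integrable_mult_right integrable_divide L2_D f g)
      fix t
      have "0 \<le> (s * cmod (f t) - cmod (g t))\<^sup>2 / s" using s by simp
      also have "\<dots> = s * (cmod (f t))\<^sup>2 + (cmod (g t))\<^sup>2 / s - 2 * (cmod (f t) * cmod (g t))"
        using s by (simp add: power2_eq_square field_simps)
      finally show "2 * cmod (f t * cnj (g t)) \<le> s * (cmod (f t))\<^sup>2 + (cmod (g t))\<^sup>2 / s"
        by (simp add: norm_mult)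
    qed
    also have "\<dots> = s * F\<^sup>2 + H\<^sup>2 / s"
      unfolding F_def H_def L2_norm_power2
      by (subst Bochner_Integration.integral_add) (auto intro!: integrable_mult_right integrable_divide L2_D f g)
    finally show ?thesis .
  qed
  have "2 * x \<le> 2 * ((F + e) * (H + e))" if e: "e > 0" for e
  proof -
    have pos: "F + e > 0" "H + e > 0" using nn e by auto
    have "2 * x \<le> ((H + e) / (F + e)) * F\<^sup>2 + H\<^sup>2 / ((H + e) / (F + e))"
      using pos by (intro bound) auto
    also have "\<dots> \<le> ((H + e) / (F + e)) * (F + e)\<^sup>2 + (H + e)\<^sup>2 / ((H + e) / (F + e))"
      using pos nn e by (intro add_mono mult_left_mono divide_right_mono power_mono) auto
    also have "\<dots> = 2 * ((F + e) * (H + e))"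
    proof -
      have "q / p * p\<^sup>2 + q\<^sup>2 / (q / p) = 2 * (p * q)" if "p > 0" "q > 0" for p q :: real
        using that by (simp add: power2_eq_square)
      then show ?thesis using pos by blast
    qed
    finally show ?thesis .
  qed
  then have ev: "eventually (\<lambda>e. 2 * x \<le> 2 * ((F + e) * (H + e))) (at_right 0)"
    by (intro eventually_at_right_less[THEN eventually_mono]) auto
  have lim: "((\<lambda>e. 2 * ((F + e) * (H + e))) \<longlongrightarrow> 2 * ((F + 0) * (H + 0))) (at_right 0)"
    by (intro tendsto_intros)
  have "2 * x \<le> 2 * ((F + 0) * (H + 0))"
    by (rule tendsto_lowerbound[OF lim ev trivial_limit_at_right_real])
  then show ?thesis by (simp add: x_def F_def H_def)
qed

lemma L2_Cauchy_Schwarz_power2: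
  assumes "f \<in> L2" "g \<in> L2"
  shows "(cmod (L2_inner f g))\<^sup>2 \<le> (L2_norm f)\<^sup>2 * (L2_norm g)\<^sup>2"
  using power_mono[OF L2_Cauchy_Schwarz[OF assms], of 2] by (simp add: power_mult_distrib)

section \<open>Gaussian integrals and the short-time Fourier transform\<close>

lemma lborel_integral_translate:
  fixes f :: "'a::euclidean_space \<Rightarrow> 'b::{banach, second_countable_topology}"
  assumes [measurable]: "f \<in> borel_measurable borel"
  shows "integrable lborel (\<lambda>x. f (a + x)) \<longleftrightarrow> integrable lborel f" "(LBINT x. f (a + x)) = (LBINT x. f x)"
proof -
  have "integrable (distr lborel borel ((+) a)) f = integrable lborel (\<lambda>x. f (a + x))"
    by (rule integrable_distr_eq) auto
  then show "integrable lborel (\<lambda>x. f (a + x)) \<longleftrightarrow> integrable lborel f" by (simp add: lborel_distr_plus)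
  have "integral\<^sup>L (distr lborel borel ((+) a)) f = (LBINT x. f (a + x))"
    by (rule integral_distr) auto
  then show "(LBINT x. f (a + x)) = (LBINT x. f x)" by (simp add: lborel_distr_plus)
qed

lemma lborel_nn_integral_translate:
  fixes f :: "'a::euclidean_space \<Rightarrow> ennreal"
  assumes [measurable]: "f \<in> borel_measurable borel"
  shows "(\<integral>\<^sup>+x. f (a + x) \<partial>lborel) = (\<integral>\<^sup>+x. f x \<partial>lborel)"
proof -
  have "integral\<^sup>N (distr lborel borel ((+) a)) f = (\<integral>\<^sup>+x. f (a + x) \<partial>lborel)"
    by (rule nn_integral_distr) auto
  then show ?thesis by (simp add: lborel_distr_plus)
qed

lemma lborel_nn_integral_affine:
  fixes f :: "'a::euclidean_space \<Rightarrow> ennreal"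
  assumes [measurable]: "f \<in> borel_measurable borel" and c: "c \<noteq> 0"
  shows "(\<integral>\<^sup>+x. f x \<partial>lborel) = ennreal (\<bar>c\<bar> ^ DIM('a)) * (\<integral>\<^sup>+x. f (t + c *\<^sub>R x) \<partial>lborel)"
proof -
  have "(\<integral>\<^sup>+x. f x \<partial>lborel) = integral\<^sup>N (density (distr lborel borel (\<lambda>x. t + c *\<^sub>R x)) (\<lambda>_. ennreal (\<bar>c\<bar> ^ DIM('a)))) f"
    using lborel_affine[OF c, of t] by simp
  also have "\<dots> = (\<integral>\<^sup>+x. ennreal (\<bar>c\<bar> ^ DIM('a)) * f x \<partial>(distr lborel borel (\<lambda>x. t + c *\<^sub>R x)))"
    by (rule nn_integral_density) auto
  also have "\<dots> = (\<integral>\<^sup>+x. ennreal (\<bar>c\<bar> ^ DIM('a)) * f (t + c *\<^sub>R x) \<partial>lborel)"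
    by (rule nn_integral_distr) auto
  also have "\<dots> = ennreal (\<bar>c\<bar> ^ DIM('a)) * (\<integral>\<^sup>+x. f (t + c *\<^sub>R x) \<partial>lborel)"
    by (rule nn_integral_cmult) auto
  finally show ?thesis .
qed

lemma lborel_integral_affine:
  fixes f :: "'a::euclidean_space \<Rightarrow> 'b::{banach, second_countable_topology}"
  assumes [measurable]: "f \<in> borel_measurable borel" and c: "c \<noteq> 0"
  shows "(LBINT x. f x) = \<bar>c\<bar> ^ DIM('a) *\<^sub>R (LBINT x. f (t + c *\<^sub>R x))"
proof -
  have "(LBINT x. f x) = integral\<^sup>L (density (distr lborel borel (\<lambda>x. t + c *\<^sub>R x)) (\<lambda>_. ennreal (\<bar>c\<bar> ^ DIM('a)))) f"
    using lborel_affine[OF c, of t] by simp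
  also have "\<dots> = (LINT x|distr lborel borel (\<lambda>x. t + c *\<^sub>R x). \<bar>c\<bar> ^ DIM('a) *\<^sub>R f x)"
    by (rule integral_density) auto
  also have "\<dots> = (LBINT x. \<bar>c\<bar> ^ DIM('a) *\<^sub>R f (t + c *\<^sub>R x))"
    by (rule integral_distr) auto
  finally show ?thesis by simp
qed

section \<open>Convergence of Gaussian integrals and their dependence on complex parameters\<close>

lemma gaussian_nn_integral_finite_real:
  fixes c :: real
  assumes c: "c > 0"
  shows "(\<integral>\<^sup>+x. ennreal (exp (- c * x\<^sup>2)) \<partial>lborel) < \<infinity>"
proof -
  \<comment> \<open>Upper bound for the contribution of the shell
    \<open>n \<le> |x| < n + 1\<close>: the largest value of the integrand there times the length of
    an interval that contains the shell.\<close>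
  define b where "b n = exp (- c * (real n)\<^sup>2) * (2 * (real n + 1))" for n
  have "(\<integral>\<^sup>+x. ennreal (exp (- c * x\<^sup>2)) \<partial>lborel)
      \<le> (\<integral>\<^sup>+x. (\<Sum>n. ennreal (exp (- c * (real n)\<^sup>2)) * indicator {- (real n + 1)..real n + 1} x) \<partial>lborel)"
  proof (rule nn_integral_mono)
    fix x :: real
    define m where "m = nat \<lfloor>\<bar>x\<bar>\<rfloor>"
    have m: "real m \<le> \<bar>x\<bar>" "\<bar>x\<bar> < real m + 1" by (auto simp: m_def)
    have "(real m)\<^sup>2 \<le> x\<^sup>2" using power_mono[OF m(1), of 2] by simp
    then have "ennreal (exp (- c * x\<^sup>2)) \<le> ennreal (exp (- c * (real m)\<^sup>2)) * indicator {- (real m + 1)..real m + 1} x"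
      using m c by (auto simp: indicator_def intro!: ennreal_leI)
    also have "\<dots> \<le> (\<Sum>n. ennreal (exp (- c * (real n)\<^sup>2)) * indicator {- (real n + 1)..real n + 1} x)"
    proof -
      have "F m \<le> suminf F" for F :: "nat \<Rightarrow> ennreal"
        using sum_le_suminf[OF summableI, of "{m}" F] by simp
      then show ?thesis .
    qed
    finally show "ennreal (exp (- c * x\<^sup>2)) \<le> (\<Sum>n. ennreal (exp (- c * (real n)\<^sup>2)) * indicator {- (real n + 1)..real n + 1} x)" .
  qed
  also have "\<dots> = (\<Sum>n. \<integral>\<^sup>+x. ennreal (exp (- c * (real n)\<^sup>2)) * indicator {- (real n + 1)..real n + 1} x \<partial>lborel)"
    by (rule nn_integral_suminf) auto
  also have "\<dots> = (\<Sum>n. ennreal (b n))"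
  proof (rule suminf_cong)
    fix n :: nat
    have "emeasure lborel {- (real n + 1)..real n + 1} = ennreal (2 * (real n + 1))"
      by (subst emeasure_lborel_Icc) auto
    then show "(\<integral>\<^sup>+x. ennreal (exp (- c * (real n)\<^sup>2)) * indicator {- (real n + 1)..real n + 1} x \<partial>lborel) = ennreal (b n)"
      by (subst nn_integral_cmult_indicator) (auto simp: b_def ennreal_mult)
  qed
  also have "\<dots> < \<infinity>"
  proof -
    have "b \<in> O(\<lambda>n. 1 / real n ^ 2)" unfolding b_def using c by real_asymp
    moreover have "summable (\<lambda>n. norm (1 / real n ^ 2))" using inverse_power_summable[of 2, where 'a = real] by (simp add: inverse_eq_divide)
    ultimately have "summable b" by (rule summable_comparison_test_bigo[rotated])
    then have "(\<Sum>n. ennreal (b n)) = ennreal (suminf b)"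
      by (rule suminf_ennreal2[rotated]) (simp add: b_def)
    then show ?thesis by simp
  qed
  finally show ?thesis .
qed

lemma gaussian_integrable:
  fixes c :: real
  assumes c: "c > 0"
  shows "integrable lborel (\<lambda>x::'a::euclidean_space. exp (- c * (norm x)\<^sup>2))"
proof (rule integrableI_nonneg)
  have eq: "ennreal (exp (- c * (norm x)\<^sup>2)) = (\<Prod>b\<in>Basis. ennreal (exp (- c * (x \<bullet> b)\<^sup>2)))" for x :: 'a
  proof -
    have "(norm x)\<^sup>2 = (\<Sum>b\<in>Basis. (x \<bullet> b)\<^sup>2)"
      unfolding power2_norm_eq_inner by (subst euclidean_inner) (simp add: power2_eq_square)
    then show ?thesis by (simp add: prod_ennreal exp_sum sum_distrib_left flip: sum_negf)
  qed
  have "(\<integral>\<^sup>+(x::'a). ennreal (exp (- c * (norm x)\<^sup>2)) \<partial>lborel) = (\<Prod>b\<in>(Basis::'a set). \<integral>\<^sup>+x. ennreal (exp (- c * x\<^sup>2)) \<partial>lborel)"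
    unfolding eq by (rule nn_integral_lborel_prod) auto
  also have "\<dots> < \<infinity>"
  proof -
    obtain r where "0 \<le> r" "(\<integral>\<^sup>+x. ennreal (exp (- c * x\<^sup>2)) \<partial>lborel) = ennreal r"
      using gaussian_nn_integral_finite_real[OF c]
      by (cases "\<integral>\<^sup>+x. ennreal (exp (- c * x\<^sup>2)) \<partial>lborel" rule: ennreal_cases) auto
    then show ?thesis by (simp only: prod_constant ennreal_power) simp
  qed
  finally show "(\<integral>\<^sup>+(x::'a). ennreal (exp (- c * (norm x)\<^sup>2)) \<partial>lborel) < \<infinity>" .
qed auto

lemma integrable_pos_integral_pos:
  fixes f :: "'a::euclidean_space \<Rightarrow> real"
  assumes "integrable lborel f" "\<And>x. f x > 0"
  shows "(LBINT x. f x) > 0"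
proof -
  have "(LBINT x. f x) \<noteq> 0"
  proof
    assume "(LBINT x. f x) = 0"
    then have "AE x in lborel. f x = 0"
      using integral_nonneg_eq_0_iff_AE[OF assms(1)] assms(2) by (simp add: less_imp_le)
    then have "AE x in (lborel :: 'a measure). False"
      by eventually_elim (use assms(2) in \<open>simp add: less_le\<close>)
    then show False by (simp add: AE_iff_null null_sets_def)
  qed
  moreover have "(LBINT x. f x) \<ge> 0" using assms(2) by (intro Bochner_Integration.integral_nonneg) (simp add: less_imp_le)
  ultimately show ?thesis by simp
qed

text \<open>Both sides are entire in \<open>s\<close> and agree on the real line. For the integral
  this follows by expanding the exponential and integrating termwise, which makes it an everywhere
  convergent power series.\<close>

lemma gaussian_integral_analytic:
  fixes w l :: "'a::euclidean_space \<Rightarrow> real" and c0 k :: real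
  assumes [measurable]: "w \<in> borel_measurable borel" "l \<in> borel_measurable borel"
    and w: "\<And>t. w t \<ge> 0"
    and real: "\<And>s::real. integrable lborel (\<lambda>t. w t * exp (s * l t))" "\<And>s::real. (LBINT t. w t * exp (s * l t)) = c0 * exp (k * s\<^sup>2)"
  shows "(CLBINT t. of_real (w t) * exp (s * of_real (l t))) = of_real c0 * exp (of_real k * s\<^sup>2)"
proof -
  define h where "h = (\<lambda>s::complex. CLBINT t. of_real (w t) * exp (s * of_real (l t)))"
  define a where "a = (\<lambda>n. CLBINT t. of_real (w t * l t ^ n / fact n))"
  \<comment> \<open>The sum of the integrands for \<open>r\<close> and \<open>- r\<close> dominates
    \<open>exp (r * |l t|)\<close>, so the real case of the hypothesis already controls all partial
    sums of the exponential series.\<close>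
  have dom: "integrable lborel (\<lambda>t. w t * exp (r * \<bar>l t\<bar>))" if r: "r \<ge> 0" for r
  proof (rule Bochner_Integration.integrable_bound)
    show "integrable lborel (\<lambda>t. w t * exp (r * l t) + w t * exp (- r * l t))"
      by (intro Bochner_Integration.integrable_add real)
    show "AE t in lborel. norm (w t * exp (r * \<bar>l t\<bar>)) \<le> norm (w t * exp (r * l t) + w t * exp (- r * l t))"
    proof (intro AE_I2)
      fix t
      have "0 \<le> w t * exp (r * l t)" "0 \<le> w t * exp (- r * l t)" using w[of t] by simp_all
      then show "norm (w t * exp (r * \<bar>l t\<bar>)) \<le> norm (w t * exp (r * l t) + w t * exp (- r * l t))"
        by (cases "l t \<ge> 0") (simp_all add: abs_of_nonneg abs_of_neg)
    qed
  qed auto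
  have sums: "(\<lambda>n. a n * s ^ n) sums h s" for s
  proof -
    define f where "f = (\<lambda>n t. complex_of_real (w t * l t ^ n / fact n) * s ^ n)"
    have fnorm: "norm (f n t) = w t * ((cmod s * \<bar>l t\<bar>) ^ n / fact n)" for n t
      using w[of t] by (simp add: f_def norm_mult norm_divide norm_power power_abs power_mult_distrib abs_mult)
    have exps: "(\<lambda>n. w t * ((cmod s * \<bar>l t\<bar>) ^ n / fact n)) sums (w t * exp (cmod s * \<bar>l t\<bar>))" for t
      using sums_mult[OF exp_converges[of "cmod s * \<bar>l t\<bar>"], of "w t"] by (simp add: divide_inverse mult_ac)
    have part: "(\<Sum>i<n. norm (f i t)) \<le> w t * exp (cmod s * \<bar>l t\<bar>)" for n t
      unfolding fnorm using sum_le_suminf[of "\<lambda>i. w t * ((cmod s * \<bar>l t\<bar>) ^ i / fact i)" "{..<n}"] exps[of t] w[of t]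
      by (auto simp: sums_iff)
    have fint: "integrable lborel (f n)" for n
    proof (rule Bochner_Integration.integrable_bound[OF dom[of "cmod s"]])
      show "AE t in lborel. norm (f n t) \<le> norm (w t * exp (cmod s * \<bar>l t\<bar>))"
      proof (intro AE_I2)
        fix t
        have "norm (f n t) \<le> (\<Sum>i<Suc n. norm (f i t))" by (simp add: sum_nonneg)
        also have "\<dots> \<le> w t * exp (cmod s * \<bar>l t\<bar>)" by (rule part)
        finally show "norm (f n t) \<le> norm (w t * exp (cmod s * \<bar>l t\<bar>))" using w[of t] by simp
      qed
    qed (auto simp: f_def)
    have "summable (\<lambda>i. LBINT t. norm (f i t))"
    proof (rule summableI_nonneg_bounded)
      fix n
      have "(\<Sum>i<n. LBINT t. norm (f i t)) = (LBINT t. \<Sum>i<n. norm (f i t))"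
        by (rule Bochner_Integration.integral_sum[symmetric]) (use fint in auto)
      also have "\<dots> \<le> (LBINT t. w t * exp (cmod s * \<bar>l t\<bar>))"
        using part by (intro integral_mono dom Bochner_Integration.integrable_sum integrable_norm fint) auto
      finally show "(\<Sum>i<n. LBINT t. norm (f i t)) \<le> (LBINT t. w t * exp (cmod s * \<bar>l t\<bar>))" .
    qed auto
    moreover have "AE t in lborel. summable (\<lambda>i. norm (f i t))"
      unfolding fnorm using sums_summable[OF exps] by (intro AE_I2)
    ultimately have "(\<lambda>i. integral\<^sup>L lborel (f i)) sums (CLBINT t. (\<Sum>i. f i t))"
      by (intro sums_integral fint)
    moreover have "integral\<^sup>L lborel (f i) = a i * s ^ i" for i
      unfolding f_def a_def by (rule integral_mult_left_zero)
    moreover have "(\<Sum>i. f i t) = of_real (w t) * exp (s * of_real (l t))" for t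
    proof -
      have "(\<lambda>n. of_real (w t) * ((s * of_real (l t)) ^ n /\<^sub>R fact n)) sums (of_real (w t) * exp (s * of_real (l t)))"
        by (intro sums_mult exp_converges)
      moreover have "of_real (w t) * ((s * of_real (l t)) ^ n /\<^sub>R fact n) = f n t" for n
        by (simp add: f_def scaleR_conv_of_real power_mult_distrib divide_inverse mult_ac)
      ultimately show ?thesis by (simp add: sums_iff)
    qed
    ultimately show ?thesis by (simp add: h_def)
  qed
  have "h field_differentiable at x" for x
  proof (rule holomorphic_on_imp_differentiable_at)
    show "h holomorphic_on ball 0 (cmod x + 1)"
      using sums by (intro power_series_holomorphic[where a = a]) simp
  qed auto
  then have hol: "h holomorphic_on UNIV"
    by (simp add: holomorphic_on_def)
  have "h s - of_real c0 * exp (of_real k * s\<^sup>2) = 0"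
  proof (rule analytic_continuation[where f = "\<lambda>s. h s - of_real c0 * exp (of_real k * s\<^sup>2)" and S = UNIV and U = "range of_real" and \<xi> = 0])
    show "(\<lambda>s. h s - of_real c0 * exp (of_real k * s\<^sup>2)) holomorphic_on UNIV"
      by (intro holomorphic_intros hol)
    show "(0::complex) islimpt range of_real"
    proof (rule islimptI)
      fix T :: "complex set" assume T: "0 \<in> T" "open T"
      then obtain e where e: "e > 0" "ball 0 e \<subseteq> T" using open_contains_ball by blast
      then have "complex_of_real (e / 2) \<in> T" by (auto simp: subset_iff)
      then show "\<exists>y\<in>range of_real. y \<in> T \<and> y \<noteq> (0::complex)"
        using e(1) by (intro bexI[of _ "complex_of_real (e / 2)"] conjI rangeI) auto
    qed
    fix z :: complex assume "z \<in> range of_real"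
    then obtain r :: real where z: "z = of_real r" by auto
    have "h z = (CLBINT t. of_real (w t * exp (r * l t)))"
      unfolding h_def z by (simp only: of_real_mult exp_of_real[symmetric])
    also have "\<dots> = of_real (LBINT t. w t * exp (r * l t))" by (rule integral_complex_of_real)
    also have "\<dots> = of_real c0 * exp (of_real k * z\<^sup>2)"
      unfolding real z by (simp only: of_real_mult exp_of_real[symmetric] of_real_power)
    finally show "h z - of_real c0 * exp (of_real k * z\<^sup>2) = 0" by simp
  qed auto
  then show ?thesis by (simp add: h_def)
qed

lemma fubini_integrable_bounded:
  fixes a :: "'a::euclidean_space \<Rightarrow> complex" and b :: "'b::euclidean_space \<Rightarrow> complex"
    and k :: "'a \<Rightarrow> 'b \<Rightarrow> complex"
  assumes [measurable]: "a \<in> borel_measurable borel" "b \<in> borel_measurable borel"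
    "(\<lambda>(x, y). k x y) \<in> borel_measurable (borel \<Otimes>\<^sub>M borel)"
    and int: "integrable lborel a" "integrable lborel b" and k: "\<And>x y. cmod (k x y) \<le> K"
  shows "integrable (lborel \<Otimes>\<^sub>M lborel) (\<lambda>(x, y). a x * b y * k x y)"
proof (rule Bochner_Integration.integrable_bound)
  have "integrable (lborel \<Otimes>\<^sub>M lborel) (\<lambda>(x, y). a x * b y)"
  proof (rule lborel_pair.Fubini_integrable)
    have "(\<lambda>x. LBINT y. norm (case (x, y) of (x, y) \<Rightarrow> a x * b y)) = (\<lambda>x. norm (a x) * (LBINT y. norm (b y)))"
      by (simp add: norm_mult)
    then show "integrable lborel (\<lambda>x. LBINT y. norm (case (x, y) of (x, y) \<Rightarrow> a x * b y))"
      using int by (simp add: integrable_mult_left)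
    show "AE x in lborel. integrable lborel (\<lambda>y. case (x, y) of (x, y) \<Rightarrow> a x * b y)"
      using int by (intro AE_I2) simp
  qed measurable
  then show "integrable (lborel \<Otimes>\<^sub>M lborel) (\<lambda>z. K * norm (case z of (x, y) \<Rightarrow> a x * b y))"
    by (intro integrable_mult_right integrable_norm)
  show "AE z in lborel \<Otimes>\<^sub>M lborel. norm (case z of (x, y) \<Rightarrow> a x * b y * k x y) \<le> norm (K * norm (case z of (x, y) \<Rightarrow> a x * b y))"
  proof (intro AE_I2)
    fix z :: "'a \<times> 'b"
    obtain x y where z: "z = (x, y)" by (cases z)
    have "norm (a x * b y) * norm (k x y) \<le> norm (a x * b y) * K" by (intro mult_left_mono k norm_ge_zero)
    also have "\<dots> \<le> norm (K * norm (a x * b y))" by (simp add: mult.commute)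
    finally show "norm (case z of (x, y) \<Rightarrow> a x * b y * k x y) \<le> norm (K * norm (case z of (x, y) \<Rightarrow> a x * b y))"
      by (simp add: z norm_mult)
  qed
qed measurable

section \<open>Approximation by continuous functions, continuity of translations, and a Plancherel
  inequality\<close>

lemma L2_approx_continuous:
  fixes h :: "'a::euclidean_space \<Rightarrow> complex"
  assumes h[measurable]: "h \<in> borel_measurable borel" and int: "integrable lborel (\<lambda>x. (cmod (h x))\<^sup>2)" and \<delta>: "\<delta> > 0"
  obtains g B R where "continuous_on UNIV g" "\<And>x. cmod (g x) \<le> B" "\<And>x. norm x > R \<Longrightarrow> g x = 0" "R \<ge> 0"
    "integrable lborel (\<lambda>x. (cmod (h x - g x))\<^sup>2)" "(LBINT x. (cmod (h x - g x))\<^sup>2) < \<delta>"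
proof -
  \<comment> \<open>Truncation in height and in support reduces to a bounded function on a ball. Its
    continuous approximants converge only almost everywhere; they are clipped and cut off to obtain
    one integrable majorant.\<close>
  define t where "t = (\<lambda>(M::nat) x. if cmod (h x) \<le> real M \<and> norm x \<le> real M then h x else 0)"
  have t[measurable]: "t M \<in> borel_measurable borel" for M unfolding t_def by measurable
  have "(\<lambda>M. LBINT x. (cmod (h x - t M x))\<^sup>2) \<longlonglongrightarrow> (LBINT (x::'a). (0::real))"
  proof (rule integral_dominated_convergence[OF _ _ int])
    show "AE x in lborel. (\<lambda>M. (cmod (h x - t M x))\<^sup>2) \<longlonglongrightarrow> 0"
    proof (intro AE_I2 tendsto_eventually)
      fix x
      obtain N where N: "cmod (h x) + norm x \<le> real N" using real_arch_simple by blast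
      show "\<forall>\<^sub>F M in sequentially. (cmod (h x - t M x))\<^sup>2 = 0"
      proof (rule eventually_sequentiallyI[of N])
        fix M assume "N \<le> M"
        then have "real N \<le> real M" by simp
        then have "cmod (h x) \<le> real M" "norm x \<le> real M"
          using N norm_ge_zero[of x] norm_ge_zero[of "h x"] by linarith+
        then show "(cmod (h x - t M x))\<^sup>2 = 0" by (simp add: t_def)
      qed
    qed
    show "AE x in lborel. norm ((cmod (h x - t M x))\<^sup>2) \<le> (cmod (h x))\<^sup>2" for M
      by (intro AE_I2) (simp add: t_def)
  qed measurable
  then have "(\<lambda>M. LBINT x. (cmod (h x - t M x))\<^sup>2) \<longlonglongrightarrow> 0" by simp
  moreover have "\<delta> / 4 > 0" using \<delta> by simp
  ultimately have "\<forall>\<^sub>F M in sequentially. (LBINT x. (cmod (h x - t M x))\<^sup>2) < \<delta> / 4"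
    by (rule order_tendstoD(2))
  then obtain M0 where M0: "\<And>M. M \<ge> M0 \<Longrightarrow> (LBINT x. (cmod (h x - t M x))\<^sup>2) < \<delta> / 4"
    unfolding eventually_sequentially by blast
  define M where "M = Suc M0"
  have M: "(LBINT x. (cmod (h x - t M x))\<^sup>2) < \<delta> / 4" "real M > 0" using M0 by (auto simp: M_def)
  have hint: "integrable lborel (\<lambda>x. (cmod (h x - t M x))\<^sup>2)"
    by (rule Bochner_Integration.integrable_bound[OF int]) (auto simp: t_def intro!: AE_I2)
  have "t M measurable_on UNIV"
    by (rule lebesgue_measurable_imp_measurable_on) (auto intro: measurable_completion)
  then obtain N g where N: "negligible N" and g: "\<And>n. continuous_on UNIV (g n)"
    and lim: "\<And>x. x \<notin> N \<Longrightarrow> (\<lambda>n. g n x) \<longlonglongrightarrow> t M x"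
    unfolding measurable_on_def by auto
  \<comment> \<open>Radial projection onto the disc of radius \<open>M\<close>, with the case
    distinction hidden in \<open>max\<close> so that it is visibly continuous. The successor in the
    definition of \<open>M\<close> keeps the denominator positive.\<close>
  define clip where "clip = (\<lambda>z::complex. z * of_real (real M / max (real M) (cmod z)))"
  define ct :: "'a \<Rightarrow> real" where "ct = (\<lambda>x. max 0 (min 1 (real M + 1 - norm x)))"
  define g' where "g' = (\<lambda>n x. clip (g n x) * of_real (ct x))"
  have clip_bound: "cmod (clip z) \<le> real M" for z
  proof -
    have "cmod z * real M \<le> max (real M) (cmod z) * real M" by (intro mult_right_mono) auto
    then have "cmod z * real M / max (real M) (cmod z) \<le> real M"
      using M(2) by (subst pos_divide_le_eq) (auto simp: mult.commute)
    then show ?thesis using M(2) by (simp add: clip_def norm_mult norm_divide)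
  qed
  have clip_id: "clip z = z" if "cmod z \<le> real M" for z
    using that M(2) by (simp add: clip_def max_def)
  have cclip: "continuous_on UNIV clip"
    unfolding clip_def using M(2) by (intro continuous_intros) auto
  have ct: "0 \<le> ct x" "ct x \<le> 1" for x by (auto simp: ct_def)
  have ct0: "ct x = 0" if "norm x > real M + 1" for x using that by (simp add: ct_def)
  have cct: "continuous_on UNIV ct" unfolding ct_def by (intro continuous_intros)
  have cg': "continuous_on UNIV (g' n)" for n
    unfolding g'_def by (intro continuous_intros continuous_on_compose2[OF cclip] g cct) auto
  have g'_meas[measurable]: "g' n \<in> borel_measurable borel" for n
    using cg' by (rule borel_measurable_continuous_onI)
  have g'_bound: "cmod (g' n x) \<le> real M" for n x
  proof -
    have "cmod (clip (g n x)) * ct x \<le> real M * 1" using clip_bound ct by (intro mult_mono) auto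
    then show ?thesis using ct[of x] by (simp add: g'_def norm_mult)
  qed
  have g'0: "g' n x = 0" if "norm x > real M + 1" for n x using ct0[OF that] by (simp add: g'_def)
  have t_bound: "cmod (t M x) \<le> real M" for x by (simp add: t_def)
  have dom: "(cmod (t M x - g' n x))\<^sup>2 \<le> 4 * (real M)\<^sup>2 * indicator (cball 0 (real M + 1)) x" for n x
  proof (cases "norm x \<le> real M + 1")
    case True
    have "cmod (t M x - g' n x) \<le> real M + real M"
      using norm_triangle_ineq4[of "t M x" "g' n x"] t_bound[of x] g'_bound[of n x] by linarith
    then have "(cmod (t M x - g' n x))\<^sup>2 \<le> (real M + real M)\<^sup>2" by (intro power_mono) auto
    then show ?thesis using True by (simp add: power2_eq_square)
  next
    case False
    then show ?thesis using g'0 by (simp add: t_def)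
  qed
  have domint: "integrable lborel (\<lambda>x::'a. 4 * (real M)\<^sup>2 * indicator (cball 0 (real M + 1)) x)"
    by (intro integrable_mult_right integrable_real_indicator) (use emeasure_bounded_finite[OF bounded_cball] in \<open>auto simp: top.not_eq_extremum\<close>)
  have tint: "integrable lborel (\<lambda>x. (cmod (t M x - g' n x))\<^sup>2)" for n
    by (rule Bochner_Integration.integrable_bound[OF domint]) (use dom in \<open>auto intro!: AE_I2\<close>)
  have "(\<lambda>n. LBINT x. (cmod (t M x - g' n x))\<^sup>2) \<longlonglongrightarrow> (LBINT (x::'a). (0::real))"
  proof (rule integral_dominated_convergence[OF _ _ domint])
    have "AE x in lebesgue. x \<notin> N"
      using N by (simp add: AE_not_in negligible_iff_null_sets)
    then have "AE x in lborel. x \<notin> N" by (simp add: AE_completion_iff)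
    then show "AE x in lborel. (\<lambda>n. (cmod (t M x - g' n x))\<^sup>2) \<longlonglongrightarrow> 0"
    proof eventually_elim
      case (elim x)
      have "(\<lambda>n. clip (g n x)) \<longlonglongrightarrow> clip (t M x)"
        using cclip lim[OF elim] by (intro isCont_tendsto_compose[of _ clip]) (auto simp: continuous_on_eq_continuous_at)
      then have "(\<lambda>n. clip (g n x) * of_real (ct x)) \<longlonglongrightarrow> clip (t M x) * of_real (ct x)"
        by (intro tendsto_intros)
      moreover have "clip (t M x) * of_real (ct x) = t M x"
        using clip_id[OF t_bound] M(2) by (auto simp: t_def ct_def)
      ultimately have "(\<lambda>n. g' n x) \<longlonglongrightarrow> t M x" by (simp add: g'_def)
      then have "(\<lambda>n. (cmod (t M x - g' n x))\<^sup>2) \<longlonglongrightarrow> (cmod (t M x - t M x))\<^sup>2"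
        by (intro tendsto_intros)
      then show ?case by simp
    qed
    show "AE x in lborel. norm ((cmod (t M x - g' n x))\<^sup>2) \<le> 4 * (real M)\<^sup>2 * indicator (cball 0 (real M + 1)) x" for n
      using dom by (intro AE_I2) auto
  qed measurable
  then have "(\<lambda>n. LBINT x. (cmod (t M x - g' n x))\<^sup>2) \<longlonglongrightarrow> 0" by simp
  moreover have "\<delta> / 4 > 0" using \<delta> by simp
  ultimately have "\<forall>\<^sub>F n in sequentially. (LBINT x. (cmod (t M x - g' n x))\<^sup>2) < \<delta> / 4"
    by (rule order_tendstoD(2))
  then obtain n where n: "(LBINT x. (cmod (t M x - g' n x))\<^sup>2) < \<delta> / 4"
    unfolding eventually_sequentially by blast
  have le: "(cmod (h x - g' n x))\<^sup>2 \<le> 2 * (cmod (h x - t M x))\<^sup>2 + 2 * (cmod (t M x - g' n x))\<^sup>2" for x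
    using sum_square_norm_bound[of "h x - t M x" "t M x - g' n x"] by simp
  have int2: "integrable lborel (\<lambda>x. 2 * (cmod (h x - t M x))\<^sup>2 + 2 * (cmod (t M x - g' n x))\<^sup>2)"
    using hint tint by auto
  have int3: "integrable lborel (\<lambda>x. (cmod (h x - g' n x))\<^sup>2)"
    by (rule Bochner_Integration.integrable_bound[OF int2]) (use le in \<open>auto intro!: AE_I2\<close>)
  have "(LBINT x. (cmod (h x - g' n x))\<^sup>2) \<le> (LBINT x. 2 * (cmod (h x - t M x))\<^sup>2 + 2 * (cmod (t M x - g' n x))\<^sup>2)"
    by (rule integral_mono[OF int3 int2 le])
  also have "\<dots> = 2 * (LBINT x. (cmod (h x - t M x))\<^sup>2) + 2 * (LBINT x. (cmod (t M x - g' n x))\<^sup>2)"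
    using hint tint by simp
  also have "\<dots> < \<delta>" using M(1) n by simp
  finally have "(LBINT x. (cmod (h x - g' n x))\<^sup>2) < \<delta>" .
  then show ?thesis using that[OF cg' g'_bound g'0 _ int3] by simp
qed

lemma L2_translation_continuous:
  fixes h :: "'a::euclidean_space \<Rightarrow> complex" and r :: "nat \<Rightarrow> 'a"
  assumes h[measurable]: "h \<in> borel_measurable borel" and int: "integrable lborel (\<lambda>x. (cmod (h x))\<^sup>2)"
    and r: "r \<longlonglongrightarrow> 0"
  shows "(\<lambda>n. LBINT x. (cmod (h x - h (x + r n)))\<^sup>2) \<longlonglongrightarrow> 0"
proof (rule LIMSEQ_I)
  fix e :: real assume e: "e > 0"
  obtain g B R where g: "continuous_on UNIV g" "\<And>x. cmod (g x) \<le> B" "\<And>x. norm x > R \<Longrightarrow> g x = 0" "R \<ge> 0"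
    and gi: "integrable lborel (\<lambda>x. (cmod (h x - g x))\<^sup>2)" "(LBINT x. (cmod (h x - g x))\<^sup>2) < e / 16"
    using L2_approx_continuous[OF h int, of "e / 16"] e by auto
  have gm[measurable]: "g \<in> borel_measurable borel" by (rule borel_measurable_continuous_onI[OF g(1)])
  obtain N where N: "\<And>n. n \<ge> N \<Longrightarrow> norm (r n) < 1" using LIMSEQ_D[OF r, of 1] by auto
  have domint: "integrable lborel (\<lambda>x::'a. 4 * B\<^sup>2 * indicator (cball 0 (R + 1)) x)"
    by (intro integrable_mult_right integrable_real_indicator) (use emeasure_bounded_finite[OF bounded_cball] in \<open>auto simp: top.not_eq_extremum\<close>)
  have dom: "(cmod (g x - g (x + y)))\<^sup>2 \<le> 4 * B\<^sup>2 * indicator (cball 0 (R + 1)) x" if y: "norm y < 1" for x y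
  proof (cases "norm x \<le> R + 1")
    case True
    have "cmod (g x - g (x + y)) \<le> B + B"
      using norm_triangle_ineq4[of "g x" "g (x + y)"] g(2)[of x] g(2)[of "x + y"] by linarith
    then have "(cmod (g x - g (x + y)))\<^sup>2 \<le> (B + B)\<^sup>2" by (intro power_mono) auto
    then show ?thesis using True by (simp add: power2_eq_square)
  next
    case False
    then have "norm (x + y) > R" using y norm_triangle_ineq2[of x "- y"] by simp
    then show ?thesis using False g(3)[of x] g(3)[of "x + y"] by simp
  qed
  have gri: "integrable lborel (\<lambda>x. (cmod (g x - g (x + y)))\<^sup>2)" if "norm y < 1" for y
    by (rule Bochner_Integration.integrable_bound[OF domint]) (use dom[OF that] in \<open>auto intro!: AE_I2\<close>)
  have "(\<lambda>n. LBINT x. (cmod (g x - g (x + r (n + N))))\<^sup>2) \<longlonglongrightarrow> (LBINT (x::'a). (0::real))"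
  proof (rule integral_dominated_convergence[OF _ _ domint])
    show "AE x in lborel. (\<lambda>n. (cmod (g x - g (x + r (n + N))))\<^sup>2) \<longlonglongrightarrow> 0"
    proof (intro AE_I2)
      fix x
      have "(\<lambda>n. x + r (n + N)) \<longlonglongrightarrow> x + 0" by (intro tendsto_intros LIMSEQ_ignore_initial_segment r)
      then have "(\<lambda>n. g (x + r (n + N))) \<longlonglongrightarrow> g (x + 0)"
        using g(1) by (intro isCont_tendsto_compose[of _ g]) (auto simp: continuous_on_eq_continuous_at)
      then have "(\<lambda>n. (cmod (g x - g (x + r (n + N))))\<^sup>2) \<longlonglongrightarrow> (cmod (g x - g (x + 0)))\<^sup>2"
        by (intro tendsto_intros)
      then show "(\<lambda>n. (cmod (g x - g (x + r (n + N))))\<^sup>2) \<longlonglongrightarrow> 0" by simp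
    qed
    show "AE x in lborel. norm ((cmod (g x - g (x + r (n + N))))\<^sup>2) \<le> 4 * B\<^sup>2 * indicator (cball 0 (R + 1)) x" for n
      using dom[OF N[of "n + N"]] by (intro AE_I2) auto
  qed measurable
  then have "(\<lambda>n. LBINT x. (cmod (g x - g (x + r (n + N))))\<^sup>2) \<longlonglongrightarrow> 0" by simp
  then have lim: "(\<lambda>n. LBINT x. (cmod (g x - g (x + r n)))\<^sup>2) \<longlonglongrightarrow> 0"
    by (rule LIMSEQ_offset[where f = "\<lambda>n. LBINT x. (cmod (g x - g (x + r n)))\<^sup>2"])
  obtain N2 where N2: "\<And>n. n \<ge> N2 \<Longrightarrow> norm (LBINT x. (cmod (g x - g (x + r n)))\<^sup>2) < e / 8"
    using LIMSEQ_D[OF lim, of "e / 8"] e by auto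
  have "norm ((LBINT x. (cmod (h x - h (x + r n)))\<^sup>2) - 0) < e" if n: "n \<ge> max N N2" for n
  proof -
    have n1: "norm (r n) < 1" using N n by simp
    have "(\<lambda>x. (cmod (h (r n + x) - g (r n + x)))\<^sup>2) = (\<lambda>x. (cmod (h (x + r n) - g (x + r n)))\<^sup>2)" by (simp add: add.commute)
    then have tr: "integrable lborel (\<lambda>x. (cmod (h (x + r n) - g (x + r n)))\<^sup>2)"
      "(LBINT x. (cmod (h (x + r n) - g (x + r n)))\<^sup>2) = (LBINT x. (cmod (h x - g x))\<^sup>2)"
      using lborel_integral_translate[of "\<lambda>x. (cmod (h x - g x))\<^sup>2" "r n"] gi(1) by simp_all
    \<comment> \<open>Split through \<open>g\<close> and its translate, each use of the square
      inequality costing a factor 2. With the bounds \<open>e / 16\<close> and \<open>e / 8\<close>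
      the total is below \<open>7 / 8 * e\<close>.\<close>
    have le: "(cmod (h x - h (x + r n)))\<^sup>2 \<le> 2 * (2 * (cmod (h x - g x))\<^sup>2 + 2 * (cmod (g x - g (x + r n)))\<^sup>2) + 2 * (cmod (h (x + r n) - g (x + r n)))\<^sup>2" for x
      using sum_square_norm_bound[of "(h x - g x) + (g x - g (x + r n))" "- (h (x + r n) - g (x + r n))"]
        sum_square_norm_bound[of "h x - g x" "g x - g (x + r n)"]
      unfolding norm_minus_cancel by simp
    have I: "integrable lborel (\<lambda>x. 2 * (2 * (cmod (h x - g x))\<^sup>2 + 2 * (cmod (g x - g (x + r n)))\<^sup>2) + 2 * (cmod (h (x + r n) - g (x + r n)))\<^sup>2)"
      using gi(1) gri[OF n1] tr(1) by auto
    have I0: "integrable lborel (\<lambda>x. (cmod (h x - h (x + r n)))\<^sup>2)"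
      by (rule Bochner_Integration.integrable_bound[OF I]) (use le in \<open>auto intro!: AE_I2\<close>)
    have "(LBINT x. (cmod (h x - h (x + r n)))\<^sup>2) \<le> (LBINT x. 2 * (2 * (cmod (h x - g x))\<^sup>2 + 2 * (cmod (g x - g (x + r n)))\<^sup>2) + 2 * (cmod (h (x + r n) - g (x + r n)))\<^sup>2)"
      by (rule integral_mono[OF I0 I le])
    also have "\<dots> = 2 * (2 * (LBINT x. (cmod (h x - g x))\<^sup>2) + 2 * (LBINT x. (cmod (g x - g (x + r n)))\<^sup>2)) + 2 * (LBINT x. (cmod (h x - g x))\<^sup>2)"
      using gi(1) gri[OF n1] tr by simp
    also have "\<dots> < e" using gi(2) N2[of n] n e by (simp add: abs_less_iff)
    finally show ?thesis by simp
  qed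
  then show "\<exists>no. \<forall>n\<ge>no. norm ((LBINT x. (cmod (h x - h (x + r n)))\<^sup>2) - 0) < e" by blast
qed

text \<open>For a real parameter, completing the square reduces the integral to a translate of
  \<open>c0\<close>; complex parameters follow by analytic continuation. The value of
  \<open>c0\<close> is never computed, only its positivity is used.\<close>

lemma gaussian_bilinear_integral:
  fixes b :: "'a::euclidean_space \<Rightarrow> 'a \<Rightarrow> real"
  assumes b: "bilinear b" "\<And>x y. b x y = b y x" and \<mu>: "\<mu> > 0" "\<And>t. b t t \<ge> \<mu> * (norm t)\<^sup>2"
  defines "c0 \<equiv> LBINT t. exp (- b t t)"
  shows "integrable lborel (\<lambda>t. exp (- b t t + r * b t y))" "c0 > 0"
    "(CLBINT t. of_real (exp (- b t t)) * exp (s * of_real (b t y))) = of_real c0 * exp (of_real (b y y / 4) * s\<^sup>2)"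
proof -
  have lin: "linear (\<lambda>t. b t y)" for y using b(1) by (simp add: bilinear_def)
  have cl[measurable]: "(\<lambda>t. b t y) \<in> borel_measurable borel" for y
    by (intro borel_measurable_continuous_onI linear_continuous_on) (simp add: linear_conv_bounded_linear[symmetric] lin)
  have cq[measurable]: "(\<lambda>t. b t t) \<in> borel_measurable borel"
    by (intro borel_measurable_continuous_onI bilinear_continuous_on_compose[OF _ _ b(1)] continuous_intros)
  have int: "integrable lborel (\<lambda>t. exp (- b t t))"
    by (rule Bochner_Integration.integrable_bound[OF gaussian_integrable[OF \<mu>(1)]]) (use \<mu>(2) in \<open>auto intro!: AE_I2\<close>)
  show c0: "c0 > 0" unfolding c0_def by (rule integrable_pos_integral_pos[OF int]) simp
  have sq: "- b t t + r * b t y = b y y / 4 * r\<^sup>2 + - b (- ((r / 2) *\<^sub>R y) + t) (- ((r / 2) *\<^sub>R y) + t)" for r t y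
    using b(2)[of t y]
    by (simp add: bilinear_lsub[OF b(1)] bilinear_rsub[OF b(1)] bilinear_lmul[OF b(1)] bilinear_rmul[OF b(1)]
      power2_eq_square field_simps)
  have tr: "integrable lborel (\<lambda>t. exp (- b t t + r * b t y)) \<and> (LBINT t. exp (- b t t + r * b t y)) = c0 * exp (b y y / 4 * r\<^sup>2)" for r
    unfolding sq exp_add[of "b y y / 4 * r\<^sup>2"] c0_def
    using lborel_integral_translate[of "\<lambda>t. exp (- b t t)" "- ((r / 2) *\<^sub>R y)"] int by simp
  then show "integrable lborel (\<lambda>t. exp (- b t t + r * b t y))" by blast
  show "(CLBINT t. of_real (exp (- b t t)) * exp (s * of_real (b t y))) = of_real c0 * exp (of_real (b y y / 4) * s\<^sup>2)"
  proof -
    have tr': "integrable lborel (\<lambda>t. exp (- b t t) * exp (r * b t y)) \<and> (LBINT t. exp (- b t t) * exp (r * b t y)) = c0 * exp (b y y / 4 * r\<^sup>2)" for r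
      using tr[of r] by (simp only: exp_add)
    show ?thesis by (rule gaussian_integral_analytic) (use tr' in simp_all)
  qed
qed

text \<open>One inequality with an unspecified constant is enough for a lower frame bound. The
  frequency integral is damped by a wide Gaussian \<open>en\<close>, whose Fourier transform is
  explicit. Fubini turns the damped integral into an average of correlations of \<open>h\<close>
  with its small translates, and these tend to the squared norm. Since \<open>en \<le> 1\<close>,
  damping only decreases the right-hand side.\<close>

lemma plancherel_lower_bound:
  obtains \<kappa> :: real where "\<kappa> > 0"
    "\<And>h :: 'a::euclidean_space \<Rightarrow> complex. h \<in> borel_measurable borel \<Longrightarrow> integrable lborel h \<Longrightarrow> integrable lborel (\<lambda>t. (cmod (h t))\<^sup>2) \<Longrightarrow>
      ennreal (\<kappa> * (LBINT t. (cmod (h t))\<^sup>2)) \<le> (\<integral>\<^sup>+\<omega>. ennreal ((cmod (CLBINT t. h t * exp (- 2 * of_real pi * \<i> * of_real (t \<bullet> \<omega>))))\<^sup>2) \<partial>lborel)"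
proof -
  define e where "e = (\<lambda>t::'a. exp (- pi * (norm t)\<^sup>2))"
  define c0 where "c0 = (LBINT t. e t)"
  have e[measurable]: "e \<in> borel_measurable borel" unfolding e_def by measurable
  have eint: "integrable lborel e" unfolding e_def by (rule gaussian_integrable) simp
  have c0: "c0 > 0" unfolding c0_def by (rule integrable_pos_integral_pos[OF eint]) (simp add: e_def)
  show ?thesis
  proof (rule that[of "c0\<^sup>2"])
    show "c0\<^sup>2 > 0" using c0 by simp
    fix h :: "'a \<Rightarrow> complex"
    assume hm[measurable]: "h \<in> borel_measurable borel" and h1: "integrable lborel h" and h2: "integrable lborel (\<lambda>t. (cmod (h t))\<^sup>2)"
    define N where "N = (LBINT t. (cmod (h t))\<^sup>2)"
    define E where "E = (\<lambda>\<omega> t::'a. exp (- 2 * of_real pi * \<i> * complex_of_real (t \<bullet> \<omega>)))"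
    have E1: "cmod (E \<omega> t) = 1" for \<omega> t by (simp add: E_def norm_exp_eq_Re)
    have Em[measurable]: "(\<lambda>(\<omega>, t). E \<omega> t) \<in> borel_measurable (borel \<Otimes>\<^sub>M borel)" unfolding E_def by measurable
    define H where "H = (\<lambda>\<omega>. CLBINT t. h t * E \<omega> t)"
    have Hm[measurable]: "H \<in> borel_measurable borel" unfolding H_def by measurable
    define K where "K = (LBINT t. cmod (h t))"
    have HK: "cmod (H \<omega>) \<le> K" for \<omega>
      unfolding H_def K_def using integral_norm_bound[of lborel "\<lambda>t. h t * E \<omega> t"] by (simp add: norm_mult E1)
    have ch1: "integrable lborel (\<lambda>t. cnj (h t))" using h1 by simp
    have cm[measurable]: "cnj \<in> borel_measurable borel" by (intro borel_measurable_continuous_onI continuous_intros)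
    \<comment> \<open>The squared distance of \<open>h\<close> to a translate. The real part of the
      correlation of \<open>h\<close> with its translate is \<open>N - D / 2\<close>, so the limit
      reduces to continuity of translations.\<close>
    define D where "D = (\<lambda>r. LBINT s. (cmod (h s - h (s + r)))\<^sup>2)"
    have key: "ennreal (c0 * (LBINT \<rho>. e \<rho> * (N - D ((1 / n) *\<^sub>R \<rho>) / 2))) \<le> (\<integral>\<^sup>+\<omega>. ennreal ((cmod (H \<omega>))\<^sup>2) \<partial>lborel)" if n: "n > 0" for n :: real
    proof -
      define en where "en = (\<lambda>\<omega>::'a. exp (- (pi / n\<^sup>2) * (norm \<omega>)\<^sup>2))"
      have enm[measurable]: "en \<in> borel_measurable borel" unfolding en_def by measurable
      have enint: "integrable lborel en" unfolding en_def using n by (intro gaussian_integrable) simp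
      have en_scale: "en (n *\<^sub>R x) = e x" for x using n by (simp add: en_def e_def power_mult_distrib)
      have cen: "(LBINT \<omega>. en \<omega>) = n ^ DIM('a) * c0"
        using lborel_integral_affine[of en n 0] n by (simp add: en_scale c0_def)
      have ft: "(CLBINT \<omega>. of_real (en \<omega>) * (E \<omega> s * cnj (E \<omega> t))) = of_real (n ^ DIM('a) * c0) * of_real (exp (- pi * n\<^sup>2 * (norm (t - s))\<^sup>2))" for s t
      proof -
        define b where "b = (\<lambda>x y::'a. (pi / n\<^sup>2) * (x \<bullet> y))"
        have bl: "bilinear b" unfolding b_def bilinear_def linear_iff by (simp add: inner_add_left inner_add_right distrib_left)
        have enb: "en \<omega> = exp (- b \<omega> \<omega>)" for \<omega> by (simp add: en_def b_def power2_norm_eq_inner)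
        have "(CLBINT \<omega>. of_real (exp (- b \<omega> \<omega>)) * exp (2 * of_real pi * \<i> * of_real (b \<omega> ((n\<^sup>2 / pi) *\<^sub>R (t - s)))))
            = of_real (LBINT t. exp (- b t t)) * exp (of_real (b ((n\<^sup>2 / pi) *\<^sub>R (t - s)) ((n\<^sup>2 / pi) *\<^sub>R (t - s)) / 4) * (2 * of_real pi * \<i>)\<^sup>2)"
          by (rule gaussian_bilinear_integral(3)[where \<mu> = "pi / n\<^sup>2", OF bl])
             (use n in \<open>auto simp: b_def inner_commute power2_norm_eq_inner\<close>)
        also have "(\<lambda>\<omega>. of_real (exp (- b \<omega> \<omega>)) * exp (2 * of_real pi * \<i> * of_real (b \<omega> ((n\<^sup>2 / pi) *\<^sub>R (t - s)))))
            = (\<lambda>\<omega>. of_real (en \<omega>) * (E \<omega> s * cnj (E \<omega> t)))"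
        proof
          fix \<omega>
          have q: "b \<omega> ((n\<^sup>2 / pi) *\<^sub>R (t - s)) = t \<bullet> \<omega> - s \<bullet> \<omega>"
            using n by (simp add: b_def inner_diff_right inner_commute)
          have "exp (2 * of_real pi * \<i> * of_real (b \<omega> ((n\<^sup>2 / pi) *\<^sub>R (t - s)))) = E \<omega> s * cnj (E \<omega> t)"
            unfolding q by (simp add: E_def exp_cnj algebra_simps flip: exp_add)
          then show "of_real (exp (- b \<omega> \<omega>)) * exp (2 * of_real pi * \<i> * of_real (b \<omega> ((n\<^sup>2 / pi) *\<^sub>R (t - s)))) = of_real (en \<omega>) * (E \<omega> s * cnj (E \<omega> t))"
            by (simp add: enb)
        qed
        also have "(LBINT t. exp (- b t t)) = n ^ DIM('a) * c0" using cen by (simp add: enb)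
        also have "complex_of_real (b ((n\<^sup>2 / pi) *\<^sub>R (t - s)) ((n\<^sup>2 / pi) *\<^sub>R (t - s)) / 4) * (2 * of_real pi * \<i>)\<^sup>2 = of_real (- pi * n\<^sup>2 * (norm (t - s))\<^sup>2)"
          using n by (simp add: b_def power2_norm_eq_inner power_mult_distrib) (simp add: power2_eq_square)
        finally show ?thesis by (simp only: exp_of_real)
      qed
      have F1: "integrable (lborel \<Otimes>\<^sub>M lborel) (\<lambda>(\<omega>, s). of_real (en \<omega>) * h s * (E \<omega> s * cnj (H \<omega>)))"
      proof (rule fubini_integrable_bounded[where K = K])
        show "(\<lambda>(x, y). E x y * cnj (H x)) \<in> borel_measurable (borel \<Otimes>\<^sub>M borel)" by measurable
      qed (use h1 enint HK in \<open>auto simp: norm_mult E1\<close>)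
      have F2: "integrable (lborel \<Otimes>\<^sub>M lborel) (\<lambda>(\<omega>, t). of_real (en \<omega>) * cnj (h t) * (E \<omega> s * cnj (E \<omega> t)))" for s
      proof (rule fubini_integrable_bounded[where K = 1])
        show "(\<lambda>(x, y). E x s * cnj (E x y)) \<in> borel_measurable (borel \<Otimes>\<^sub>M borel)" by measurable
      qed (use ch1 enint in \<open>auto simp: norm_mult E1\<close>)
      define I where "I = (CLBINT \<omega>. of_real (en \<omega> * (cmod (H \<omega>))\<^sup>2))"
      have "I = (CLBINT \<omega>. CLBINT s. of_real (en \<omega>) * h s * (E \<omega> s * cnj (H \<omega>)))"
        unfolding I_def
      proof (rule Bochner_Integration.integral_cong[OF refl])
        fix \<omega>
        have "(CLBINT s. of_real (en \<omega>) * h s * (E \<omega> s * cnj (H \<omega>))) = (CLBINT s. (of_real (en \<omega>) * cnj (H \<omega>)) * (h s * E \<omega> s))"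
          by (simp only: mult_ac)
        also have "\<dots> = (of_real (en \<omega>) * cnj (H \<omega>)) * H \<omega>" unfolding H_def by (rule integral_mult_right_zero)
        also have "\<dots> = of_real (en \<omega> * (cmod (H \<omega>))\<^sup>2)"
          unfolding of_real_mult complex_norm_square by (simp only: mult_ac)
        finally show "of_real (en \<omega> * (cmod (H \<omega>))\<^sup>2) = (CLBINT s. of_real (en \<omega>) * h s * (E \<omega> s * cnj (H \<omega>)))" by simp
      qed
      also have "\<dots> = (CLBINT s. CLBINT \<omega>. of_real (en \<omega>) * h s * (E \<omega> s * cnj (H \<omega>)))"
        by (rule lborel_pair.Fubini_integral[symmetric, OF F1])
      also have "\<dots> = (CLBINT s. of_real c0 * (CLBINT \<rho>. h s * cnj (h (s + (1 / n) *\<^sub>R \<rho>)) * of_real (e \<rho>)))"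
      proof (rule Bochner_Integration.integral_cong[OF refl])
        fix s
        have "(CLBINT \<omega>. of_real (en \<omega>) * h s * (E \<omega> s * cnj (H \<omega>))) = (CLBINT \<omega>. h s * (of_real (en \<omega>) * (E \<omega> s * cnj (H \<omega>))))"
          by (simp only: mult_ac)
        also have "\<dots> = h s * (CLBINT \<omega>. of_real (en \<omega>) * (E \<omega> s * cnj (H \<omega>)))" by (rule integral_mult_right_zero)
        also have "(CLBINT \<omega>. of_real (en \<omega>) * (E \<omega> s * cnj (H \<omega>))) = (CLBINT \<omega>. CLBINT t. of_real (en \<omega>) * cnj (h t) * (E \<omega> s * cnj (E \<omega> t)))"
        proof (rule Bochner_Integration.integral_cong[OF refl])
          fix \<omega>
          have "cnj (H \<omega>) = (CLBINT t. cnj (h t * E \<omega> t))" unfolding H_def by (rule Bochner_Integration.integral_cnj[symmetric])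
          then have "of_real (en \<omega>) * (E \<omega> s * cnj (H \<omega>)) = (of_real (en \<omega>) * E \<omega> s) * (CLBINT t. cnj (h t * E \<omega> t))" by simp
          also have "\<dots> = (CLBINT t. (of_real (en \<omega>) * E \<omega> s) * cnj (h t * E \<omega> t))" by (rule integral_mult_right_zero[symmetric])
          also have "\<dots> = (CLBINT t. of_real (en \<omega>) * cnj (h t) * (E \<omega> s * cnj (E \<omega> t)))" by (simp only: complex_cnj_mult mult_ac)
          finally show "of_real (en \<omega>) * (E \<omega> s * cnj (H \<omega>)) = (CLBINT t. of_real (en \<omega>) * cnj (h t) * (E \<omega> s * cnj (E \<omega> t)))" .
        qed
        also have "\<dots> = (CLBINT t. CLBINT \<omega>. of_real (en \<omega>) * cnj (h t) * (E \<omega> s * cnj (E \<omega> t)))"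
          by (rule lborel_pair.Fubini_integral[symmetric, OF F2])
        also have "\<dots> = (CLBINT t. cnj (h t) * (of_real (n ^ DIM('a) * c0) * of_real (exp (- pi * n\<^sup>2 * (norm (t - s))\<^sup>2))))"
        proof (rule Bochner_Integration.integral_cong[OF refl])
          fix t
          have "(CLBINT \<omega>. of_real (en \<omega>) * cnj (h t) * (E \<omega> s * cnj (E \<omega> t))) = (CLBINT \<omega>. cnj (h t) * (of_real (en \<omega>) * (E \<omega> s * cnj (E \<omega> t))))"
            by (simp only: mult_ac)
          also have "\<dots> = cnj (h t) * (CLBINT \<omega>. of_real (en \<omega>) * (E \<omega> s * cnj (E \<omega> t)))" by (rule integral_mult_right_zero)
          finally show "(CLBINT \<omega>. of_real (en \<omega>) * cnj (h t) * (E \<omega> s * cnj (E \<omega> t))) = cnj (h t) * (of_real (n ^ DIM('a) * c0) * of_real (exp (- pi * n\<^sup>2 * (norm (t - s))\<^sup>2)))"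
            by (simp only: ft)
        qed
        \<comment> \<open>Substitution \<open>t = s + \<rho> / n\<close>. The Jacobian cancels the
          factor \<open>n ^ DIM('a)\<close> of the Fourier transform, and the narrow Gaussian
          becomes the fixed \<open>e\<close>.\<close>
        also have "\<dots> = \<bar>1 / n\<bar> ^ DIM('a) *\<^sub>R (CLBINT \<rho>. cnj (h (s + (1 / n) *\<^sub>R \<rho>)) * (of_real (n ^ DIM('a) * c0) * of_real (exp (- pi * n\<^sup>2 * (norm (s + (1 / n) *\<^sub>R \<rho> - s))\<^sup>2))))"
          by (rule lborel_integral_affine) (use n in auto)
        also have "\<dots> = \<bar>1 / n\<bar> ^ DIM('a) *\<^sub>R (CLBINT \<rho>. of_real (n ^ DIM('a) * c0) * (cnj (h (s + (1 / n) *\<^sub>R \<rho>)) * of_real (e \<rho>)))"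
          using n by (simp add: e_def power_mult_distrib power_divide mult_ac)
        also have "\<dots> = of_real c0 * (CLBINT \<rho>. cnj (h (s + (1 / n) *\<^sub>R \<rho>)) * of_real (e \<rho>))"
          using n by (simp add: scaleR_conv_of_real power_divide)
        finally have "(CLBINT \<omega>. of_real (en \<omega>) * h s * (E \<omega> s * cnj (H \<omega>))) = of_real c0 * (h s * (CLBINT \<rho>. cnj (h (s + (1 / n) *\<^sub>R \<rho>)) * of_real (e \<rho>)))"
          by (simp only: mult_ac)
        also have "h s * (CLBINT \<rho>. cnj (h (s + (1 / n) *\<^sub>R \<rho>)) * of_real (e \<rho>)) = (CLBINT \<rho>. h s * (cnj (h (s + (1 / n) *\<^sub>R \<rho>)) * of_real (e \<rho>)))"
          by (rule integral_mult_right_zero[symmetric])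
        finally show "(CLBINT \<omega>. of_real (en \<omega>) * h s * (E \<omega> s * cnj (H \<omega>))) = of_real c0 * (CLBINT \<rho>. h s * cnj (h (s + (1 / n) *\<^sub>R \<rho>)) * of_real (e \<rho>))"
          by (simp only: mult.assoc)
      qed
      also have "\<dots> = of_real c0 * (CLBINT s. CLBINT \<rho>. h s * cnj (h (s + (1 / n) *\<^sub>R \<rho>)) * of_real (e \<rho>))"
        by (rule integral_mult_right_zero)
      finally have I1: "I = of_real c0 * (CLBINT s. CLBINT \<rho>. h s * cnj (h (s + (1 / n) *\<^sub>R \<rho>)) * of_real (e \<rho>))" .
      have tr: "integrable lborel (\<lambda>s. (cmod (h (s + y)))\<^sup>2)" "(LBINT s. (cmod (h (s + y)))\<^sup>2) = N" for y
        using lborel_integral_translate[of "\<lambda>t. (cmod (h t))\<^sup>2" y] h2 by (simp_all add: add.commute N_def)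
      have v1: "integrable (lborel \<Otimes>\<^sub>M lborel) (\<lambda>(\<rho>, s). e \<rho> * (cmod (h s))\<^sup>2)"
      proof (rule lborel_pair.Fubini_integrable)
        have "(\<lambda>x. LBINT y. norm (case (x, y) of (\<rho>, s) \<Rightarrow> e \<rho> * (cmod (h s))\<^sup>2)) = (\<lambda>x. e x * N)"
          by (simp add: N_def e_def)
        then show "integrable lborel (\<lambda>x. LBINT y. norm (case (x, y) of (\<rho>, s) \<Rightarrow> e \<rho> * (cmod (h s))\<^sup>2))" using eint by simp
      qed (use h2 in auto)
      have v2: "integrable (lborel \<Otimes>\<^sub>M lborel) (\<lambda>(\<rho>, s). e \<rho> * (cmod (h (s + (1 / n) *\<^sub>R \<rho>)))\<^sup>2)"
      proof (rule lborel_pair.Fubini_integrable)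
        have "(\<lambda>x. LBINT y. norm (case (x, y) of (\<rho>, s) \<Rightarrow> e \<rho> * (cmod (h (s + (1 / n) *\<^sub>R \<rho>)))\<^sup>2)) = (\<lambda>x. e x * N)"
          by (simp add: tr e_def)
        then show "integrable lborel (\<lambda>x. LBINT y. norm (case (x, y) of (\<rho>, s) \<Rightarrow> e \<rho> * (cmod (h (s + (1 / n) *\<^sub>R \<rho>)))\<^sup>2))" using eint by simp
      qed (use tr in auto)
      have prod_le: "cmod x * cmod y \<le> (cmod x)\<^sup>2 + (cmod y)\<^sup>2" for x y
        using sum_squares_bound[of "cmod x" "cmod y"] mult_nonneg_nonneg[of "cmod x" "cmod y"] norm_ge_zero[of x] norm_ge_zero[of y]
        by linarith
      have u: "integrable (lborel \<Otimes>\<^sub>M lborel) (\<lambda>(\<rho>, s). h s * cnj (h (s + (1 / n) *\<^sub>R \<rho>)) * of_real (e \<rho>))"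
      proof (rule Bochner_Integration.integrable_bound[OF Bochner_Integration.integrable_add[OF v1 v2]])
        show "AE x in lborel \<Otimes>\<^sub>M lborel. norm (case x of (\<rho>, s) \<Rightarrow> h s * cnj (h (s + (1 / n) *\<^sub>R \<rho>)) * of_real (e \<rho>))
           \<le> norm ((case x of (\<rho>, s) \<Rightarrow> e \<rho> * (cmod (h s))\<^sup>2) + (case x of (\<rho>, s) \<Rightarrow> e \<rho> * (cmod (h (s + (1 / n) *\<^sub>R \<rho>)))\<^sup>2))"
        proof (intro AE_I2, clarify)
          fix \<rho> s
          have "e \<rho> * (cmod (h s) * cmod (h (s + (1 / n) *\<^sub>R \<rho>))) \<le> e \<rho> * ((cmod (h s))\<^sup>2 + (cmod (h (s + (1 / n) *\<^sub>R \<rho>)))\<^sup>2)"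
            by (intro mult_left_mono prod_le) (simp add: e_def)
          also have "\<dots> \<le> norm (e \<rho> * (cmod (h s))\<^sup>2 + e \<rho> * (cmod (h (s + (1 / n) *\<^sub>R \<rho>)))\<^sup>2)"
            by (simp add: distrib_left)
          finally show "norm (h s * cnj (h (s + (1 / n) *\<^sub>R \<rho>)) * of_real (e \<rho>)) \<le> norm (e \<rho> * (cmod (h s))\<^sup>2 + e \<rho> * (cmod (h (s + (1 / n) *\<^sub>R \<rho>)))\<^sup>2)"
            by (simp add: norm_mult e_def mult_ac)
        qed
      qed measurable
      have swap: "(CLBINT s. CLBINT \<rho>. h s * cnj (h (s + (1 / n) *\<^sub>R \<rho>)) * of_real (e \<rho>)) = (CLBINT \<rho>. CLBINT s. h s * cnj (h (s + (1 / n) *\<^sub>R \<rho>)) * of_real (e \<rho>))"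
        by (rule lborel_pair.Fubini_integral[OF u])
      have intg: "integrable lborel (\<lambda>\<rho>. CLBINT s. h s * cnj (h (s + (1 / n) *\<^sub>R \<rho>)) * of_real (e \<rho>))"
        by (rule lborel_pair.integrable_fst[OF u])
      have Rept: "Re (CLBINT s. h s * cnj (h (s + (1 / n) *\<^sub>R \<rho>)) * of_real (e \<rho>)) = e \<rho> * (N - D ((1 / n) *\<^sub>R \<rho>) / 2)" for \<rho>
      proof -
        define y where "y = (1 / n) *\<^sub>R \<rho>"
        have i12: "integrable lborel (\<lambda>s. (cmod (h s))\<^sup>2 + (cmod (h (s + y)))\<^sup>2)" using tr h2 by simp
        have i: "integrable lborel (\<lambda>s. h s * cnj (h (s + y)))"
          by (rule Bochner_Integration.integrable_bound[OF i12]) (auto intro!: AE_I2 order_trans[OF prod_le] simp: norm_mult)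
        have i2: "integrable lborel (\<lambda>s. 2 * (cmod (h s))\<^sup>2 + 2 * (cmod (h (s + y)))\<^sup>2)" using tr h2 by simp
        have i3: "integrable lborel (\<lambda>s. (cmod (h s - h (s + y)))\<^sup>2)"
          by (rule Bochner_Integration.integrable_bound[OF i2])
             (use sum_square_norm_bound[of "h _" "- h (_ + y)"] in \<open>auto intro!: AE_I2\<close>)
        have "Re (CLBINT s. h s * cnj (h (s + y)) * of_real (e \<rho>)) = Re ((CLBINT s. h s * cnj (h (s + y))) * of_real (e \<rho>))"
          by simp
        also have "\<dots> = e \<rho> * Re (CLBINT s. h s * cnj (h (s + y)))" by simp
        also have "Re (CLBINT s. h s * cnj (h (s + y))) = (LBINT s. Re (h s * cnj (h (s + y))))"
          by (rule integral_bounded_linear[OF bounded_linear_Re i, symmetric])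
        also have "\<dots> = (LBINT s. ((cmod (h s))\<^sup>2 + (cmod (h (s + y)))\<^sup>2 - (cmod (h s - h (s + y)))\<^sup>2) / 2)"
          unfolding cmod_power2 by (intro Bochner_Integration.integral_cong refl) (simp add: power2_eq_square algebra_simps)
        also have "\<dots> = N - D y / 2" using h2 tr i3 by (simp add: N_def D_def)
        finally show ?thesis by (simp add: y_def)
      qed
      have "Re (CLBINT \<rho>. CLBINT s. h s * cnj (h (s + (1 / n) *\<^sub>R \<rho>)) * of_real (e \<rho>))
          = (LBINT \<rho>. Re (CLBINT s. h s * cnj (h (s + (1 / n) *\<^sub>R \<rho>)) * of_real (e \<rho>)))"
        by (rule integral_bounded_linear[OF bounded_linear_Re intg, symmetric])
      also have "\<dots> = (LBINT \<rho>. e \<rho> * (N - D ((1 / n) *\<^sub>R \<rho>) / 2))" by (simp only: Rept)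
      moreover have "Re (of_real c0 * z) = c0 * Re z" for z by simp
      ultimately have ReI: "Re I = c0 * (LBINT \<rho>. e \<rho> * (N - D ((1 / n) *\<^sub>R \<rho>) / 2))"
        unfolding I1 swap by (simp only:)
      have iH: "integrable lborel (\<lambda>\<omega>. en \<omega> * (cmod (H \<omega>))\<^sup>2)"
      proof (rule Bochner_Integration.integrable_bound)
        show "integrable lborel (\<lambda>\<omega>. en \<omega> * K\<^sup>2)" using enint by simp
        show "AE \<omega> in lborel. norm (en \<omega> * (cmod (H \<omega>))\<^sup>2) \<le> norm (en \<omega> * K\<^sup>2)"
          using HK by (intro AE_I2) (auto simp: en_def intro!: power_mono)
      qed measurable
      have "I = of_real (LBINT \<omega>. en \<omega> * (cmod (H \<omega>))\<^sup>2)" unfolding I_def by (rule integral_complex_of_real)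
      then have "ennreal (Re I) = (\<integral>\<^sup>+\<omega>. ennreal (en \<omega> * (cmod (H \<omega>))\<^sup>2) \<partial>lborel)"
        by (subst nn_integral_eq_integral[OF iH]) (auto simp: en_def)
      also have "\<dots> \<le> (\<integral>\<^sup>+\<omega>. ennreal ((cmod (H \<omega>))\<^sup>2) \<partial>lborel)"
        by (intro nn_integral_mono ennreal_leI mult_left_le_one_le) (auto simp: en_def)
      finally show ?thesis by (simp add: ReI)
    qed
    have tr: "integrable lborel (\<lambda>s. (cmod (h (s + y)))\<^sup>2)" "(LBINT s. (cmod (h (s + y)))\<^sup>2) = N" for y
      using lborel_integral_translate[of "\<lambda>t. (cmod (h t))\<^sup>2" y] h2 by (simp_all add: add.commute N_def)
    have D0: "0 \<le> D y" for y unfolding D_def by (intro Bochner_Integration.integral_nonneg) simp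
    \<comment> \<open>Together with \<open>D \<ge> 0\<close> this gives
      \<open>|N - D / 2| \<le> N\<close>, the majorant needed for dominated convergence.\<close>
    have D4: "D y \<le> 4 * N" for y
    proof -
      have i2: "integrable lborel (\<lambda>s. 2 * (cmod (h s))\<^sup>2 + 2 * (cmod (h (s + y)))\<^sup>2)" using tr h2 by simp
      have le: "(cmod (h s - h (s + y)))\<^sup>2 \<le> 2 * (cmod (h s))\<^sup>2 + 2 * (cmod (h (s + y)))\<^sup>2" for s
        using sum_square_norm_bound[of "h s" "- h (s + y)"] by simp
      have i3: "integrable lborel (\<lambda>s. (cmod (h s - h (s + y)))\<^sup>2)"
        by (rule Bochner_Integration.integrable_bound[OF i2]) (use le in \<open>auto intro!: AE_I2\<close>)
      have "D y \<le> (LBINT s. 2 * (cmod (h s))\<^sup>2 + 2 * (cmod (h (s + y)))\<^sup>2)"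
        unfolding D_def by (rule integral_mono[OF i3 i2 le])
      also have "\<dots> = 4 * N" using tr h2 by (simp add: N_def)
      finally show ?thesis .
    qed
    have Dm[measurable]: "D \<in> borel_measurable borel" unfolding D_def by measurable
    have "(\<lambda>n. LBINT \<rho>. e \<rho> * (N - D ((1 / real (Suc n)) *\<^sub>R \<rho>) / 2)) \<longlonglongrightarrow> (LBINT \<rho>. e \<rho> * (N - 0 / 2))"
    proof (rule integral_dominated_convergence)
      show "integrable lborel (\<lambda>\<rho>. e \<rho> * N)" using eint by simp
      show "AE \<rho> in lborel. (\<lambda>n. e \<rho> * (N - D ((1 / real (Suc n)) *\<^sub>R \<rho>) / 2)) \<longlonglongrightarrow> e \<rho> * (N - 0 / 2)"
      proof (intro AE_I2 tendsto_intros)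
        fix \<rho> :: 'a
        have "(\<lambda>n. (1 / real (Suc n)) *\<^sub>R \<rho>) \<longlonglongrightarrow> 0 *\<^sub>R \<rho>"
          using LIMSEQ_inverse_real_of_nat by (intro tendsto_intros) (simp add: inverse_eq_divide)
        then show "(\<lambda>n. D ((1 / real (Suc n)) *\<^sub>R \<rho>)) \<longlonglongrightarrow> 0"
          unfolding D_def by (intro L2_translation_continuous hm h2) simp
      qed simp
      show "AE \<rho> in lborel. norm (e \<rho> * (N - D ((1 / real (Suc n)) *\<^sub>R \<rho>) / 2)) \<le> e \<rho> * N" for n
      proof (intro AE_I2)
        fix \<rho>
        have "\<bar>N - D ((1 / real (Suc n)) *\<^sub>R \<rho>) / 2\<bar> \<le> N"
          using D0[of "(1 / real (Suc n)) *\<^sub>R \<rho>"] D4[of "(1 / real (Suc n)) *\<^sub>R \<rho>"] by (simp only: abs_le_iff) linarith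
        then have "e \<rho> * \<bar>N - D ((1 / real (Suc n)) *\<^sub>R \<rho>) / 2\<bar> \<le> e \<rho> * N" by (intro mult_left_mono) (simp_all add: e_def)
        then show "norm (e \<rho> * (N - D ((1 / real (Suc n)) *\<^sub>R \<rho>) / 2)) \<le> e \<rho> * N" by (simp add: abs_mult e_def)
      qed
    qed measurable
    then have "(\<lambda>n. c0 * (LBINT \<rho>. e \<rho> * (N - D ((1 / real (Suc n)) *\<^sub>R \<rho>) / 2))) \<longlonglongrightarrow> c0 * (c0 * N)"
      by (intro tendsto_intros) (simp add: c0_def)
    then have "(\<lambda>n. ennreal (c0 * (LBINT \<rho>. e \<rho> * (N - D ((1 / real (Suc n)) *\<^sub>R \<rho>) / 2)))) \<longlonglongrightarrow> ennreal (c0 * (c0 * N))"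
      by (rule tendsto_ennrealI)
    then have "ennreal (c0 * (c0 * N)) \<le> (\<integral>\<^sup>+\<omega>. ennreal ((cmod (H \<omega>))\<^sup>2) \<partial>lborel)"
      by (rule LIMSEQ_le_const2) (use key in auto)
    then show "ennreal (c0\<^sup>2 * (LBINT t. (cmod (h t))\<^sup>2)) \<le> (\<integral>\<^sup>+\<omega>. ennreal ((cmod (CLBINT t. h t * exp (- 2 * of_real pi * \<i> * of_real (t \<bullet> \<omega>))))\<^sup>2) \<partial>lborel)"
      unfolding H_def E_def N_def by (simp only: power2_eq_square mult.assoc)
  qed
qed

text \<open>Elements of \<open>L2\<close> are only Lebesgue measurable, whereas the integrations
  over products are carried out for Borel functions and \<open>lborel\<close>. Real and imaginary
  parts are replaced separately.\<close>

lemma L2_borel_representative: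
  assumes f: "f \<in> L2"
  obtains f' where "f' \<in> borel_measurable borel" "AE t in lborel. f t = f' t"
proof -
  have m: "f \<in> borel_measurable lebesgue" using f by (rule L2_D)
  have "(\<lambda>t. Re (f t)) \<in> borel_measurable lebesgue" "(\<lambda>t. Im (f t)) \<in> borel_measurable lebesgue"
    using m by measurable
  note this[THEN completion_ex_borel_measurable_real]
  then obtain r i where ri: "r \<in> borel_measurable lborel" "AE t in lborel. Re (f t) = r t"
    "i \<in> borel_measurable lborel" "AE t in lborel. Im (f t) = i t"
    by blast
  have "(\<lambda>t. complex_of_real (r t) + \<i> * complex_of_real (i t)) \<in> borel_measurable borel"
    using ri(1,3) by measurable
  moreover have "AE t in lborel. f t = complex_of_real (r t) + \<i> * complex_of_real (i t)"
    using ri(2,4) by eventually_elim (simp add: complex_eq_iff)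
  ultimately show ?thesis by (rule that)
qed

lemma L2_of_borel:
  assumes "g \<in> borel_measurable borel" "integrable lborel (\<lambda>t. (cmod (g t))\<^sup>2)"
  shows "g \<in> L2"
proof (rule L2_I)
  show "g \<in> borel_measurable lebesgue" using assms(1) by (auto intro: measurable_completion)
  show "integrable lebesgue (\<lambda>t. (cmod (g t))\<^sup>2)"
    using assms by (subst integrable_completion) auto
qed

lemma L2_inner_borel:
  assumes f: "f \<in> L2" and f'[measurable]: "f' \<in> borel_measurable borel" "AE t in lborel. f t = f' t"
    and g[measurable]: "g \<in> borel_measurable borel"
  shows "L2_inner f g = (CLBINT t. f' t * cnj (g t))"
proof -
  have cm[measurable]: "cnj \<in> borel_measurable borel" by (intro borel_measurable_continuous_onI continuous_intros)
  have m': "(\<lambda>t. f' t * cnj (g t)) \<in> borel_measurable borel" by measurable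
  have mc: "(\<lambda>t. cnj (g t)) \<in> borel_measurable lebesgue" by (rule measurable_completion) measurable
  have "L2_inner f g = (LINT t|lebesgue. f' t * cnj (g t))"
    unfolding L2_inner_def
  proof (rule integral_cong_AE)
    show "(\<lambda>t. f t * cnj (g t)) \<in> borel_measurable lebesgue"
      using L2_D(1)[OF f] mc by (rule borel_measurable_times)
    show "(\<lambda>t. f' t * cnj (g t)) \<in> borel_measurable lebesgue"
      by (rule measurable_completion) (use m' in simp)
    show "AE t in lebesgue. f t * cnj (g t) = f' t * cnj (g t)"
      using AE_completion[OF f'(2)] by eventually_elim simp
  qed
  also have "\<dots> = (CLBINT t. f' t * cnj (g t))"
    using m' by (intro integral_completion) simp
  finally show ?thesis .
qed

lemma L2_norm_borel:
  assumes f: "f \<in> L2" and f'[measurable]: "f' \<in> borel_measurable borel" "AE t in lborel. f t = f' t"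
  shows "(L2_norm f)\<^sup>2 = (LBINT t. (cmod (f' t))\<^sup>2)" "integrable lborel (\<lambda>t. (cmod (f' t))\<^sup>2)"
proof -
  have m': "(\<lambda>t. (cmod (f' t))\<^sup>2) \<in> borel_measurable borel" by measurable
  have ml: "(\<lambda>t. (cmod (f' t))\<^sup>2) \<in> borel_measurable lebesgue"
    by (rule measurable_completion) (use m' in simp)
  have ml2: "(\<lambda>t. (cmod (f t))\<^sup>2) \<in> borel_measurable lebesgue"
    using L2_D(1)[OF f] by measurable
  have ae: "AE t in lebesgue. (cmod (f t))\<^sup>2 = (cmod (f' t))\<^sup>2"
    using AE_completion[OF f'(2)] by eventually_elim simp
  have "integrable lebesgue (\<lambda>t. (cmod (f' t))\<^sup>2)"
    using L2_D(2)[OF f] integrable_cong_AE[OF ml2 ml ae] by simp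
  then show "integrable lborel (\<lambda>t. (cmod (f' t))\<^sup>2)"
    using m' by (subst (asm) integrable_completion) auto
  have "(L2_norm f)\<^sup>2 = (LINT t|lebesgue. (cmod (f' t))\<^sup>2)"
    unfolding L2_norm_power2 by (rule integral_cong_AE[OF ml2 ml ae])
  also have "\<dots> = (LBINT t. (cmod (f' t))\<^sup>2)" using m' by (intro integral_completion) simp
  finally show "(L2_norm f)\<^sup>2 = (LBINT t. (cmod (f' t))\<^sup>2)" .
qed

text \<open>For fixed \<open>x\<close> the inner products are the Fourier transform of
  \<open>f\<close> times the conjugated translate of \<open>g\<close>. The Plancherel inequality
  applies to this product, and integrating over \<open>x\<close> with Tonelli separates the norms of
  \<open>f\<close> and \<open>g\<close>. Boundedness of \<open>g\<close> puts the product into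
  \<open>L2\<close>.\<close>

lemma stft_lower_bound:
  obtains \<kappa> :: real where "\<kappa> > 0"
    "\<And>(f :: real ^ 'd::finite \<Rightarrow> complex) g B. f \<in> L2 \<Longrightarrow> g \<in> borel_measurable borel \<Longrightarrow> integrable lborel (\<lambda>t. (cmod (g t))\<^sup>2) \<Longrightarrow>
      (\<And>t. cmod (g t) \<le> B) \<Longrightarrow>
      ennreal (\<kappa> * (L2_norm f)\<^sup>2 * (LBINT t. (cmod (g t))\<^sup>2))
        \<le> (\<integral>\<^sup>+x. \<integral>\<^sup>+\<omega>. ennreal ((cmod (L2_inner f (\<lambda>t. exp (2 * of_real pi * \<i> * of_real (t \<bullet> \<omega>)) * g (t - x))))\<^sup>2) \<partial>lborel \<partial>lborel)"
proof -
  obtain \<kappa> :: real where \<kappa>: "\<kappa> > 0" "\<And>h :: real ^ 'd \<Rightarrow> complex. h \<in> borel_measurable borel \<Longrightarrow> integrable lborel h \<Longrightarrow> integrable lborel (\<lambda>t. (cmod (h t))\<^sup>2) \<Longrightarrow>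
      ennreal (\<kappa> * (LBINT t. (cmod (h t))\<^sup>2)) \<le> (\<integral>\<^sup>+\<omega>. ennreal ((cmod (CLBINT t. h t * exp (- 2 * of_real pi * \<i> * of_real (t \<bullet> \<omega>))))\<^sup>2) \<partial>lborel)"
    by (rule plancherel_lower_bound) (rule that)
  show ?thesis
  proof (rule that[OF \<kappa>(1)])
    fix f g :: "real ^ 'd \<Rightarrow> complex" and B :: real
    assume f: "f \<in> L2" and g[measurable]: "g \<in> borel_measurable borel" and gi: "integrable lborel (\<lambda>t. (cmod (g t))\<^sup>2)"
      and B: "\<And>t. cmod (g t) \<le> B"
    obtain f' where f'[measurable]: "f' \<in> borel_measurable borel" and ae: "AE t in lborel. f t = f' t"
      using L2_borel_representative[OF f] by blast
    note fn = L2_norm_borel[OF f f' ae]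
    have cm[measurable]: "cnj \<in> borel_measurable borel" by (intro borel_measurable_continuous_onI continuous_intros)
    define h where "h = (\<lambda>x t. f' t * cnj (g (t - x)))"
    have hm[measurable]: "h x \<in> borel_measurable borel" for x unfolding h_def by measurable
    have gt: "integrable lborel (\<lambda>t. (cmod (g (t - x)))\<^sup>2)" for x
      using lborel_integral_translate(1)[of "\<lambda>t. (cmod (g t))\<^sup>2" "- x"] gi by simp
    have prod_le: "cmod x * cmod y \<le> (cmod x)\<^sup>2 + (cmod y)\<^sup>2" for x y
      using sum_squares_bound[of "cmod x" "cmod y"] mult_nonneg_nonneg[of "cmod x" "cmod y"] norm_ge_zero[of x] norm_ge_zero[of y]
      by linarith
    have h1: "integrable lborel (h x)" for x
      by (rule Bochner_Integration.integrable_bound[OF Bochner_Integration.integrable_add[OF fn(2) gt[of x]]])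
         (auto simp: h_def norm_mult intro!: AE_I2 order_trans[OF prod_le])
    have h2: "integrable lborel (\<lambda>t. (cmod (h x t))\<^sup>2)" for x
    proof (rule Bochner_Integration.integrable_bound[OF integrable_mult_right[OF fn(2), of "B\<^sup>2"]])
      show "AE t in lborel. norm ((cmod (h x t))\<^sup>2) \<le> norm (B\<^sup>2 * (cmod (f' t))\<^sup>2)"
      proof (intro AE_I2)
        fix t
        have "(cmod (g (t - x)))\<^sup>2 * (cmod (f' t))\<^sup>2 \<le> B\<^sup>2 * (cmod (f' t))\<^sup>2"
          using B by (intro mult_right_mono power_mono) auto
        then show "norm ((cmod (h x t))\<^sup>2) \<le> norm (B\<^sup>2 * (cmod (f' t))\<^sup>2)"
          by (simp add: h_def norm_mult power_mult_distrib mult.commute)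
      qed
    qed measurable
    have inner: "L2_inner f (\<lambda>t. exp (2 * of_real pi * \<i> * of_real (t \<bullet> \<omega>)) * g (t - x)) = (CLBINT t. h x t * exp (- 2 * of_real pi * \<i> * of_real (t \<bullet> \<omega>)))" for x \<omega>
    proof -
      have "L2_inner f (\<lambda>t. exp (2 * of_real pi * \<i> * of_real (t \<bullet> \<omega>)) * g (t - x))
          = (CLBINT t. f' t * cnj (exp (2 * of_real pi * \<i> * of_real (t \<bullet> \<omega>)) * g (t - x)))"
        by (rule L2_inner_borel[OF f f' ae]) measurable
      also have "\<dots> = (CLBINT t. h x t * exp (- 2 * of_real pi * \<i> * of_real (t \<bullet> \<omega>)))"
        by (intro Bochner_Integration.integral_cong refl) (simp add: h_def exp_cnj mult_ac)
      finally show ?thesis .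
    qed
    have G: "(\<integral>\<^sup>+x. ennreal ((cmod (g (t - x)))\<^sup>2) \<partial>lborel) = ennreal (LBINT t. (cmod (g t))\<^sup>2)" for t
    proof -
      have "(\<integral>\<^sup>+x. ennreal ((cmod (g x))\<^sup>2) \<partial>lborel) = ennreal (\<bar>- 1\<bar> ^ DIM(real ^ 'd)) * (\<integral>\<^sup>+x. ennreal ((cmod (g (t + (- 1) *\<^sub>R x)))\<^sup>2) \<partial>lborel)"
        by (rule lborel_nn_integral_affine) auto
      then show ?thesis using nn_integral_eq_integral[OF gi] by simp
    qed
    have "ennreal (\<kappa> * (L2_norm f)\<^sup>2 * (LBINT t. (cmod (g t))\<^sup>2)) = ennreal \<kappa> * (ennreal (L2_norm f ^ 2) * ennreal (LBINT t. (cmod (g t))\<^sup>2))"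
      by (simp only: mult.assoc ennreal_mult'[OF less_imp_le[OF \<kappa>(1)]] ennreal_mult'[OF zero_le_power2])
    also have "ennreal (L2_norm f ^ 2) * ennreal (LBINT t. (cmod (g t))\<^sup>2) = (\<integral>\<^sup>+t. ennreal ((cmod (f' t))\<^sup>2) * ennreal (LBINT t. (cmod (g t))\<^sup>2) \<partial>lborel)"
      unfolding fn(1) using nn_integral_eq_integral[OF fn(2)] by (simp add: nn_integral_multc)
    also have "\<dots> = (\<integral>\<^sup>+t. \<integral>\<^sup>+x. ennreal ((cmod (f' t))\<^sup>2) * ennreal ((cmod (g (t - x)))\<^sup>2) \<partial>lborel \<partial>lborel)"
      by (simp add: G nn_integral_cmult)
    also have "\<dots> = (\<integral>\<^sup>+x. \<integral>\<^sup>+t. ennreal ((cmod (f' t))\<^sup>2) * ennreal ((cmod (g (t - x)))\<^sup>2) \<partial>lborel \<partial>lborel)"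
      by (rule lborel_pair.Fubini'[symmetric]) measurable
    also have "ennreal \<kappa> * \<dots> = (\<integral>\<^sup>+x. ennreal \<kappa> * (\<integral>\<^sup>+t. ennreal ((cmod (f' t))\<^sup>2) * ennreal ((cmod (g (t - x)))\<^sup>2) \<partial>lborel) \<partial>lborel)"
      by (rule nn_integral_cmult[symmetric]) measurable
    also have "\<dots> = (\<integral>\<^sup>+x. ennreal (\<kappa> * (LBINT t. (cmod (h x t))\<^sup>2)) \<partial>lborel)"
    proof (rule nn_integral_cong)
      fix x
      have "(\<integral>\<^sup>+t. ennreal ((cmod (f' t))\<^sup>2) * ennreal ((cmod (g (t - x)))\<^sup>2) \<partial>lborel) = (\<integral>\<^sup>+t. ennreal ((cmod (h x t))\<^sup>2) \<partial>lborel)"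
        by (intro nn_integral_cong) (simp add: h_def norm_mult power_mult_distrib ennreal_mult)
      also have "\<dots> = ennreal (LBINT t. (cmod (h x t))\<^sup>2)" by (rule nn_integral_eq_integral[OF h2]) simp
      finally show "ennreal \<kappa> * (\<integral>\<^sup>+t. ennreal ((cmod (f' t))\<^sup>2) * ennreal ((cmod (g (t - x)))\<^sup>2) \<partial>lborel) = ennreal (\<kappa> * (LBINT t. (cmod (h x t))\<^sup>2))"
        using \<kappa>(1) by (simp add: ennreal_mult')
    qed
    also have "\<dots> \<le> (\<integral>\<^sup>+x. \<integral>\<^sup>+\<omega>. ennreal ((cmod (L2_inner f (\<lambda>t. exp (2 * of_real pi * \<i> * of_real (t \<bullet> \<omega>)) * g (t - x))))\<^sup>2) \<partial>lborel \<partial>lborel)"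
      unfolding inner by (intro nn_integral_mono \<kappa>(2) hm h1 h2)
    finally show "ennreal (\<kappa> * (L2_norm f)\<^sup>2 * (LBINT t. (cmod (g t))\<^sup>2))
        \<le> (\<integral>\<^sup>+x. \<integral>\<^sup>+\<omega>. ennreal ((cmod (L2_inner f (\<lambda>t. exp (2 * of_real pi * \<i> * of_real (t \<bullet> \<omega>)) * g (t - x))))\<^sup>2) \<partial>lborel \<partial>lborel)" .
  qed
qed

lemma symmetric_matrix_inner:
  fixes X :: "real ^ 'd ^ 'd"
  assumes "transpose X = X"
  shows "a \<bullet> (X *v b) = b \<bullet> (X *v a)"
  using dot_lmul_matrix[of a X b] transpose_matrix_vector[of X a] assms by (simp add: inner_commute)

lemma positive_definite_lower_bound:
  fixes X :: "real ^ 'd ^ 'd"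
  assumes pos: "\<And>t. t \<noteq> 0 \<Longrightarrow> t \<bullet> (X *v t) > 0"
  obtains \<mu> where "\<mu> > 0" "\<And>t. t \<bullet> (X *v t) \<ge> \<mu> * (norm t)\<^sup>2"
proof -
  have cont: "continuous_on A (\<lambda>t. t \<bullet> (X *v t))" for A
    by (intro continuous_intros linear_continuous_on linear_conv_bounded_linear[THEN iffD1] matrix_vector_mul_linear)
  obtain b :: "real ^ 'd" where "norm b = 1" using vector_choose_size[of 1] by auto
  then have "sphere 0 1 \<noteq> ({} :: (real ^ 'd) set)" by auto
  then obtain u where u: "u \<in> sphere 0 1" "\<And>t. t \<in> sphere 0 1 \<Longrightarrow> u \<bullet> (X *v u) \<le> t \<bullet> (X *v t)"
    using continuous_attains_inf[OF compact_sphere _ cont] by metis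
  show ?thesis
  proof
    show "u \<bullet> (X *v u) > 0" using u(1) by (intro pos) auto
    fix t :: "real ^ 'd"
    show "t \<bullet> (X *v t) \<ge> (u \<bullet> (X *v u)) * (norm t)\<^sup>2"
    proof (cases "t = 0")
      case False
      define s where "s = (1 / norm t) *\<^sub>R t"
      have "t = norm t *\<^sub>R s" using False by (simp add: s_def)
      then have "t \<bullet> (X *v t) = (norm t)\<^sup>2 * (s \<bullet> (X *v s))"
        by (metis inner_scaleR_left inner_scaleR_right matrix_vector_mult_scaleR mult.assoc power2_eq_square)
      moreover have "s \<in> sphere 0 1" using False by (simp add: s_def)
      ultimately show ?thesis using u(2)[of s] by (auto intro: mult_right_mono simp: mult.commute)
    qed simp
  qed
qed

section \<open>Block matrices and symplectic relations\<close>

lemma block_matrix_nth [simp]: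
  "block_matrix P Q R S $ Inl a $ Inl b = P $ a $ b" "block_matrix P Q R S $ Inl a $ Inr b = Q $ a $ b"
  "block_matrix P Q R S $ Inr a $ Inl b = R $ a $ b" "block_matrix P Q R S $ Inr a $ Inr b = S $ a $ b"
  by (simp_all add: block_matrix_def)

lemma sum_UNIV_Plus: "(\<Sum>k\<in>(UNIV :: ('d::finite + 'd) set). f k) = (\<Sum>a\<in>UNIV. f (Inl a)) + (\<Sum>a\<in>UNIV. f (Inr a))"
  by (subst UNIV_Plus_UNIV[symmetric], subst sum.Plus) auto

lemma vec_eq_Plus: "(x :: 'a ^ ('d::finite + 'd)) = y \<longleftrightarrow> (\<forall>a. x $ Inl a = y $ Inl a) \<and> (\<forall>a. x $ Inr a = y $ Inr a)"
proof
  assume R: "(\<forall>a. x $ Inl a = y $ Inl a) \<and> (\<forall>a. x $ Inr a = y $ Inr a)"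
  have "x $ i = y $ i" for i using R by (cases i) auto
  then show "x = y" by (simp add: vec_eq_iff)
qed simp

lemma block_matrix_eq_iff:
  "block_matrix P Q R S = block_matrix P' Q' R' S' \<longleftrightarrow> P = P' \<and> Q = Q' \<and> R = R' \<and> S = S'"
proof
  assume eq: "block_matrix P Q R S = block_matrix P' Q' R' S'"
  have "P $ a $ b = P' $ a $ b" "Q $ a $ b = Q' $ a $ b" "R $ a $ b = R' $ a $ b" "S $ a $ b = S' $ a $ b" for a b
    using arg_cong[OF eq, of "\<lambda>M. M $ Inl a $ Inl b"] arg_cong[OF eq, of "\<lambda>M. M $ Inl a $ Inr b"]
      arg_cong[OF eq, of "\<lambda>M. M $ Inr a $ Inl b"] arg_cong[OF eq, of "\<lambda>M. M $ Inr a $ Inr b"]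
    by (simp_all only: block_matrix_nth)
  then show "P = P' \<and> Q = Q' \<and> R = R' \<and> S = S'" by (simp add: vec_eq_iff)
qed simp

lemma block_matrix_mult:
  fixes P Q R S :: "real ^ 'd ^ 'd::finite"
  shows "block_matrix P Q R S ** block_matrix P' Q' R' S'
    = block_matrix (P ** P' + Q ** R') (P ** Q' + Q ** S') (R ** P' + S ** R') (R ** Q' + S ** S')"
  unfolding vec_eq_Plus by (simp add: matrix_matrix_mult_def sum_UNIV_Plus)

lemma transpose_block_matrix:
  "transpose (block_matrix P Q R S) = block_matrix (transpose P) (transpose R) (transpose Q) (transpose S)"
  unfolding vec_eq_Plus by (simp add: transpose_def)

lemma block_matrix_one: "(mat 1 :: real ^ ('d::finite + 'd) ^ ('d + 'd)) = block_matrix (mat 1) 0 0 (mat 1)"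
  unfolding vec_eq_Plus by (simp add: mat_def)

lemma block_matrix_vector_nth:
  fixes P Q R S :: "real ^ 'd ^ 'd::finite"
  shows "(block_matrix P Q R S *v k) $ Inl a = (P *v (\<chi> i. k $ Inl i) + Q *v (\<chi> i. k $ Inr i)) $ a"
    "(block_matrix P Q R S *v k) $ Inr a = (R *v (\<chi> i. k $ Inl i) + S *v (\<chi> i. k $ Inr i)) $ a"
  by (simp_all add: matrix_vector_mult_def sum_UNIV_Plus)

section \<open>Calculus of diagonal matrices and inverses\<close>

definition diag :: "('d \<Rightarrow> real) \<Rightarrow> real ^ 'd ^ 'd" where
  "diag f = (\<chi> i j. if i = j then f i else 0)"

lemma diag_of_diagonal_matrix: "diagonal_matrix M \<Longrightarrow> M = diag (\<lambda>i. M $ i $ i)"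
  by (simp add: diagonal_matrix_def diag_def vec_eq_iff)

lemma diag_mult: "diag f ** diag g = diag (\<lambda>i. f i * g (i :: 'd::finite))"
proof -
  have "(\<Sum>k\<in>UNIV. (if i = k then f i else 0) * (if k = j then g k else 0)) = (if i = j then f i * g i else 0)" for i j
  proof -
    have "(\<Sum>k\<in>UNIV. (if i = k then f i else 0) * (if k = j then g k else 0)) = (\<Sum>k\<in>UNIV. if k = i then (if i = j then f i * g i else 0) else 0)"
      by (intro sum.cong) auto
    then show ?thesis by simp
  qed
  then show ?thesis by (simp add: diag_def matrix_matrix_mult_def vec_eq_iff)
qed

lemma diag_vec: "diag f *v x = (\<chi> i. f i * x $ (i :: 'd::finite))"
proof -
  have "(\<Sum>k\<in>UNIV. (if i = k then f i else 0) * x $ k) = f i * x $ i" for i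
  proof -
    have "(\<Sum>k\<in>UNIV. (if i = k then f i else 0) * x $ k) = (\<Sum>k\<in>UNIV. if k = i then f i * x $ i else 0)"
      by (intro sum.cong) auto
    then show ?thesis by simp
  qed
  then show ?thesis by (simp add: diag_def matrix_vector_mult_def vec_eq_iff)
qed

lemma diag_one: "diag (\<lambda>i. 1) = mat 1"
  by (simp add: diag_def mat_def)

lemma transpose_diag: "transpose (diag f) = diag f"
  by (simp add: diag_def transpose_def vec_eq_iff)

lemma matrix_inv_inverse:
  assumes "invertible (A :: 'a::semiring_1 ^ 'n ^ 'm)"
  shows "A ** matrix_inv A = mat 1" "matrix_inv A ** A = mat 1"
  using someI_ex[OF assms[unfolded invertible_def]] unfolding matrix_inv_def by blast+

lemma invertible_diag:
  assumes "\<And>i :: 'd::finite. f i \<noteq> 0"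
  shows "invertible (diag f)" "matrix_inv (diag f) = diag (\<lambda>i. 1 / f i)"
proof -
  have m: "diag f ** diag (\<lambda>i. 1 / f i) = mat 1" "diag (\<lambda>i. 1 / f i) ** diag f = mat 1"
    using assms by (simp_all add: diag_mult flip: diag_one)
  then show inv: "invertible (diag f)" unfolding invertible_def by blast
  then have "matrix_inv (diag f) ** diag f = mat 1" by (simp add: matrix_inv_inverse)
  then have "(matrix_inv (diag f) ** diag f) ** diag (\<lambda>i. 1 / f i) = diag (\<lambda>i. 1 / f i)" by simp
  then show "matrix_inv (diag f) = diag (\<lambda>i. 1 / f i)"
    by (simp only: matrix_mul_assoc[symmetric] m matrix_mul_rid)
qed

lemma diag_invertible_nz:
  assumes "invertible (diag (f :: 'd::finite \<Rightarrow> real))"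
  shows "f i \<noteq> 0"
proof
  assume f: "f i = 0"
  have "diag f *v axis i 1 = 0" using f by (simp add: diag_vec vec_eq_iff axis_def)
  moreover obtain B where B: "B ** diag f = mat 1" using assms unfolding invertible_def by blast
  have "axis i (1::real) = (B ** diag f) *v axis i 1" unfolding B by simp
  ultimately have "axis i (1::real) = (0 :: real ^ 'd)"
    by (simp add: matrix_vector_mul_assoc[symmetric])
  then show False by (simp add: axis_eq_0_iff)
qed

lemma matrix_mult_distribs:
  fixes A B C :: "real ^ 'd ^ 'd::finite"
  shows "A ** (B + C) = A ** B + A ** C" "(A + B) ** C = A ** C + B ** C"
    "A ** (B - C) = A ** B - A ** C" "(A - B) ** C = A ** C - B ** C"
    "A ** (- B) = - (A ** B)" "(- A) ** B = - (A ** B)"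
  by (simp_all add: matrix_matrix_mult_def vec_eq_iff sum.distrib sum_subtractf sum_negf
      distrib_left distrib_right left_diff_distrib right_diff_distrib)

lemma transpose_distribs:
  fixes A B :: "real ^ 'd ^ 'd::finite"
  shows "transpose (A + B) = transpose A + transpose B" "transpose (A - B) = transpose A - transpose B"
    "transpose (- A) = - transpose A"
  by (simp_all add: transpose_def vec_eq_iff)

text \<open>The assumptions say that the block matrix of the \<open>Sij\<close> is symplectic. It
  acts on the Siegel upper half space, and \<open>X\<close> and \<open>Y\<close> are the real data
  of the image of the base point: \<open>P = S11 S11^T + S12 S12^T\<close> is the Gram matrix whose
  inverse is \<open>X\<close>. The conclusions are the identities that make the Gaussian integral
  depend on phase space through \<open>X\<close> and one extra vector only.\<close>

lemma symplectic_relations: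
  fixes S11 S12 S21 S22 :: "real ^ 'd ^ 'd::finite"
  assumes M1: "transpose S11 ** S21 = transpose S21 ** S11"
    and M2: "transpose S11 ** S22 - transpose S21 ** S12 = mat 1"
    and M3: "transpose S12 ** S22 = transpose S22 ** S12"
  defines "P \<equiv> S11 ** transpose S11 + S12 ** transpose S12"
  defines "X \<equiv> matrix_inv P"
  defines "Y \<equiv> - ((S21 ** transpose S11 + S22 ** transpose S12) ** X)"
  shows "invertible P" "transpose X = X" "transpose Y = Y" "\<And>t. t \<noteq> 0 \<Longrightarrow> t \<bullet> (X *v t) > 0"
    "S21 + Y ** S11 = - (X ** S12)" "S22 + Y ** S12 = X ** S11"
    "transpose S11 ** X ** S11 + transpose S12 ** X ** S12 = mat 1"
    "transpose S11 ** X ** S12 = transpose S12 ** X ** S11"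
proof -
  note D = matrix_mult_distribs transpose_distribs
  have M2': "transpose S22 ** S11 - transpose S12 ** S21 = mat 1"
    using arg_cong[OF M2, of transpose] by (simp add: D matrix_transpose_mul transpose_mat)
  define B where "B = block_matrix S11 S12 S21 S22"
  \<comment> \<open>The symplectic inverse \<open>- J B^T J\<close>. A left inverse of a square
    matrix is a right inverse, which yields the relations \<open>N1\<close> and \<open>N2\<close>
    between rows from those between columns.\<close>
  define B' where "B' = block_matrix (transpose S22) (- transpose S12) (- transpose S21) (transpose S11)"
  have "B' ** B = mat 1"
    using M1 M2 M2' M3 unfolding B_def B'_def block_matrix_mult block_matrix_one block_matrix_eq_iff by (simp add: D)
  then have "B ** B' = mat 1" by (rule matrix_left_right_inverse[THEN iffD1])
  then have N1: "S11 ** transpose S12 = S12 ** transpose S11" and N2: "S22 ** transpose S11 - S21 ** transpose S12 = mat 1"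
    unfolding B_def B'_def block_matrix_mult block_matrix_one block_matrix_eq_iff by (simp_all add: D)
  have Pv: "v \<bullet> (P *v v) = (norm (transpose S11 *v v))\<^sup>2 + (norm (transpose S12 *v v))\<^sup>2" for v
  proof -
    have "v \<bullet> ((S ** transpose S) *v v) = (norm (transpose S *v v))\<^sup>2" for S :: "real ^ 'd ^ 'd"
      using dot_lmul_matrix[of v S "transpose S *v v"] transpose_matrix_vector[of S v]
      by (simp add: power2_norm_eq_inner matrix_vector_mul_assoc[symmetric])
    then show ?thesis by (simp add: P_def matrix_vector_mult_add_rdistrib inner_add_right)
  qed
  \<comment> \<open>If the quadratic form of \<open>P\<close> vanishes at \<open>v\<close>, both
    \<open>S11^T v\<close> and \<open>S12^T v\<close> vanish, and \<open>N2\<close> recovers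
    \<open>v\<close> from these two vectors.\<close>
  have Ppos: "v \<bullet> (P *v v) > 0" if "v \<noteq> 0" for v
  proof (rule ccontr)
    assume "\<not> v \<bullet> (P *v v) > 0"
    then have "(norm (transpose S11 *v v))\<^sup>2 + (norm (transpose S12 *v v))\<^sup>2 \<le> 0" unfolding Pv by simp
    then have z: "transpose S11 *v v = 0" "transpose S12 *v v = 0"
      by (simp_all add: sum_power2_le_zero_iff)
    have "v = (S22 ** transpose S11 - S21 ** transpose S12) *v v" by (simp add: N2)
    also have "\<dots> = S22 *v (transpose S11 *v v) - S21 *v (transpose S12 *v v)"
      by (simp add: matrix_vector_mult_diff_rdistrib matrix_vector_mul_assoc del: transpose_matrix_vector)
    also have "\<dots> = 0" by (simp add: z del: transpose_matrix_vector)
    finally show False using that by simp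
  qed
  have inj: "inj ((*v) P)"
  proof (rule linear_injective_0[THEN iffD2, OF matrix_vector_mul_linear], intro allI impI)
    fix v assume "P *v v = 0"
    then show "v = 0" using Ppos[of v] by auto
  qed
  then show inv: "invertible P"
    by (simp only: invertible_left_inverse matrix_left_invertible_injective)
  have PX: "P ** X = mat 1" and XP: "X ** P = mat 1" unfolding X_def using inv by (simp_all add: matrix_inv_inverse)
  have Psym: "transpose P = P" by (simp add: P_def D matrix_transpose_mul)
  show Xsym: "transpose X = X"
  proof -
    have "transpose X ** P = mat 1" using arg_cong[OF PX, of transpose] by (simp add: matrix_transpose_mul Psym transpose_mat)
    then have "(transpose X ** P) ** X = X" by simp
    then show ?thesis by (simp only: matrix_mul_assoc[symmetric] PX matrix_mul_rid)
  qed
  show "t \<bullet> (X *v t) > 0" if "t \<noteq> 0" for t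
  proof -
    have t: "t = P *v (X *v t)" by (simp add: matrix_vector_mul_assoc PX)
    then have "X *v t \<noteq> 0" using that by auto
    then have "(X *v t) \<bullet> (P *v (X *v t)) > 0" by (rule Ppos)
    then show ?thesis using t by (simp add: inner_commute)
  qed
  \<comment> \<open>Real forms of the complex matrices \<open>(S11 + i S12)^T\<close> and
    \<open>X (S11 - i S12)\<close>. By \<open>N1\<close> the product of the second with the first is
    \<open>X P = 1\<close>; exchanging the factors gives the identities \<open>I\<close> and
    \<open>I2\<close>.\<close>
  define M where "M = block_matrix (transpose S11) (- transpose S12) (transpose S12) (transpose S11)"
  define M' where "M' = block_matrix (X ** S11) (X ** S12) (- (X ** S12)) (X ** S11)"
  have "M' ** M = mat 1"
    unfolding M_def M'_def block_matrix_mult block_matrix_one block_matrix_eq_iff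
    using XP N1 by (simp add: D P_def matrix_mul_assoc[symmetric] add.commute)
  then have "M ** M' = mat 1" by (rule matrix_left_right_inverse[THEN iffD1])
  note eqs = this[unfolded M_def M'_def block_matrix_mult block_matrix_one block_matrix_eq_iff]
  have I: "transpose S11 ** (X ** S11) + transpose S12 ** (X ** S12) = mat 1"
    using conjunct1[OF eqs] by (simp add: D)
  have I2: "transpose S11 ** (X ** S12) - transpose S12 ** (X ** S11) = 0"
    using conjunct1[OF conjunct2[OF eqs]] by (simp add: D)
  have I2': "transpose S11 ** (X ** S12) = transpose S12 ** (X ** S11)" using I2 by simp
  show "transpose S11 ** X ** S11 + transpose S12 ** X ** S12 = mat 1" using I by (simp add: matrix_mul_assoc)
  show "transpose S11 ** X ** S12 = transpose S12 ** X ** S11" using I2' by (simp add: matrix_mul_assoc)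
  \<comment> \<open>The pair satisfies two linear equations, \<open>W1\<close> and \<open>W2\<close>
    below. Multiplying by the resolution of the identity \<open>I\<close> and inserting these
    equations solves them.\<close>
  define W1 W2 where "W1 = S21 + Y ** S11" and "W2 = S22 + Y ** S12"
  have YP: "Y ** P = - (S21 ** transpose S11 + S22 ** transpose S12)"
    unfolding Y_def by (simp add: D matrix_mul_assoc[symmetric] XP)
  have "W1 ** transpose S11 + W2 ** transpose S12 = (S21 ** transpose S11 + S22 ** transpose S12) + Y ** P"
    unfolding W1_def W2_def P_def by (simp add: D matrix_mul_assoc[symmetric] add_ac)
  then have W1: "W1 ** transpose S11 + W2 ** transpose S12 = 0" by (simp add: YP)
  have W2: "W2 ** transpose S11 - W1 ** transpose S12 = mat 1"
  proof -
    have "W2 ** transpose S11 - W1 ** transpose S12 = (S22 ** transpose S11 - S21 ** transpose S12) + Y ** (S12 ** transpose S11 - S11 ** transpose S12)"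
      unfolding W1_def W2_def by (simp add: D matrix_mul_assoc[symmetric])
    then show ?thesis by (simp add: N1 N2)
  qed
  have a1: "W1 ** transpose S11 = - (W2 ** transpose S12)" using W1 by (simp add: eq_neg_iff_add_eq_0)
  have a2: "W1 ** transpose S12 = W2 ** transpose S11 - mat 1" using W2 by (simp add: algebra_simps)
  have "W1 = W1 ** (transpose S11 ** (X ** S11) + transpose S12 ** (X ** S12))" by (simp add: I)
  also have "\<dots> = (W1 ** transpose S11) ** (X ** S11) + (W1 ** transpose S12) ** (X ** S12)"
    by (simp add: D matrix_mul_assoc)
  also have "\<dots> = W2 ** (transpose S11 ** (X ** S12) - transpose S12 ** (X ** S11)) - X ** S12"
    unfolding a1 a2 by (simp add: D matrix_mul_assoc[symmetric])
  finally show R1: "S21 + Y ** S11 = - (X ** S12)" by (simp add: I2 W1_def)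
  have a3: "W2 ** transpose S12 = - (W1 ** transpose S11)" using a1 by simp
  have a4: "W2 ** transpose S11 = mat 1 + W1 ** transpose S12" using W2 by (simp add: algebra_simps)
  have "W2 = W2 ** (transpose S11 ** (X ** S11) + transpose S12 ** (X ** S12))" by (simp add: I)
  also have "\<dots> = (W2 ** transpose S11) ** (X ** S11) + (W2 ** transpose S12) ** (X ** S12)"
    by (simp add: D matrix_mul_assoc)
  also have "\<dots> = X ** S11 - W1 ** (transpose S11 ** (X ** S12) - transpose S12 ** (X ** S11))"
    unfolding a3 a4 by (simp add: D matrix_mul_assoc[symmetric])
  finally show R2: "S22 + Y ** S12 = X ** S11" by (simp add: I2 W2_def)
  \<comment> \<open>The antisymmetric defect of \<open>Y\<close>. The three symplectic relations
    make every block obtained by sandwiching \<open>Z\<close> between the \<open>S1j\<close> vanish,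
    so \<open>P Z P = 0\<close> with \<open>P\<close> invertible.\<close>
  define Z where "Z = Y - transpose Y"
  have S21: "S21 = - (X ** S12) - Y ** S11" and S22: "S22 = X ** S11 - Y ** S12"
    using R1 R2 by (simp_all add: eq_diff_eq)
  have z1: "transpose S11 ** Z ** S11 = 0"
  proof -
    have "transpose S11 ** (- (X ** S12) - Y ** S11) = (- (transpose S12 ** X) - transpose S11 ** transpose Y) ** S11"
      using M1 unfolding S21 by (simp add: D matrix_transpose_mul Xsym)
    then show ?thesis using I2' by (simp add: Z_def D matrix_mul_assoc[symmetric])
  qed
  have z2: "transpose S12 ** Z ** S12 = 0"
  proof -
    have "transpose S12 ** (X ** S11 - Y ** S12) = (transpose S11 ** X - transpose S12 ** transpose Y) ** S12"
      using M3 unfolding S22 by (simp add: D matrix_transpose_mul Xsym)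
    then show ?thesis using I2' by (simp add: Z_def D matrix_mul_assoc[symmetric])
  qed
  have z3: "transpose S11 ** Z ** S12 = 0"
  proof -
    have "transpose S11 ** (X ** S11 - Y ** S12) - (- (transpose S12 ** X) - transpose S11 ** transpose Y) ** S12
        = transpose S11 ** (X ** S11) + transpose S12 ** (X ** S12)"
      using M2 unfolding S21 S22 I by (simp add: D matrix_transpose_mul Xsym)
    then show ?thesis by (simp add: Z_def D matrix_mul_assoc[symmetric])
  qed
  have z4: "transpose S12 ** Z ** S11 = 0"
  proof -
    have "transpose (transpose S11 ** Z ** S12) = - (transpose S12 ** Z ** S11)"
      by (simp add: D matrix_transpose_mul Z_def matrix_mul_assoc)
    then show ?thesis unfolding z3 by (simp add: transpose_def vec_eq_iff)
  qed
  have "P ** Z ** P = S11 ** (transpose S11 ** Z ** S11) ** transpose S11 + S11 ** (transpose S11 ** Z ** S12) ** transpose S12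
      + S12 ** (transpose S12 ** Z ** S11) ** transpose S11 + S12 ** (transpose S12 ** Z ** S12) ** transpose S12"
    unfolding P_def by (simp add: D matrix_mul_assoc)
  also have "\<dots> = 0" unfolding z1 z2 z3 z4 by simp
  finally have "X ** (P ** Z ** P) ** X = 0" by simp
  then have "(X ** P) ** Z ** (P ** X) = 0" by (simp add: matrix_mul_assoc)
  then have "Z = 0" by (simp add: XP PX)
  then show "transpose Y = Y" by (simp add: Z_def)
qed

section \<open>Gram kernel of Gaussian coherent states\<close>

text \<open>The minus sign is chosen so that the sum of \<open>u_i(k) cnj (u_i(k'))\<close> is the
  exponent produced by the Gaussian integral: the Gram matrix is then holomorphic in the point of
  the second state, up to \<open>\<theta>\<close>.\<close>

definition phase_coord :: "('d \<Rightarrow> real) \<Rightarrow> ('d \<Rightarrow> real) \<Rightarrow> real ^ ('d::finite + 'd) \<Rightarrow> 'd \<Rightarrow> complex" where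
  "phase_coord al be k i = Complex (al i * k $ Inl i) (- (be i * k $ Inr i))"

text \<open>The vector \<open>y k\<close>, defined by \<open>w k + Y x k = X y k\<close>, absorbs
  the chirp: once frequencies are expressed by \<open>y\<close>, the matrix \<open>Y\<close>
  survives only in factors depending on one index. These and all other one-index factors are
  collected in \<open>\<theta>\<close>, leaving a sesquilinear exponent in
  \<open>(x, y)\<close>.\<close>

lemma gaussian_kernel:
  fixes X Y :: "real ^ 'd ^ 'd::finite" and x w y :: "'k \<Rightarrow> real ^ 'd" and C :: complex
  assumes X: "transpose X = X" "\<forall>t. t \<noteq> 0 \<longrightarrow> t \<bullet> (X *v t) > 0" and Y: "transpose Y = Y"
    and rel: "\<And>k. w k + Y *v x k = X *v y k"
  defines "G \<equiv> \<lambda>k t. exp (2 * complex_of_real pi * \<i> * of_real (t \<bullet> w k)) * gen_gaussian C X Y (t - x k)"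
  defines "c0 \<equiv> LBINT t. exp (- (2 * pi * (t \<bullet> (X *v t))))"
  defines "\<theta> \<equiv> \<lambda>k. exp (Complex (- pi / 2 * (x k \<bullet> (X *v x k) + y k \<bullet> (X *v y k))) (- pi * (x k \<bullet> (X *v y k) - x k \<bullet> (Y *v x k))))"
  shows "c0 > 0" "gen_gaussian C X Y \<in> borel_measurable borel" "integrable lborel (\<lambda>t. (cmod (gen_gaussian C X Y t))\<^sup>2)"
    "\<And>t. cmod (gen_gaussian C X Y t) \<le> cmod C" "(LBINT t. (cmod (gen_gaussian C X Y t))\<^sup>2) = (cmod C)\<^sup>2 * c0"
    "\<And>k. G k \<in> L2"
    "\<And>k k'. L2_inner (G k') (G k) = of_real ((cmod C)\<^sup>2 * c0) * \<theta> k * cnj (\<theta> k') *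
       exp (of_real pi * Complex (x k \<bullet> (X *v x k') + y k \<bullet> (X *v y k')) (x k \<bullet> (X *v y k') - y k \<bullet> (X *v x k')))"
proof -
  define g where "g = gen_gaussian C X Y"
  define b where "b = (\<lambda>s t :: real ^ 'd. 2 * pi * (s \<bullet> (X *v t)))"
  obtain \<mu> where \<mu>: "\<mu> > 0" "\<And>t. t \<bullet> (X *v t) \<ge> \<mu> * (norm t)\<^sup>2"
    using positive_definite_lower_bound[OF X(2)[rule_format]] by blast
  have bl: "bilinear b" unfolding b_def bilinear_def linear_iff
    by (simp add: inner_add_left inner_add_right distrib_left matrix_vector_right_distrib matrix_vector_mult_scaleR)
  have bs: "b s t = b t s" for s t using symmetric_matrix_inner[OF X(1)] by (simp add: b_def)
  have bpos: "b t t \<ge> (2 * pi * \<mu>) * (norm t)\<^sup>2" for t using \<mu>(2)[of t] by (simp add: b_def mult_left_mono)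
  have mu2: "2 * pi * \<mu> > 0" using \<mu> by simp
  note gb = gaussian_bilinear_integral[OF bl bs mu2 bpos]
  have c0: "c0 = (LBINT t. exp (- b t t))" by (simp add: c0_def b_def)
  show "c0 > 0" using gb(2) by (simp add: c0)
  have gform: "g t = C * exp (Complex (- pi * (t \<bullet> (X *v t))) (- pi * (t \<bullet> (Y *v t))))" for t
    unfolding g_def gen_gaussian_def by (intro arg_cong2[where f = "(*)"] refl arg_cong[where f = exp]) (simp add: complex_eq_iff)
  have cX: "continuous_on UNIV (\<lambda>t. t \<bullet> (M *v t))" for M :: "real ^ 'd ^ 'd"
    by (intro continuous_intros linear_continuous_on linear_conv_bounded_linear[THEN iffD1] matrix_vector_mul_linear)
  have cg: "continuous_on UNIV g"
    unfolding g_def gen_gaussian_def by (intro continuous_intros continuous_on_of_real cX)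
  show gm: "gen_gaussian C X Y \<in> borel_measurable borel"
    using borel_measurable_continuous_onI[OF cg] by (simp add: g_def)
  then have gm'[measurable]: "g \<in> borel_measurable borel" by (simp add: g_def)
  have gnorm: "cmod (g t) = cmod C * exp (- pi * (t \<bullet> (X *v t)))" for t
    by (simp add: gform norm_mult norm_exp_eq_Re)
  have gnorm2: "(cmod (g t))\<^sup>2 = (cmod C)\<^sup>2 * exp (- b t t)" for t
    by (simp add: gnorm power_mult_distrib b_def flip: exp_of_nat_mult)
  have gint: "integrable lborel (\<lambda>t. exp (- b t t))" using gb(1)[of 0 0] by simp
  show gi: "integrable lborel (\<lambda>t. (cmod (gen_gaussian C X Y t))\<^sup>2)"
    unfolding g_def[symmetric] gnorm2 using gint by simp
  show "(LBINT t. (cmod (gen_gaussian C X Y t))\<^sup>2) = (cmod C)\<^sup>2 * c0"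
    unfolding g_def[symmetric] gnorm2 c0 by simp
  show "cmod (gen_gaussian C X Y t) \<le> cmod C" for t
  proof -
    have "0 \<le> t \<bullet> (X *v t)" using order_trans[OF _ \<mu>(2)[of t]] \<mu>(1) by simp
    then show ?thesis unfolding g_def[symmetric] gnorm by (simp add: mult_left_le)
  qed
  have Gm[measurable]: "G k \<in> borel_measurable borel" for k
    unfolding G_def g_def[symmetric] by measurable
  show GL2: "G k \<in> L2" for k
  proof (rule L2_of_borel[OF Gm])
    have "integrable lborel (\<lambda>t. (cmod (g (- x k + t)))\<^sup>2)"
      using lborel_integral_translate(1)[of "\<lambda>t. (cmod (g t))\<^sup>2" "- x k"] gi by (simp add: g_def)
    moreover have "(cmod (G k t))\<^sup>2 = (cmod (g (- x k + t)))\<^sup>2" for t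
      by (simp add: G_def g_def norm_mult norm_exp_eq_Re)
    ultimately show "integrable lborel (\<lambda>t. (cmod (G k t))\<^sup>2)" by simp
  qed
  \<comment> \<open>Translation by \<open>a / 2\<close> completes the square in the real linear
    term. The imaginary one is the complex Gaussian identity at the parameter
    \<open>- i\<close>.\<close>
  have complex_gauss: "(CLBINT t. exp (Complex (- b t t + b t a) (- b t e))) = of_real c0 * exp (Complex ((b a a - b e e) / 4) (- b a e / 2))" for a e
  proof -
    define F where "F = (\<lambda>t. exp (Complex (- b t t + b t a) (- b t e)))"
    have cont: "continuous_on UNIV (\<lambda>t. b t a)" for a
      unfolding b_def by (intro continuous_intros)
    have cb: "continuous_on UNIV (\<lambda>t. b t t)" unfolding b_def by (intro continuous_intros cX)
    have "continuous_on UNIV F"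
      unfolding F_def Complex_eq by (intro continuous_intros continuous_on_of_real cb cont)
    then have Fm: "F \<in> borel_measurable borel" by (rule borel_measurable_continuous_onI)
    have sh: "F ((1 / 2) *\<^sub>R a + t) = exp (Complex (b a a / 4) (- b a e / 2)) * (of_real (exp (- b t t)) * exp (- \<i> * of_real (b t e)))" for t
    proof -
      have "Complex (- b ((1 / 2) *\<^sub>R a + t) ((1 / 2) *\<^sub>R a + t) + b ((1 / 2) *\<^sub>R a + t) a) (- b ((1 / 2) *\<^sub>R a + t) e)
          = Complex (b a a / 4) (- b a e / 2) + (of_real (- b t t) + - \<i> * of_real (b t e))"
        using bs[of a t] by (simp add: complex_eq_iff bilinear_ladd[OF bl] bilinear_radd[OF bl] bilinear_lmul[OF bl] bilinear_rmul[OF bl] field_simps)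
      then show ?thesis unfolding F_def by (simp only: exp_add exp_of_real)
    qed
    have "(CLBINT t. F t) = (CLBINT t. F ((1 / 2) *\<^sub>R a + t))"
      by (rule lborel_integral_translate(2)[OF Fm, symmetric])
    also have "\<dots> = exp (Complex (b a a / 4) (- b a e / 2)) * (CLBINT t. of_real (exp (- b t t)) * exp (- \<i> * of_real (b t e)))"
      unfolding sh by (rule integral_mult_right_zero)
    also have "\<dots> = exp (Complex (b a a / 4) (- b a e / 2)) * (of_real c0 * exp (of_real (b e e / 4) * (- \<i>)\<^sup>2))"
      unfolding gb(3) c0 by simp
    also have "\<dots> = of_real c0 * exp (Complex (b a a / 4) (- b a e / 2) + of_real (b e e / 4) * (- \<i>)\<^sup>2)"
      by (simp only: exp_add mult_ac)
    also have "Complex (b a a / 4) (- b a e / 2) + of_real (b e e / 4) * (- \<i>)\<^sup>2 = Complex ((b a a - b e e) / 4) (- b a e / 2)"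
      by (simp add: complex_eq_iff power2_eq_square diff_divide_distrib)
    finally show ?thesis by (simp add: F_def)
  qed
  show "L2_inner (G k') (G k) = of_real ((cmod C)\<^sup>2 * c0) * \<theta> k * cnj (\<theta> k') *
       exp (of_real pi * Complex (x k \<bullet> (X *v x k') + y k \<bullet> (X *v y k')) (x k \<bullet> (X *v y k') - y k \<bullet> (X *v x k')))" for k k'
  proof -
    define R0 where "R0 = - pi * (x k \<bullet> (X *v x k) + x k' \<bullet> (X *v x k'))"
    define I0 where "I0 = pi * (x k \<bullet> (Y *v x k) - x k' \<bullet> (Y *v x k'))"
    note exps = matrix_vector_right_distrib matrix_vector_mult_diff_distrib inner_add_left inner_add_right inner_diff_left inner_diff_right
    have sX: "s \<bullet> (X *v t) = t \<bullet> (X *v s)" and sY: "s \<bullet> (Y *v t) = t \<bullet> (Y *v s)" for s t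
      using symmetric_matrix_inner[OF X(1)] symmetric_matrix_inner[OF Y] by auto
    have Gform: "G k t = C * exp (Complex (- pi * ((t - x k) \<bullet> (X *v (t - x k)))) (2 * pi * (t \<bullet> w k) - pi * ((t - x k) \<bullet> (Y *v (t - x k)))))" for k t
    proof -
      have "exp (2 * complex_of_real pi * \<i> * of_real (t \<bullet> w k)) * exp (Complex a b) = exp (Complex a (2 * pi * (t \<bullet> w k) + b))" for a b
        unfolding exp_add[symmetric] by (rule arg_cong[where f = exp]) (simp add: complex_eq_iff)
      then show ?thesis unfolding G_def g_def[symmetric] gform by (simp only: mult.left_commute[of _ C]) simp
    qed
    have prod: "G k' t * cnj (G k t) = (of_real ((cmod C)\<^sup>2) * exp (Complex R0 I0)) * exp (Complex (- b t t + b t (x k + x k')) (- b t (y k - y k')))" for t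
    proof -
      have cn: "cnj (exp (Complex p q)) = exp (Complex p (- q))" for p q
        by (simp only: exp_cnj complex_cnj)
      have w: "w k = X *v y k - Y *v x k" for k using rel[of k] by (simp add: eq_diff_eq)
      have e1: "Complex p q + Complex p' q' = Complex (p + p') (q + q')" for p q p' q' by (simp add: complex_eq_iff)
      have "G k' t * cnj (G k t) = (C * cnj C) *
        exp (Complex (- pi * ((t - x k') \<bullet> (X *v (t - x k')))) (2 * pi * (t \<bullet> w k') - pi * ((t - x k') \<bullet> (Y *v (t - x k'))))
           + Complex (- pi * ((t - x k) \<bullet> (X *v (t - x k)))) (- (2 * pi * (t \<bullet> w k) - pi * ((t - x k) \<bullet> (Y *v (t - x k))))))"
        unfolding Gform exp_add complex_cnj_mult cn by (simp only: mult_ac)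
      also have "Complex (- pi * ((t - x k') \<bullet> (X *v (t - x k')))) (2 * pi * (t \<bullet> w k') - pi * ((t - x k') \<bullet> (Y *v (t - x k'))))
           + Complex (- pi * ((t - x k) \<bullet> (X *v (t - x k)))) (- (2 * pi * (t \<bullet> w k) - pi * ((t - x k) \<bullet> (Y *v (t - x k)))))
        = Complex R0 I0 + Complex (- b t t + b t (x k + x k')) (- b t (y k - y k'))"
        unfolding e1 w R0_def I0_def b_def
        using sX[of "x k" t] sX[of "x k'" t] sY[of "x k" t] sY[of "x k'" t]
        by (simp add: exps algebra_simps)
      finally show ?thesis by (simp only: exp_add complex_norm_square[symmetric] mult.assoc)
    qed
    have "L2_inner (G k') (G k) = (CLBINT t. G k' t * cnj (G k t))"
      by (rule L2_inner_borel[OF GL2 Gm _ Gm]) simp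
    also have "\<dots> = (of_real ((cmod C)\<^sup>2) * exp (Complex R0 I0)) * (of_real c0 * exp (Complex ((b (x k + x k') (x k + x k') - b (y k - y k') (y k - y k')) / 4) (- b (x k + x k') (y k - y k') / 2)))"
      unfolding prod complex_gauss[symmetric] by (rule integral_mult_right_zero)
    also have "\<dots> = of_real ((cmod C)\<^sup>2 * c0) * exp (Complex R0 I0 + Complex ((b (x k + x k') (x k + x k') - b (y k - y k') (y k - y k')) / 4) (- b (x k + x k') (y k - y k') / 2))"
      by (simp only: exp_add of_real_mult mult_ac)
    also have "Complex R0 I0 + Complex ((b (x k + x k') (x k + x k') - b (y k - y k') (y k - y k')) / 4) (- b (x k + x k') (y k - y k') / 2)
       = Complex (- pi / 2 * (x k \<bullet> (X *v x k) + y k \<bullet> (X *v y k))) (- pi * (x k \<bullet> (X *v y k) - x k \<bullet> (Y *v x k)))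
        + cnj (Complex (- pi / 2 * (x k' \<bullet> (X *v x k') + y k' \<bullet> (X *v y k'))) (- pi * (x k' \<bullet> (X *v y k') - x k' \<bullet> (Y *v x k'))))
        + of_real pi * Complex (x k \<bullet> (X *v x k') + y k \<bullet> (X *v y k')) (x k \<bullet> (X *v y k') - y k \<bullet> (X *v x k'))"
      unfolding R0_def I0_def b_def
      using sX[of "x k" "x k'"] sX[of "y k" "y k'"] sX[of "y k" "x k'"]
      by (simp add: complex_eq_iff exps field_simps)
    finally show ?thesis by (simp only: \<theta>_def exp_add exp_cnj mult.assoc)
  qed
qed

text \<open>Half of the exponent pays for replacing \<open>\<zeta>\<close> by a nearby lattice
  point, whose translation permutes the lattice. Hence the bound is uniform in
  \<open>\<zeta>\<close>.\<close>

lemma rect_lattice_shifted_gauss_bound: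
  fixes a b c :: real
  assumes ab: "a > 0" "b > 0" "c > 0"
  obtains M where "M > 0" "\<And>\<zeta> F. finite F \<Longrightarrow> F \<subseteq> rect_lattice a b \<Longrightarrow> (\<Sum>l\<in>F. exp (- c * (cmod (\<zeta> - l))\<^sup>2)) \<le> M"
proof -
  define M0 where "M0 = (exp 1 * (2 + 1 / sqrt (c / 2 * a\<^sup>2))) * (exp 1 * (2 + 1 / sqrt (c / 2 * b\<^sup>2)))"
  define M where "M = exp (c * (a / 2 + b / 2)\<^sup>2) * M0"
  have "M0 > 0" unfolding M0_def using ab by (intro mult_pos_pos add_pos_nonneg) auto
  show ?thesis
  proof
    show "M > 0" using \<open>M0 > 0\<close> by (simp add: M_def)
    fix \<zeta> F assume F: "finite F" "F \<subseteq> rect_lattice a b"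
    obtain l0 where l0: "l0 \<in> rect_lattice a b" "\<bar>Re (\<zeta> - l0)\<bar> \<le> a / 2" "\<bar>Im (\<zeta> - l0)\<bar> \<le> b / 2"
      using rect_lattice_cell[OF ab(1,2)] by blast
    have v: "(cmod (\<zeta> - l0))\<^sup>2 \<le> (a / 2 + b / 2)\<^sup>2"
      using cmod_le[of "\<zeta> - l0"] l0 by (intro power_mono) auto
    have le: "exp (- c * (cmod (\<zeta> - l))\<^sup>2) \<le> exp (c * (a / 2 + b / 2)\<^sup>2) * exp (- (c / 2) * (cmod (l - l0))\<^sup>2)" for l
    proof -
      have "(cmod (l - l0))\<^sup>2 \<le> 2 * (cmod (\<zeta> - l0))\<^sup>2 + 2 * (cmod (\<zeta> - l))\<^sup>2"
        using sum_square_norm_bound[of "\<zeta> - l0" "- (\<zeta> - l)"] unfolding norm_minus_cancel by simp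
      then have "c / 2 * (cmod (l - l0))\<^sup>2 \<le> c / 2 * (2 * (a / 2 + b / 2)\<^sup>2 + 2 * (cmod (\<zeta> - l))\<^sup>2)"
        using v ab(3) by (intro mult_left_mono) auto
      then have "- c * (cmod (\<zeta> - l))\<^sup>2 \<le> c * (a / 2 + b / 2)\<^sup>2 + - (c / 2) * (cmod (l - l0))\<^sup>2"
        by (simp add: distrib_left)
      then show ?thesis by (simp only: exp_le_cancel_iff flip: exp_add)
    qed
    define F' where "F' = (\<lambda>l. l - l0) ` F"
    have F': "finite F'" "F' \<subseteq> rect_lattice a b"
      using F rect_lattice_add[OF _ rect_lattice_uminus[OF l0(1)]] by (auto simp: F'_def)
    have "(\<Sum>l\<in>F. exp (- c * (cmod (\<zeta> - l))\<^sup>2)) \<le> (\<Sum>l\<in>F. exp (c * (a / 2 + b / 2)\<^sup>2) * exp (- (c / 2) * (cmod (l - l0))\<^sup>2))"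
      by (intro sum_mono le)
    also have "\<dots> = exp (c * (a / 2 + b / 2)\<^sup>2) * (\<Sum>l\<in>F'. exp (- (c / 2) * (cmod l)\<^sup>2))"
      unfolding F'_def by (subst sum.reindex) (auto simp: inj_on_def sum_distrib_left)
    also have "\<dots> \<le> M"
      unfolding M_def M0_def using ab by (intro mult_left_mono rect_lattice_gauss_sum_bound F') auto
    finally show "(\<Sum>l\<in>F. exp (- c * (cmod (\<zeta> - l))\<^sup>2)) \<le> M" .
  qed
qed

text \<open>\<open>G k\<close> is the coherent state at the point with complex coordinates \<open>phase_coord al be k i\<close>; the index \<open>k\<close> is not
  restricted to integer vectors, so that shifted lattices and arbitrary points of phase space are covered.\<close>

locale coherent_system =
  fixes al be :: "'d::finite \<Rightarrow> real" and G :: "real ^ ('d + 'd) \<Rightarrow> real ^ 'd \<Rightarrow> complex"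
    and \<theta> :: "real ^ ('d + 'd) \<Rightarrow> complex" and c :: real
  assumes nz: "al i \<noteq> 0" "be i \<noteq> 0" and c: "c > 0"
    and G_L2: "G k \<in> L2"
    and kernel: "L2_inner (G k') (G k) = of_real c * \<theta> k * cnj (\<theta> k') * exp (of_real pi * (\<Sum>i\<in>UNIV. phase_coord al be k i * cnj (phase_coord al be k' i)))"
    and \<theta>_norm: "cmod (\<theta> k) = exp (- pi / 2 * (\<Sum>i\<in>UNIV. (cmod (phase_coord al be k i))\<^sup>2))"
begin

abbreviation "u \<equiv> phase_coord al be"
abbreviation "Lam i \<equiv> rect_lattice \<bar>al i\<bar> \<bar>be i\<bar>"

definition dist2 :: "real ^ ('d + 'd) \<Rightarrow> real ^ ('d + 'd) \<Rightarrow> real" where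
  "dist2 k k' = (\<Sum>i\<in>UNIV. (cmod (u k i - u k' i))\<^sup>2)"

lemma pos: "\<bar>al i\<bar> > 0" "\<bar>be i\<bar> > 0" using nz by auto

lemma u_add: "u (k + k') i = u k i + u k' i"
  by (simp add: phase_coord_def complex_eq_iff algebra_simps)

lemma dist2_add: "dist2 (k + t) (k' + t) = dist2 k k'"
  by (simp add: dist2_def u_add)

lemma dist2_commute: "dist2 k k' = dist2 k' k"
  by (simp add: dist2_def norm_minus_commute)

lemma dist2_nonneg: "dist2 k k' \<ge> 0"
  by (simp add: dist2_def sum_nonneg)

lemma u_lattice: "k \<in> int_vectors \<Longrightarrow> u k i \<in> Lam i"
proof -
  assume "k \<in> int_vectors"
  then obtain m n where mn: "k $ Inl i = of_int m" "k $ Inr i = of_int n"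
    unfolding int_vectors_def Ints_def by blast
  define m' where "m' = (if al i > 0 then m else - m)"
  define n' where "n' = (if be i > 0 then - n else n)"
  have "u k i = Complex (\<bar>al i\<bar> * of_int m') (\<bar>be i\<bar> * of_int n')"
    by (simp add: phase_coord_def mn m'_def n'_def)
  then show ?thesis by (simp only: rect_latticeI)
qed

text \<open>Turns sums over integer vectors into sums over a product of planar lattices, where
  products over coordinates factor. Signs of \<open>al\<close> and \<open>be\<close> are irrelevant
  since the integers are symmetric.\<close>

lemma lattice_bij: "bij_betw (\<lambda>k i. u k i) int_vectors (PiE UNIV Lam)"
proof (rule bij_betwI')
  fix k k' :: "real ^ ('d + 'd)"
  show "((\<lambda>i. u k i) = (\<lambda>i. u k' i)) = (k = k')"
    unfolding vec_eq_Plus fun_eq_iff phase_coord_def using nz by (auto simp: complex_eq_iff)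
next
  fix k :: "real ^ ('d + 'd)" assume "k \<in> int_vectors"
  then show "(\<lambda>i. u k i) \<in> PiE UNIV Lam" using u_lattice by auto
next
  fix l assume l: "l \<in> PiE UNIV Lam"
  define k where "k = (\<chi> j. case j of Inl i \<Rightarrow> Re (l i) / al i | Inr i \<Rightarrow> - Im (l i) / be i)"
  have ratio: "\<bar>a\<bar> * of_int m / a \<in> \<int>" if "a \<noteq> 0" for a :: real and m :: int
    using that by (cases "a > 0") auto
  have "k $ j \<in> \<int>" for j
  proof (cases j)
    case (Inl i)
    have "l i \<in> Lam i" using l by auto
    then obtain m n where "l i = Complex (\<bar>al i\<bar> * of_int m) (\<bar>be i\<bar> * of_int n)"
      unfolding rect_lattice_def by blast
    then show ?thesis using ratio[OF nz(1)] by (simp add: k_def Inl)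
  next
    case (Inr i)
    have "l i \<in> Lam i" using l by auto
    then obtain m n where "l i = Complex (\<bar>al i\<bar> * of_int m) (\<bar>be i\<bar> * of_int n)"
      unfolding rect_lattice_def by blast
    then show ?thesis using ratio[OF nz(2)] by (simp add: k_def Inr)
  qed
  then have "k \<in> int_vectors" by (simp add: int_vectors_def)
  moreover have "l = (\<lambda>i. u k i)"
    using nz by (simp add: fun_eq_iff phase_coord_def k_def complex_eq_iff)
  ultimately show "\<exists>k\<in>int_vectors. l = (\<lambda>i. u k i)" by blast
qed

text \<open>A finite set of integer vectors is enlarged to the product of its coordinate
  projections; on a product set the sum of products is the product of the sums.\<close>

lemma sum_prod_bound:
  fixes f :: "'d \<Rightarrow> complex \<Rightarrow> real"
  assumes f: "\<And>i l. f i l \<ge> 0" and M: "\<And>i F. finite F \<Longrightarrow> F \<subseteq> Lam i \<Longrightarrow> (\<Sum>l\<in>F. f i l) \<le> M i"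
    and F: "finite F" "F \<subseteq> int_vectors"
  shows "(\<Sum>k\<in>F. \<Prod>i\<in>UNIV. f i (u k i)) \<le> (\<Prod>i\<in>UNIV. M i)"
proof -
  define B where "B i = (\<lambda>k. u k i) ` F" for i
  have B: "finite (B i)" "B i \<subseteq> Lam i" for i using F u_lattice by (auto simp: B_def)
  have inj: "inj_on (\<lambda>k i. u k i) F"
    using lattice_bij F(2) by (meson bij_betw_imp_inj_on inj_on_subset)
  have "(\<Sum>k\<in>F. \<Prod>i\<in>UNIV. f i (u k i)) = (\<Sum>l\<in>(\<lambda>k i. u k i) ` F. \<Prod>i\<in>UNIV. f i (l i))"
    by (subst sum.reindex[OF inj]) simp
  also have "\<dots> \<le> (\<Sum>l\<in>PiE UNIV B. \<Prod>i\<in>UNIV. f i (l i))"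
    using B f by (intro sum_mono2 finite_PiE prod_nonneg) (auto simp: B_def)
  also have "\<dots> = (\<Prod>i\<in>UNIV. \<Sum>l\<in>B i. f i l)"
    using B by (subst prod_sum_PiE) auto
  also have "\<dots> \<le> (\<Prod>i\<in>UNIV. M i)"
    using B M f by (intro prod_mono) (auto intro: sum_nonneg)
  finally show ?thesis .
qed

lemma has_sum_prod:
  fixes f :: "'d \<Rightarrow> complex \<Rightarrow> complex"
  assumes "\<And>i. (f i has_sum s i) (Lam i)"
  shows "((\<lambda>k. \<Prod>i\<in>UNIV. f i (u k i)) has_sum (\<Prod>i\<in>UNIV. s i)) int_vectors"
proof -
  have abs: "(\<lambda>l. norm (f i l)) summable_on Lam i" for i
    using assms[of i] summable_on_iff_abs_summable_on_complex has_sum_imp_summable by blast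
  define M where "M i = infsum (\<lambda>l. norm (f i l)) (Lam i)" for i
  have M: "(\<Sum>l\<in>F. norm (f i l)) \<le> M i" if "finite F" "F \<subseteq> Lam i" for i F
    unfolding M_def using that by (intro finite_sum_le_infsum abs) auto
  have "(\<lambda>k. norm (\<Prod>i\<in>UNIV. f i (u k i))) summable_on int_vectors"
  proof (rule nonneg_bdd_above_summable_on)
    show "bdd_above (sum (\<lambda>k. norm (\<Prod>i\<in>UNIV. f i (u k i))) ` {F. F \<subseteq> int_vectors \<and> finite F})"
      by (rule bdd_aboveI2[where M = "\<Prod>i\<in>UNIV. M i"])
         (use sum_prod_bound[of "\<lambda>i l. norm (f i l)" M] M in \<open>auto simp: prod_norm[symmetric]\<close>)
  qed simp
  then have "(\<lambda>k. \<Prod>i\<in>UNIV. f i (u k i)) summable_on int_vectors"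
    by (rule abs_summable_summable)
  moreover have "infsum (\<lambda>k. \<Prod>i\<in>UNIV. f i (u k i)) int_vectors = (\<Prod>i\<in>UNIV. s i)"
  proof -
    have "infsum (\<lambda>k. \<Prod>i\<in>UNIV. f i (u k i)) int_vectors = infsum (\<lambda>l. \<Prod>i\<in>UNIV. f i (l i)) (PiE UNIV Lam)"
      using infsum_reindex_bij_betw[OF lattice_bij, of "\<lambda>l. \<Prod>i\<in>UNIV. f i (l i)"] by simp
    also have "\<dots> = (\<Prod>i\<in>UNIV. infsum (f i) (Lam i))"
      by (rule infsum_prod_PiE_abs) (use abs in auto)
    also have "\<dots> = (\<Prod>i\<in>UNIV. s i)" by (intro prod.cong refl infsumI assms)
    finally show ?thesis .
  qed
  ultimately show ?thesis using has_sum_infsum by fastforce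
qed

lemma gauss_sum_bound:
  assumes \<epsilon>: "\<epsilon> > 0"
  obtains M where "M > 0" "\<And>z F. finite F \<Longrightarrow> F \<subseteq> int_vectors \<Longrightarrow> (\<Sum>k\<in>F. exp (- \<epsilon> * dist2 z k)) \<le> M"
proof -
  have "\<forall>i. \<exists>M>0. \<forall>\<zeta> F. finite F \<longrightarrow> F \<subseteq> Lam i \<longrightarrow> (\<Sum>l\<in>F. exp (- \<epsilon> * (cmod (\<zeta> - l))\<^sup>2)) \<le> M"
    using rect_lattice_shifted_gauss_bound[OF pos \<epsilon>] by metis
  then obtain M where M: "\<And>i. M i > 0" "\<And>i \<zeta> F. finite F \<Longrightarrow> F \<subseteq> Lam i \<Longrightarrow> (\<Sum>l\<in>F. exp (- \<epsilon> * (cmod (\<zeta> - l))\<^sup>2)) \<le> M i"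
    by metis
  show ?thesis
  proof
    show "(\<Prod>i\<in>UNIV. M i) > 0" using M(1) by (intro prod_pos) auto
    fix z and F :: "(real ^ ('d + 'd)) set" assume F: "finite F" "F \<subseteq> int_vectors"
    have "exp (- \<epsilon> * dist2 z k) = (\<Prod>i\<in>UNIV. exp (- \<epsilon> * (cmod (u z i - u k i))\<^sup>2))" for k
      by (simp add: dist2_def exp_sum sum_distrib_left flip: sum_negf)
    then show "(\<Sum>k\<in>F. exp (- \<epsilon> * dist2 z k)) \<le> (\<Prod>i\<in>UNIV. M i)"
      using sum_prod_bound[of "\<lambda>i l. exp (- \<epsilon> * (cmod (u z i - l))\<^sup>2)" M, OF _ M(2) F] by simp
  qed
qed

text \<open>The factors \<open>\<theta>\<close> complete the real part of the exponent to a squared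
  distance. The modulus is thus invariant under common translations of both points, the source of
  all uniformity in shifts.\<close>

lemma kernel_norm: "cmod (L2_inner (G k') (G k)) = c * exp (- (pi / 2) * dist2 k k')"
proof -
  have d: "dist2 k k' = (\<Sum>i\<in>UNIV. (cmod (u k i))\<^sup>2) + (\<Sum>i\<in>UNIV. (cmod (u k' i))\<^sup>2) - 2 * (\<Sum>i\<in>UNIV. Re (u k i * cnj (u k' i)))"
    unfolding dist2_def sum_distrib_left sum.distrib[symmetric] sum_subtractf[symmetric]
    by (intro sum.cong refl, unfold cmod_power2) (simp add: power2_eq_square algebra_simps)
  have "- pi / 2 * (\<Sum>i\<in>UNIV. (cmod (u k i))\<^sup>2) + - pi / 2 * (\<Sum>i\<in>UNIV. (cmod (u k' i))\<^sup>2) + pi * (\<Sum>i\<in>UNIV. Re (u k i * cnj (u k' i))) = - (pi / 2) * dist2 k k'"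
    by (subst d) (simp add: field_simps)
  moreover have "cmod (exp (of_real pi * (\<Sum>i\<in>UNIV. u k i * cnj (u k' i)))) = exp (pi * (\<Sum>i\<in>UNIV. Re (u k i * cnj (u k' i))))"
    by (simp add: norm_exp_eq_Re)
  ultimately show ?thesis
    unfolding kernel norm_mult complex_mod_cnj \<theta>_norm using c
    by (simp only: norm_of_real abs_of_pos mult.assoc flip: exp_add)
qed

lemma kernel_norm_le: "cmod (L2_inner (G k') (G k)) \<le> c"
  unfolding kernel_norm using c dist2_nonneg[of k k'] by (simp add: mult_left_le)

lemma G_norm: "(L2_norm (G k))\<^sup>2 = c"
proof -
  have "cmod (L2_inner (G k) (G k)) = c" unfolding kernel_norm by (simp add: dist2_def)
  then show ?thesis by (simp only: L2_inner_self norm_of_real abs_of_nonneg[OF zero_le_power2])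
qed

text \<open>Schur's test for the Gram matrix, whose row sums are Gaussian lattice sums. Bounds for
  all translates \<open>k + t\<close> hold with the same constant because only differences of points
  enter.\<close>

lemma bessel:
  obtains M where "M > 0"
    "\<And>t f F. f \<in> L2 \<Longrightarrow> finite F \<Longrightarrow> F \<subseteq> int_vectors \<Longrightarrow> (\<Sum>k\<in>F. (cmod (L2_inner f (G (k + t))))\<^sup>2) \<le> M * (L2_norm f)\<^sup>2"
proof -
  obtain M0 where M0: "M0 > 0" "\<And>z F. finite F \<Longrightarrow> F \<subseteq> int_vectors \<Longrightarrow> (\<Sum>k\<in>F. exp (- (pi / 2) * dist2 z k)) \<le> M0"
    using gauss_sum_bound[of "pi / 2"] by auto
  show ?thesis
  proof
    show "c * M0 > 0" using c M0 by simp
    fix t and f :: "real ^ 'd \<Rightarrow> complex" and F :: "(real ^ ('d + 'd)) set" assume f: "f \<in> L2" and F: "finite F" "F \<subseteq> int_vectors"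
    define v where "v k = L2_inner f (G (k + t))" for k
    define s where "s = (\<Sum>k\<in>F. (cmod (v k))\<^sup>2)"
    \<comment> \<open>Testing \<open>f\<close> against the combination with its own samples as
      coefficients gives \<open>s = <f, h>\<close>, while Schur's test gives
      \<open>|h|^2 \<le> c * M0 * s\<close>. Cauchy-Schwarz and division by \<open>s\<close>
      conclude.\<close>
    define h where "h = (\<lambda>x. \<Sum>k\<in>F. v k * G (k + t) x)"
    have h: "h \<in> L2" unfolding h_def by (intro L2_sum G_L2)
    have s0: "s \<ge> 0" by (simp add: s_def sum_nonneg)
    have "L2_inner f h = (\<Sum>k\<in>F. cnj (v k) * v k)"
      unfolding h_def v_def by (rule L2_inner_sum_right) (use f G_L2 in auto)
    also have "\<dots> = of_real s"
      unfolding s_def of_real_sum complex_norm_square by (intro sum.cong refl mult.commute)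
    finally have fh: "L2_inner f h = of_real s" .
    have "of_real ((L2_norm h)\<^sup>2) = L2_inner h h" by (rule L2_inner_self[symmetric])
    also have "\<dots> = (\<Sum>k\<in>F. v k * L2_inner (G (k + t)) h)"
      by (subst (1) h_def, rule L2_inner_sum_left) (use h G_L2 in auto)
    also have "\<dots> = (\<Sum>k\<in>F. v k * (\<Sum>l\<in>F. cnj (v l) * L2_inner (G (k + t)) (G (l + t))))"
      unfolding h_def by (intro sum.cong refl arg_cong2[where f = "(*)"] L2_inner_sum_right) (use G_L2 in auto)
    finally have "(L2_norm h)\<^sup>2 = cmod (\<Sum>k\<in>F. \<Sum>l\<in>F. v k * (cnj (v l) * L2_inner (G (k + t)) (G (l + t))))"
      by (metis (no_types, lifting) norm_of_real abs_of_nonneg zero_le_power2 sum.cong sum_distrib_left)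
    also have "\<dots> \<le> (\<Sum>k\<in>F. \<Sum>l\<in>F. ((cmod (v k))\<^sup>2 / 2 + (cmod (v l))\<^sup>2 / 2) * (c * exp (- (pi / 2) * dist2 l k)))"
    proof (intro order_trans[OF norm_sum] sum_mono)
      fix k l
      have "cmod (v k) * cmod (v l) \<le> (cmod (v k))\<^sup>2 / 2 + (cmod (v l))\<^sup>2 / 2"
        using sum_squares_bound[of "cmod (v k)" "cmod (v l)"] by linarith
      then have "(cmod (v k) * cmod (v l)) * cmod (L2_inner (G (k + t)) (G (l + t))) \<le> ((cmod (v k))\<^sup>2 / 2 + (cmod (v l))\<^sup>2 / 2) * cmod (L2_inner (G (k + t)) (G (l + t)))"
        by (intro mult_right_mono) auto
      then show "cmod (v k * (cnj (v l) * L2_inner (G (k + t)) (G (l + t)))) \<le> ((cmod (v k))\<^sup>2 / 2 + (cmod (v l))\<^sup>2 / 2) * (c * exp (- (pi / 2) * dist2 l k))"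
        unfolding kernel_norm dist2_add by (simp add: norm_mult kernel_norm dist2_add mult_ac)
    qed
    also have "\<dots> = (\<Sum>k\<in>F. \<Sum>l\<in>F. (cmod (v k))\<^sup>2 / 2 * (c * exp (- (pi / 2) * dist2 k l))) + (\<Sum>k\<in>F. \<Sum>l\<in>F. (cmod (v l))\<^sup>2 / 2 * (c * exp (- (pi / 2) * dist2 l k)))"
      by (simp add: distrib_right sum.distrib dist2_commute)
    finally have hn1: "(L2_norm h)\<^sup>2 \<le> (\<Sum>k\<in>F. \<Sum>l\<in>F. (cmod (v k))\<^sup>2 / 2 * (c * exp (- (pi / 2) * dist2 k l))) + (\<Sum>k\<in>F. \<Sum>l\<in>F. (cmod (v l))\<^sup>2 / 2 * (c * exp (- (pi / 2) * dist2 l k)))" .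
    have hn2: "(\<Sum>k\<in>F. \<Sum>l\<in>F. (cmod (v l))\<^sup>2 / 2 * (c * exp (- (pi / 2) * dist2 l k))) = (\<Sum>k\<in>F. \<Sum>l\<in>F. (cmod (v k))\<^sup>2 / 2 * (c * exp (- (pi / 2) * dist2 k l)))"
      by (rule sum.swap)
    have "(\<Sum>k\<in>F. \<Sum>l\<in>F. (cmod (v k))\<^sup>2 / 2 * (c * exp (- (pi / 2) * dist2 k l))) = (\<Sum>k\<in>F. (cmod (v k))\<^sup>2 / 2 * c * (\<Sum>l\<in>F. exp (- (pi / 2) * dist2 k l)))"
      by (simp add: sum_distrib_left mult_ac)
    also have "\<dots> \<le> (\<Sum>k\<in>F. (cmod (v k))\<^sup>2 / 2 * c * M0)"
      using c by (intro sum_mono mult_left_mono M0 F) auto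
    also have "\<dots> = c * M0 * s / 2"
      by (simp add: s_def sum_distrib_left sum_divide_distrib mult_ac)
    finally have hn: "(L2_norm h)\<^sup>2 \<le> c * M0 * s" using hn1 hn2 by linarith
    have "s\<^sup>2 = (cmod (L2_inner f h))\<^sup>2" using s0 by (simp add: fh)
    also have "\<dots> \<le> (L2_norm f)\<^sup>2 * (L2_norm h)\<^sup>2" by (rule L2_Cauchy_Schwarz_power2[OF f h])
    also have "\<dots> \<le> (L2_norm f)\<^sup>2 * (c * M0 * s)" using hn by (rule mult_left_mono) simp
    finally have ss: "s * s \<le> (c * M0 * (L2_norm f)\<^sup>2) * s" by (simp add: power2_eq_square mult_ac)
    have "s \<le> c * M0 * (L2_norm f)\<^sup>2"
    proof (cases "s = 0")
      case True
      then show ?thesis using c M0 by simp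
    next
      case False
      then show ?thesis using s0 ss by (simp add: mult_le_cancel_right)
    qed
    then show "(\<Sum>k\<in>F. (cmod (L2_inner f (G (k + t))))\<^sup>2) \<le> c * M0 * (L2_norm f)\<^sup>2"
      by (simp add: s_def v_def)
  qed
qed

end

section \<open>Sampling below the critical density\<close>

lemma countable_rect_lattice: "countable (rect_lattice a b)"
proof -
  have "rect_lattice a b = (\<lambda>(m, n). Complex (a * of_int m) (b * of_int n)) ` (UNIV :: (int \<times> int) set)"
    unfolding rect_lattice_def by (auto simp: image_def)
  then show ?thesis by simp
qed

context coherent_system
begin

lemma countable_int_vectors: "countable (int_vectors :: (real ^ ('d + 'd)) set)"
proof -
  have "countable (PiE UNIV Lam)" by (intro countable_PiE countable_rect_lattice) simp
  then have "countable ((\<lambda>k i. u k i) ` int_vectors)" using bij_betw_imp_surj_on[OF lattice_bij] by simp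
  then show ?thesis using bij_betw_imp_inj_on[OF lattice_bij] countable_image_inj_on by blast
qed

lemma infinite_int_vectors: "infinite (int_vectors :: (real ^ ('d + 'd)) set)"
proof
  assume "finite (int_vectors :: (real ^ ('d + 'd)) set)"
  moreover have "range (\<lambda>n::nat. (\<chi> j. real n) :: real ^ ('d + 'd)) \<subseteq> int_vectors"
    by (auto simp: int_vectors_def)
  ultimately have "finite (range (\<lambda>n::nat. (\<chi> j. real n) :: real ^ ('d + 'd)))" by (rule finite_subset[rotated])
  moreover have "inj (\<lambda>n::nat. (\<chi> j. real n) :: real ^ ('d + 'd))" by (auto simp: inj_def vec_eq_iff)
  ultimately show False using finite_imageD by blast
qed

lemma gauss_summable: "\<epsilon> > 0 \<Longrightarrow> (\<lambda>k. exp (- \<epsilon> * dist2 z k)) summable_on int_vectors"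
proof -
  assume "\<epsilon> > 0"
  then obtain M where M: "\<And>z F. finite F \<Longrightarrow> F \<subseteq> int_vectors \<Longrightarrow> (\<Sum>k\<in>F. exp (- \<epsilon> * dist2 z k)) \<le> M"
    using gauss_sum_bound by metis
  show ?thesis
  proof (rule nonneg_bdd_above_summable_on)
    show "bdd_above (sum (\<lambda>k. exp (- \<epsilon> * dist2 z k)) ` {F. F \<subseteq> int_vectors \<and> finite F})"
      by (rule bdd_aboveI2[where M = M]) (use M in auto)
  qed simp
qed

text \<open>Product of the planar interpolations with \<open>\<alpha> = pi\<close>, the rate of the
  Fock weight. The quotient \<open>\<theta> z / \<theta> k\<close> cancels the factor
  \<open>exp (pi / 2 * (|u z|^2 - |u k|^2))\<close>, so that pure Gaussian decay in the distance
  remains. The expansion is tested against coherent states only.\<close>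

lemma interpolation:
  assumes ab: "\<And>i. \<bar>al i * be i\<bar> < 1"
  obtains C \<epsilon> where "C > 0" "\<epsilon> > 0"
    "\<And>z. \<exists>a. (\<forall>k\<in>int_vectors. cmod (a k) \<le> C * exp (- \<epsilon> * dist2 z k)) \<and>
        (\<forall>k'. ((\<lambda>k. a k * L2_inner (G k') (G k)) has_sum L2_inner (G k') (G z)) int_vectors)"
proof -
  have "\<forall>i. \<exists>B e. B > 0 \<and> e > 0 \<and> (\<forall>w. \<exists>\<beta>. (\<forall>l\<in>Lam i. cmod (\<beta> l) \<le> B * exp (pi / 2 * ((cmod w)\<^sup>2 - (cmod l)\<^sup>2)) * exp (- e * (cmod (w - l))\<^sup>2)) \<and>
       (\<forall>v. ((\<lambda>l. \<beta> l * exp (v * l)) has_sum exp (v * w)) (Lam i)))"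
  proof
    fix i
    obtain S where S: "sigma_function \<bar>al i\<bar> \<bar>be i\<bar> S" using sigma_function_obtain[OF pos] by blast
    have "\<bar>al i\<bar> * \<bar>be i\<bar> < 1" "\<bar>al i\<bar> * \<bar>be i\<bar> > 0" using ab[of i] pos[of i] by (simp_all add: abs_mult)
    \<comment> \<open>The only use of the density hypothesis: area below 1 is precisely the room
      that the planar interpolation needs above the rate \<open>pi\<close>.\<close>
    then have "pi < pi / (\<bar>al i\<bar> * \<bar>be i\<bar>)" by (subst less_divide_eq) auto
    then show "\<exists>B e. B > 0 \<and> e > 0 \<and> (\<forall>w. \<exists>\<beta>. (\<forall>l\<in>Lam i. cmod (\<beta> l) \<le> B * exp (pi / 2 * ((cmod w)\<^sup>2 - (cmod l)\<^sup>2)) * exp (- e * (cmod (w - l))\<^sup>2)) \<and>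
       (\<forall>v. ((\<lambda>l. \<beta> l * exp (v * l)) has_sum exp (v * w)) (Lam i)))"
      by (rule sigma_function.exponential_interpolation[OF S pi_ge_zero]) blast
  qed
  from choice[OF this] obtain B where
    "\<forall>i. \<exists>e. B i > 0 \<and> e > 0 \<and> (\<forall>w. \<exists>\<beta>. (\<forall>l\<in>Lam i. cmod (\<beta> l) \<le> B i * exp (pi / 2 * ((cmod w)\<^sup>2 - (cmod l)\<^sup>2)) * exp (- e * (cmod (w - l))\<^sup>2)) \<and>
       (\<forall>v. ((\<lambda>l. \<beta> l * exp (v * l)) has_sum exp (v * w)) (Lam i)))" by blast
  from choice[OF this] obtain e where
    Be: "\<forall>i. B i > 0 \<and> e i > 0 \<and> (\<forall>w. \<exists>\<beta>. (\<forall>l\<in>Lam i. cmod (\<beta> l) \<le> B i * exp (pi / 2 * ((cmod w)\<^sup>2 - (cmod l)\<^sup>2)) * exp (- e i * (cmod (w - l))\<^sup>2)) \<and>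
       (\<forall>v. ((\<lambda>l. \<beta> l * exp (v * l)) has_sum exp (v * w)) (Lam i)))" by blast
  define \<epsilon> where "\<epsilon> = Min (range e)"
  have \<epsilon>: "\<epsilon> > 0" "\<epsilon> \<le> e i" for i using Be by (auto simp: \<epsilon>_def)
  define C where "C = (\<Prod>i\<in>UNIV. B i)"
  have C: "C > 0" unfolding C_def using Be by (intro prod_pos) auto
  show ?thesis
  proof (rule that[OF C \<epsilon>(1)])
    fix z
    have "\<forall>i. \<exists>\<beta>. (\<forall>l\<in>Lam i. cmod (\<beta> l) \<le> B i * exp (pi / 2 * ((cmod (u z i))\<^sup>2 - (cmod l)\<^sup>2)) * exp (- e i * (cmod (u z i - l))\<^sup>2)) \<and>
       (\<forall>v. ((\<lambda>l. \<beta> l * exp (v * l)) has_sum exp (v * u z i)) (Lam i))" using Be by blast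
    from choice[OF this] obtain \<beta> where
      \<beta>: "\<forall>i. (\<forall>l\<in>Lam i. cmod (\<beta> i l) \<le> B i * exp (pi / 2 * ((cmod (u z i))\<^sup>2 - (cmod l)\<^sup>2)) * exp (- e i * (cmod (u z i - l))\<^sup>2)) \<and>
       (\<forall>v. ((\<lambda>l. \<beta> i l * exp (v * l)) has_sum exp (v * u z i)) (Lam i))" by blast
    define a where "a = (\<lambda>k. \<theta> z / \<theta> k * (\<Prod>i\<in>UNIV. \<beta> i (u k i)))"
    have \<theta>0: "\<theta> k \<noteq> 0" for k using \<theta>_norm[of k] by auto
    have "cmod (a k) \<le> C * exp (- \<epsilon> * dist2 z k)" if k: "k \<in> int_vectors" for k
    proof -
      define p q where "p = (\<Sum>i\<in>UNIV. (cmod (u z i))\<^sup>2)" and "q = (\<Sum>i\<in>UNIV. (cmod (u k i))\<^sup>2)"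
      have "cmod (a k) = exp (- pi / 2 * p) / exp (- pi / 2 * q) * (\<Prod>i\<in>UNIV. cmod (\<beta> i (u k i)))"
        by (simp add: a_def norm_mult norm_divide \<theta>_norm p_def q_def prod_norm)
      also have "\<dots> \<le> exp (- pi / 2 * p) / exp (- pi / 2 * q) * (\<Prod>i\<in>UNIV. B i * (exp (pi / 2 * ((cmod (u z i))\<^sup>2 - (cmod (u k i))\<^sup>2)) * exp (- e i * (cmod (u z i - u k i))\<^sup>2)))"
        using \<beta> u_lattice[OF k] by (intro mult_left_mono prod_mono) (auto simp: mult.assoc)
      also have "(\<Prod>i\<in>UNIV. B i * (exp (pi / 2 * ((cmod (u z i))\<^sup>2 - (cmod (u k i))\<^sup>2)) * exp (- e i * (cmod (u z i - u k i))\<^sup>2)))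
          = C * (exp (pi / 2 * (p - q)) * exp (- (\<Sum>i\<in>UNIV. e i * (cmod (u z i - u k i))\<^sup>2)))"
        unfolding prod.distrib C_def p_def q_def sum_subtractf[symmetric] sum_distrib_left sum_negf[symmetric]
        by (simp add: exp_sum)
      also have "exp (- pi / 2 * p) / exp (- pi / 2 * q) * (C * (exp (pi / 2 * (p - q)) * exp (- (\<Sum>i\<in>UNIV. e i * (cmod (u z i - u k i))\<^sup>2))))
          = C * exp (- (\<Sum>i\<in>UNIV. e i * (cmod (u z i - u k i))\<^sup>2))"
      proof -
        have "exp (- pi / 2 * p) / exp (- pi / 2 * q) * exp (pi / 2 * (p - q)) = exp (- pi / 2 * p - (- pi / 2 * q) + pi / 2 * (p - q))"
          by (simp only: exp_add exp_diff)
        also have "- pi / 2 * p - (- pi / 2 * q) + pi / 2 * (p - q) = 0" by (simp add: field_simps)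
        finally have one: "exp (- pi / 2 * p) / exp (- pi / 2 * q) * exp (pi / 2 * (p - q)) = 1" by simp
        have "x * (C * (y * w)) = (x * y) * (C * w)" for x y w by (simp only: mult_ac)
        then show ?thesis by (simp only: one mult_1_left)
      qed
      also have "\<dots> \<le> C * exp (- \<epsilon> * dist2 z k)"
      proof -
        have "\<epsilon> * dist2 z k \<le> (\<Sum>i\<in>UNIV. e i * (cmod (u z i - u k i))\<^sup>2)"
          unfolding dist2_def sum_distrib_left by (intro sum_mono mult_right_mono \<epsilon>) simp
        then show ?thesis using C by (intro mult_left_mono) auto
      qed
      finally show ?thesis .
    qed
    moreover have "((\<lambda>k. a k * L2_inner (G k') (G k)) has_sum L2_inner (G k') (G z)) int_vectors" for k'
    proof -
      have "((\<lambda>k. \<Prod>i\<in>UNIV. \<beta> i (u k i) * exp ((of_real pi * cnj (u k' i)) * u k i)) has_sum (\<Prod>i\<in>UNIV. exp ((of_real pi * cnj (u k' i)) * u z i))) int_vectors"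
        by (rule has_sum_prod) (use \<beta> in blast)
      then have "((\<lambda>k. of_real c * \<theta> z * cnj (\<theta> k') * (\<Prod>i\<in>UNIV. \<beta> i (u k i) * exp ((of_real pi * cnj (u k' i)) * u k i))) has_sum of_real c * \<theta> z * cnj (\<theta> k') * (\<Prod>i\<in>UNIV. exp ((of_real pi * cnj (u k' i)) * u z i))) int_vectors"
        by (rule has_sum_cmult_right)
      moreover have ee: "exp (of_real pi * (\<Sum>i\<in>UNIV. u k i * cnj (u k' i))) = (\<Prod>i\<in>UNIV. exp ((of_real pi * cnj (u k' i)) * u k i))" for k
        unfolding sum_distrib_left by (subst exp_sum) (simp_all add: mult_ac)
      moreover have "of_real c * \<theta> z * cnj (\<theta> k') * (\<Prod>i\<in>UNIV. \<beta> i (u k i) * exp ((of_real pi * cnj (u k' i)) * u k i)) = a k * L2_inner (G k') (G k)" for k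
        unfolding kernel a_def ee prod.distrib using \<theta>0[of k] by simp
      ultimately show ?thesis by (simp add: kernel)
    qed
    ultimately show "\<exists>a. (\<forall>k\<in>int_vectors. cmod (a k) \<le> C * exp (- \<epsilon> * dist2 z k)) \<and>
        (\<forall>k'. ((\<lambda>k. a k * L2_inner (G k') (G k)) has_sum L2_inner (G k') (G z)) int_vectors)" by blast
  qed
qed

lemma sample_bound: "f \<in> L2 \<Longrightarrow> (cmod (L2_inner f (G k)))\<^sup>2 \<le> (L2_norm f)\<^sup>2 * c"
  using L2_Cauchy_Schwarz_power2[OF _ G_L2, of f k] by (simp add: G_norm)

text \<open>The weak expansion becomes a norm statement because the remainder \<open>h\<close> of a
  partial sum is itself a combination of coherent states. Its inner products with all coherent
  states are \<open>O(\<delta>)\<close>, and hence so is \<open><h, h>\<close>. The sample at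
  \<open>z\<close> is then estimated by Cauchy-Schwarz with the weights
  \<open>|a k|\<close>.\<close>

lemma pointwise_bound:
  assumes ab: "\<And>i. \<bar>al i * be i\<bar> < 1"
  obtains C \<epsilon> where "C > 0" "\<epsilon> > 0"
    "\<And>f z. f \<in> L2 \<Longrightarrow> (\<lambda>k. exp (- \<epsilon> * dist2 z k) * (cmod (L2_inner f (G k)))\<^sup>2) summable_on int_vectors"
    "\<And>f z. f \<in> L2 \<Longrightarrow> (cmod (L2_inner f (G z)))\<^sup>2 \<le> C * (\<Sum>\<^sub>\<infinity>k\<in>int_vectors. exp (- \<epsilon> * dist2 z k) * (cmod (L2_inner f (G k)))\<^sup>2)"
proof -
  obtain C \<epsilon> where C: "C > 0" and \<epsilon>: "\<epsilon> > 0" and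
    int: "\<And>z. \<exists>a. (\<forall>k\<in>int_vectors. cmod (a k) \<le> C * exp (- \<epsilon> * dist2 z k)) \<and>
        (\<forall>k'. ((\<lambda>k. a k * L2_inner (G k') (G k)) has_sum L2_inner (G k') (G z)) int_vectors)"
    using interpolation[OF ab] by blast
  obtain M where M: "M > 0" "\<And>z F. finite F \<Longrightarrow> F \<subseteq> int_vectors \<Longrightarrow> (\<Sum>k\<in>F. exp (- \<epsilon> * dist2 z k)) \<le> M"
    using gauss_sum_bound[OF \<epsilon>] by blast
  have summ: "(\<lambda>k. exp (- \<epsilon> * dist2 z k) * (cmod (L2_inner f (G k)))\<^sup>2) summable_on int_vectors" if f: "f \<in> L2" for f z
  proof (rule summable_on_comparison_test)
    show "(\<lambda>k. exp (- \<epsilon> * dist2 z k) * ((L2_norm f)\<^sup>2 * c)) summable_on int_vectors"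
      by (intro summable_on_cmult_left gauss_summable \<epsilon>)
    show "exp (- \<epsilon> * dist2 z k) * (cmod (L2_inner f (G k)))\<^sup>2 \<le> exp (- \<epsilon> * dist2 z k) * ((L2_norm f)\<^sup>2 * c)" for k
      by (intro mult_left_mono sample_bound f) simp
  qed simp
  show ?thesis
  proof (rule that[OF _ \<epsilon> summ])
    show "C * M * C > 0" using C M by simp
    fix f :: "real ^ 'd \<Rightarrow> complex" and z assume f: "f \<in> L2"
    obtain a where a: "\<And>k. k \<in> int_vectors \<Longrightarrow> cmod (a k) \<le> C * exp (- \<epsilon> * dist2 z k)"
      "\<And>k'. ((\<lambda>k. a k * L2_inner (G k') (G k)) has_sum L2_inner (G k') (G z)) int_vectors"
      using int by blast
    define V where "V k = L2_inner f (G k)" for k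
    define W where "W = (\<Sum>\<^sub>\<infinity>k\<in>int_vectors. exp (- \<epsilon> * dist2 z k) * (cmod (V k))\<^sup>2)"
    have asum: "(\<lambda>k. cmod (a k)) summable_on int_vectors"
      by (rule summable_on_comparison_test[OF summable_on_cmult_right[OF gauss_summable[OF \<epsilon>, of z], of C]]) (use a in auto)
    have afin: "(\<Sum>k\<in>F. cmod (a k)) \<le> C * M" if "finite F" "F \<subseteq> int_vectors" for F
    proof -
      have "(\<Sum>k\<in>F. cmod (a k)) \<le> (\<Sum>k\<in>F. C * exp (- \<epsilon> * dist2 z k))" using that a by (intro sum_mono) auto
      also have "\<dots> = C * (\<Sum>k\<in>F. exp (- \<epsilon> * dist2 z k))" by (simp add: sum_distrib_left)
      also have "\<dots> \<le> C * M" using C that by (intro mult_left_mono M) auto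
      finally show ?thesis .
    qed
    define A where "A = (\<Sum>\<^sub>\<infinity>k\<in>int_vectors. cmod (a k))"
    have key: "cmod (V z) \<le> sqrt (C * M * C * W) + L2_norm f * sqrt ((1 + C * M) * c * \<delta>)" if \<delta>: "\<delta> > 0" for \<delta>
    proof -
      have "(sum (\<lambda>k. cmod (a k)) \<longlongrightarrow> A) (finite_subsets_at_top int_vectors)"
        using has_sum_infsum[OF asum] by (simp add: has_sum_def A_def)
      then have "\<forall>\<^sub>F F in finite_subsets_at_top int_vectors. dist (\<Sum>k\<in>F. cmod (a k)) A < \<delta>"
        using \<delta> by (rule tendstoD)
      then obtain F where F: "finite F" "F \<subseteq> int_vectors" "dist (\<Sum>k\<in>F. cmod (a k)) A < \<delta>"
        unfolding eventually_finite_subsets_at_top by blast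
      have tail: "(\<Sum>\<^sub>\<infinity>k\<in>int_vectors - F. cmod (a k)) \<le> \<delta>"
        using F infsum_Diff[OF asum _ F(2)] by (auto simp: A_def dist_real_def)
      \<comment> \<open>The coefficients are conjugated because \<open>L2_inner\<close> is conjugate
        linear in its second argument.\<close>
      define h where "h = (\<lambda>t. G z t - (\<Sum>k\<in>F. cnj (a k) * G k t))"
      have sumL2: "(\<lambda>t. \<Sum>k\<in>F. cnj (a k) * G k t) \<in> L2" by (intro L2_sum G_L2)
      have h: "h \<in> L2" unfolding h_def by (intro L2_diff G_L2 sumL2)
      have inner_h: "L2_inner g h = L2_inner g (G z) - (\<Sum>k\<in>F. a k * L2_inner g (G k))" if "g \<in> L2" for g
        unfolding h_def using that G_L2 sumL2 by (simp add: L2_inner_diff_right L2_inner_sum_right)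
      have small: "cmod (L2_inner (G k') h) \<le> c * \<delta>" for k'
      proof -
        have asub: "(\<lambda>k. cmod (a k)) summable_on (int_vectors - F)"
          by (rule summable_on_subset_banach[OF asum]) auto
        have hs: "((\<lambda>k. a k * L2_inner (G k') (G k)) has_sum L2_inner (G k') h) (int_vectors - F)"
          unfolding inner_h[OF G_L2] by (intro has_sum_Diff a has_sum_finite F)
        have le: "cmod (a k * L2_inner (G k') (G k)) \<le> cmod (a k) * c" for k
          unfolding norm_mult by (intro mult_left_mono kernel_norm_le) simp
        have s2: "(\<lambda>k. cmod (a k) * c) summable_on (int_vectors - F)" by (intro summable_on_cmult_left asub)
        have s1: "(\<lambda>k. cmod (a k * L2_inner (G k') (G k))) summable_on (int_vectors - F)"
          by (rule summable_on_comparison_test[OF s2 le]) simp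
        have "cmod (L2_inner (G k') h) \<le> (\<Sum>\<^sub>\<infinity>k\<in>int_vectors - F. cmod (a k * L2_inner (G k') (G k)))"
          using norm_infsum_bound[OF s1] infsumI[OF hs] by simp
        also have "\<dots> \<le> (\<Sum>\<^sub>\<infinity>k\<in>int_vectors - F. cmod (a k) * c)"
          by (rule infsum_mono[OF s1 s2 le])
        also have "\<dots> = (\<Sum>\<^sub>\<infinity>k\<in>int_vectors - F. cmod (a k)) * c" by (rule infsum_cmult_left')
        also have "\<dots> \<le> \<delta> * c" using tail c by (intro mult_right_mono) auto
        finally show ?thesis by (simp add: mult.commute)
      qed
      \<comment> \<open>One copy of \<open>h\<close> is expanded into coherent states while the
        other remains and is small against each of them; the total coefficient mass is at most
        \<open>1 + C * M\<close>.\<close>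
      have "(L2_norm h)\<^sup>2 = cmod (L2_inner h h)" by (simp only: L2_inner_self norm_of_real abs_of_nonneg[OF zero_le_power2])
      also have "\<dots> = cmod (L2_inner h (G z) - (\<Sum>k\<in>F. a k * L2_inner h (G k)))" by (simp only: inner_h[OF h])
      also have "\<dots> \<le> cmod (L2_inner h (G z)) + (\<Sum>k\<in>F. cmod (a k * L2_inner h (G k)))"
        by (intro order_trans[OF norm_triangle_ineq4] add_mono order_refl norm_sum)
      also have "\<dots> \<le> c * \<delta> + (\<Sum>k\<in>F. cmod (a k) * (c * \<delta>))"
        using small by (intro add_mono sum_mono) (auto simp: norm_mult L2_inner_commute[of h] intro!: mult_left_mono)
      also have "\<dots> = c * \<delta> + (\<Sum>k\<in>F. cmod (a k)) * (c * \<delta>)" by (simp add: sum_distrib_right)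
      also have "\<dots> \<le> c * \<delta> + (C * M) * (c * \<delta>)"
        using afin[OF F(1,2)] c \<delta> by (intro add_mono mult_right_mono) auto
      also have "\<dots> = (1 + C * M) * c * \<delta>" by (simp add: algebra_simps)
      finally have hn: "L2_norm h \<le> sqrt ((1 + C * M) * c * \<delta>)"
        using real_le_rsqrt by blast
      have "V z = (\<Sum>k\<in>F. a k * V k) + L2_inner f h" by (simp add: V_def inner_h[OF f])
      then have "cmod (V z) \<le> (\<Sum>k\<in>F. cmod (a k) * cmod (V k)) + cmod (L2_inner f h)"
        using norm_triangle_ineq[of "\<Sum>k\<in>F. a k * V k" "L2_inner f h"] norm_sum[of "\<lambda>k. a k * V k" F] by (simp add: norm_mult)
      moreover have "cmod (L2_inner f h) \<le> L2_norm f * sqrt ((1 + C * M) * c * \<delta>)"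
        using L2_Cauchy_Schwarz[OF f h] mult_left_mono[OF hn L2_norm_nonneg[of f]] by linarith
      moreover have "(\<Sum>k\<in>F. cmod (a k) * cmod (V k)) \<le> sqrt (C * M * C * W)"
      proof (rule real_le_rsqrt)
        \<comment> \<open>Each weight is split into two square roots. One factor is bounded by the
          total mass \<open>C * M\<close>, the other keeps the Gaussian average of squared
          samples.\<close>
        have "(\<Sum>k\<in>F. cmod (a k) * cmod (V k))\<^sup>2 = (\<Sum>k\<in>F. sqrt (cmod (a k)) * (sqrt (cmod (a k)) * cmod (V k)))\<^sup>2"
          by (simp add: mult.assoc[symmetric])
        also have "\<dots> \<le> (\<Sum>k\<in>F. (sqrt (cmod (a k)))\<^sup>2) * (\<Sum>k\<in>F. (sqrt (cmod (a k)) * cmod (V k))\<^sup>2)"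
          by (rule Cauchy_Schwarz_ineq_sum)
        also have "\<dots> = (\<Sum>k\<in>F. cmod (a k)) * (\<Sum>k\<in>F. cmod (a k) * (cmod (V k))\<^sup>2)"
          by (simp add: power_mult_distrib)
        also have "\<dots> \<le> (C * M) * (C * W)"
        proof (intro mult_mono afin F)
          have "(\<Sum>k\<in>F. cmod (a k) * (cmod (V k))\<^sup>2) \<le> (\<Sum>k\<in>F. C * exp (- \<epsilon> * dist2 z k) * (cmod (V k))\<^sup>2)"
            using a F by (intro sum_mono mult_right_mono) auto
          also have "\<dots> = C * (\<Sum>k\<in>F. exp (- \<epsilon> * dist2 z k) * (cmod (V k))\<^sup>2)" by (simp add: sum_distrib_left mult.assoc)
          also have "\<dots> \<le> C * W"
            unfolding W_def V_def using C F by (intro mult_left_mono finite_sum_le_infsum summ f) auto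
          finally show "(\<Sum>k\<in>F. cmod (a k) * (cmod (V k))\<^sup>2) \<le> C * W" .
        qed (use C M in \<open>auto intro: sum_nonneg\<close>)
        finally show "(\<Sum>k\<in>F. cmod (a k) * cmod (V k))\<^sup>2 \<le> C * M * C * W" by (simp add: mult.assoc)
      qed
      ultimately show ?thesis by linarith
    qed
    have "((\<lambda>\<delta>. sqrt (C * M * C * W) + L2_norm f * sqrt ((1 + C * M) * c * \<delta>)) \<longlongrightarrow> sqrt (C * M * C * W) + L2_norm f * sqrt ((1 + C * M) * c * 0)) (at_right 0)"
      by (intro tendsto_intros)
    moreover have "\<forall>\<^sub>F \<delta> in at_right 0. cmod (V z) \<le> sqrt (C * M * C * W) + L2_norm f * sqrt ((1 + C * M) * c * \<delta>)"
      using key by (intro eventually_at_right_less[THEN eventually_mono]) auto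
    ultimately have "cmod (V z) \<le> sqrt (C * M * C * W) + L2_norm f * sqrt ((1 + C * M) * c * 0)"
      by (rule tendsto_lowerbound) simp
    then have "cmod (V z) \<le> sqrt (C * M * C * W)" by simp
    then have "(cmod (V z))\<^sup>2 \<le> (sqrt (C * M * C * W))\<^sup>2" by (intro power_mono) auto
    moreover have "C * M * C * W \<ge> 0" unfolding W_def using C M by (intro mult_nonneg_nonneg infsum_nonneg) auto
    ultimately show "(cmod (L2_inner f (G z)))\<^sup>2 \<le> C * M * C * (\<Sum>\<^sub>\<infinity>k\<in>int_vectors. exp (- \<epsilon> * dist2 z k) * (cmod (L2_inner f (G k)))\<^sup>2)"
      by (simp add: V_def W_def)
  qed
qed


lemma frame_upper_bound:
  obtains M where "M > 0" "\<And>f. f \<in> L2 \<Longrightarrow> (\<lambda>k. (cmod (L2_inner f (G k)))\<^sup>2) summable_on int_vectors"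
    "\<And>f. f \<in> L2 \<Longrightarrow> (\<Sum>\<^sub>\<infinity>k\<in>int_vectors. (cmod (L2_inner f (G k)))\<^sup>2) \<le> M * (L2_norm f)\<^sup>2"
proof -
  obtain M where M: "M > 0"
    "\<And>t f F. f \<in> L2 \<Longrightarrow> finite F \<Longrightarrow> F \<subseteq> int_vectors \<Longrightarrow> (\<Sum>k\<in>F. (cmod (L2_inner f (G (k + t))))\<^sup>2) \<le> M * (L2_norm f)\<^sup>2"
    using bessel by blast
  have fin: "(\<Sum>k\<in>F. (cmod (L2_inner f (G k)))\<^sup>2) \<le> M * (L2_norm f)\<^sup>2" if "f \<in> L2" "finite F" "F \<subseteq> int_vectors" for f F
    using M(2)[OF that, of 0] by simp
  have summ: "(\<lambda>k. (cmod (L2_inner f (G k)))\<^sup>2) summable_on int_vectors" if f: "f \<in> L2" for f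
  proof (rule nonneg_bdd_above_summable_on)
    show "bdd_above (sum (\<lambda>k. (cmod (L2_inner f (G k)))\<^sup>2) ` {F. F \<subseteq> int_vectors \<and> finite F})"
      by (rule bdd_aboveI2[where M = "M * (L2_norm f)\<^sup>2"]) (use fin[OF f] in auto)
  qed simp
  show ?thesis
    by (rule that[OF M(1) summ]) (auto intro!: infsum_le_finite_sums summ fin)
qed

text \<open>The pointwise bound is integrated over phase space, with
  \<open>\<zeta> x \<omega>\<close> the index of the point \<open>(x, \<omega>)\<close>. By
  \<open>dist\<close> every lattice point contributes at most a product of two Gaussians in
  \<open>x\<close> and in \<open>\<omega>\<close>, whose integral \<open>j^2\<close> does not depend
  on the point. This accounts for \<open>\<kappa> / (C * j\<^sup>2)\<close>.\<close>

lemma frame_lower_bound: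
  fixes \<zeta> :: "real ^ 'd \<Rightarrow> real ^ 'd \<Rightarrow> real ^ ('d + 'd)" and xl ol :: "real ^ ('d + 'd) \<Rightarrow> real ^ 'd" and \<kappa> \<rho> :: real
  assumes ab: "\<And>i. \<bar>al i * be i\<bar> < 1" and \<kappa>: "\<kappa> > 0" and \<rho>: "\<rho> > 0"
    and dist: "\<And>x \<omega> k. \<rho> * ((norm (x - xl k))\<^sup>2 + (norm (\<omega> - ol k))\<^sup>2) \<le> dist2 (\<zeta> x \<omega>) k"
    and stft: "\<And>f. f \<in> L2 \<Longrightarrow> ennreal (\<kappa> * (L2_norm f)\<^sup>2) \<le> (\<integral>\<^sup>+x. \<integral>\<^sup>+\<omega>. ennreal ((cmod (L2_inner f (G (\<zeta> x \<omega>))))\<^sup>2) \<partial>lborel \<partial>lborel)"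
  obtains C1 where "C1 > 0" "\<And>f. f \<in> L2 \<Longrightarrow> C1 * (L2_norm f)\<^sup>2 \<le> (\<Sum>\<^sub>\<infinity>k\<in>int_vectors. (cmod (L2_inner f (G k)))\<^sup>2)"
proof -
  obtain C \<epsilon> where C: "C > 0" and \<epsilon>: "\<epsilon> > 0" and
    pw: "\<And>f z. f \<in> L2 \<Longrightarrow> (\<lambda>k. exp (- \<epsilon> * dist2 z k) * (cmod (L2_inner f (G k)))\<^sup>2) summable_on int_vectors"
    "\<And>f z. f \<in> L2 \<Longrightarrow> (cmod (L2_inner f (G z)))\<^sup>2 \<le> C * (\<Sum>\<^sub>\<infinity>k\<in>int_vectors. exp (- \<epsilon> * dist2 z k) * (cmod (L2_inner f (G k)))\<^sup>2)"
    using pointwise_bound[OF ab] by blast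
  obtain M where summ: "\<And>f. f \<in> L2 \<Longrightarrow> (\<lambda>k. (cmod (L2_inner f (G k)))\<^sup>2) summable_on int_vectors"
    using frame_upper_bound by blast
  \<comment> \<open>Integration and summation are exchanged for series indexed by natural numbers,
    so the lattice is enumerated.\<close>
  define e where "e = from_nat_into (int_vectors :: (real ^ ('d + 'd)) set)"
  have e: "bij_betw e UNIV int_vectors"
    unfolding e_def by (rule bij_betw_from_nat_into[OF countable_int_vectors infinite_int_vectors])
  have sums: "(\<lambda>n. f (e n)) sums infsum f int_vectors" if "f summable_on int_vectors" for f :: "_ \<Rightarrow> real"
    using that has_sum_reindex_bij_betw[OF e, of f "infsum f int_vectors"] has_sum_infsum[of f int_vectors] by (simp add: has_sum_imp_sums)
  define g where "g = (\<lambda>x :: real ^ 'd. exp (- (\<epsilon> * \<rho>) * (norm x)\<^sup>2))"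
  have gm[measurable]: "g \<in> borel_measurable borel" unfolding g_def by measurable
  have gi: "integrable lborel g" unfolding g_def by (rule gaussian_integrable) (use \<epsilon> \<rho> in simp)
  have g0: "g x > 0" for x by (simp add: g_def)
  define j where "j = (LBINT x. g x)"
  have j: "j > 0" unfolding j_def by (rule integrable_pos_integral_pos[OF gi g0])
  have gj: "(\<integral>\<^sup>+x. ennreal (g (x - a)) \<partial>lborel) = ennreal j" for a
  proof -
    have "(\<integral>\<^sup>+x. ennreal (g (- a + x)) \<partial>lborel) = (\<integral>\<^sup>+x. ennreal (g x) \<partial>lborel)"
      by (rule lborel_nn_integral_translate) measurable
    also have "\<dots> = ennreal j" unfolding j_def by (rule nn_integral_eq_integral[OF gi]) (simp add: g0 less_imp_le)
    finally show ?thesis by simp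
  qed
  show ?thesis
  proof
    show "\<kappa> / (C * j\<^sup>2) > 0" using \<kappa> C j by simp
    fix f :: "real ^ 'd \<Rightarrow> complex" assume f: "f \<in> L2"
    define V where "V n = (cmod (L2_inner f (G (e n))))\<^sup>2" for n
    define S where "S = (\<Sum>\<^sub>\<infinity>k\<in>int_vectors. (cmod (L2_inner f (G k)))\<^sup>2)"
    have V: "V sums S" unfolding V_def S_def by (rule sums[OF summ[OF f]])
    have V0: "V n \<ge> 0" for n by (simp add: V_def)
    have le: "ennreal ((cmod (L2_inner f (G (\<zeta> x \<omega>))))\<^sup>2) \<le> (\<Sum>n. ennreal (C * V n) * (ennreal (g (x - xl (e n))) * ennreal (g (\<omega> - ol (e n)))))" for x \<omega>
    proof -
      define h where "h n = exp (- \<epsilon> * dist2 (\<zeta> x \<omega>) (e n)) * V n" for n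
      have h: "h sums (\<Sum>\<^sub>\<infinity>k\<in>int_vectors. exp (- \<epsilon> * dist2 (\<zeta> x \<omega>) k) * (cmod (L2_inner f (G k)))\<^sup>2)"
        unfolding h_def V_def by (rule sums[OF pw(1)[OF f]])
      have Ch: "(\<lambda>n. C * h n) sums (C * (\<Sum>\<^sub>\<infinity>k\<in>int_vectors. exp (- \<epsilon> * dist2 (\<zeta> x \<omega>) k) * (cmod (L2_inner f (G k)))\<^sup>2))"
        by (rule sums_mult[OF h])
      have "ennreal ((cmod (L2_inner f (G (\<zeta> x \<omega>))))\<^sup>2) \<le> ennreal (suminf (\<lambda>n. C * h n))"
        by (intro ennreal_leI) (simp only: sums_unique[OF Ch, symmetric] pw(2)[OF f])
      also have "\<dots> = (\<Sum>n. ennreal (C * h n))"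
        by (rule suminf_ennreal2[symmetric]) (use C V0 sums_summable[OF Ch] in \<open>auto simp: h_def\<close>)
      also have "\<dots> \<le> (\<Sum>n. ennreal (C * V n) * (ennreal (g (x - xl (e n))) * ennreal (g (\<omega> - ol (e n)))))"
      proof (intro suminf_le)
        fix n
        have "\<epsilon> * (\<rho> * ((norm (x - xl (e n)))\<^sup>2 + (norm (\<omega> - ol (e n)))\<^sup>2)) \<le> \<epsilon> * dist2 (\<zeta> x \<omega>) (e n)"
          using \<epsilon> dist by (intro mult_left_mono) auto
        then have "exp (- \<epsilon> * dist2 (\<zeta> x \<omega>) (e n)) \<le> g (x - xl (e n)) * g (\<omega> - ol (e n))"
          unfolding g_def exp_add[symmetric] by (simp add: algebra_simps)
        then have "C * h n \<le> C * V n * (g (x - xl (e n)) * g (\<omega> - ol (e n)))"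
          unfolding h_def mult.assoc using C V0[of n] by (subst mult.commute[of _ "V n"]) (intro mult_left_mono, auto)
        then show "ennreal (C * h n) \<le> ennreal (C * V n) * (ennreal (g (x - xl (e n))) * ennreal (g (\<omega> - ol (e n))))"
          using C V0[of n] g0 by (simp add: less_imp_le ennreal_mult[symmetric] ennreal_leI)
      qed auto
      finally show ?thesis .
    qed
    have "ennreal (\<kappa> * (L2_norm f)\<^sup>2) \<le> (\<integral>\<^sup>+x. \<integral>\<^sup>+\<omega>. ennreal ((cmod (L2_inner f (G (\<zeta> x \<omega>))))\<^sup>2) \<partial>lborel \<partial>lborel)"
      by (rule stft[OF f])
    also have "\<dots> \<le> (\<integral>\<^sup>+x. \<integral>\<^sup>+\<omega>. (\<Sum>n. ennreal (C * V n) * (ennreal (g (x - xl (e n))) * ennreal (g (\<omega> - ol (e n))))) \<partial>lborel \<partial>lborel)"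
      by (intro nn_integral_mono le)
    also have "\<dots> = (\<integral>\<^sup>+x. (\<Sum>n. \<integral>\<^sup>+\<omega>. ennreal (C * V n) * (ennreal (g (x - xl (e n))) * ennreal (g (\<omega> - ol (e n)))) \<partial>lborel) \<partial>lborel)"
      by (intro nn_integral_cong nn_integral_suminf) measurable
    also have "\<dots> = (\<integral>\<^sup>+x. (\<Sum>n. ennreal (C * V n) * (ennreal (g (x - xl (e n))) * ennreal j)) \<partial>lborel)"
      by (simp add: nn_integral_cmult gj)
    also have "\<dots> = (\<Sum>n. \<integral>\<^sup>+x. ennreal (C * V n) * (ennreal (g (x - xl (e n))) * ennreal j) \<partial>lborel)"
      by (rule nn_integral_suminf) measurable
    also have "\<dots> = (\<Sum>n. ennreal (C * V n) * (ennreal j * ennreal j))"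
      by (simp add: nn_integral_cmult nn_integral_multc gj)
    also have "\<dots> = (\<Sum>n. ennreal (C * j\<^sup>2 * V n))"
      using C V0 j by (intro suminf_cong) (simp add: less_imp_le ennreal_mult[symmetric] power2_eq_square mult_ac)
    also have "\<dots> = ennreal (suminf (\<lambda>n. C * j\<^sup>2 * V n))"
      by (rule suminf_ennreal2) (use C V0 sums_summable[OF sums_mult[OF V, of "C * j\<^sup>2"]] in auto)
    also have "\<dots> = ennreal (C * j\<^sup>2 * S)"
      using sums_unique[OF sums_mult[OF V, of "C * j\<^sup>2"]] by simp
    finally have "\<kappa> * (L2_norm f)\<^sup>2 \<le> C * j\<^sup>2 * S"
    proof (subst (asm) ennreal_le_iff)
      show "0 \<le> C * j\<^sup>2 * S" unfolding S_def using C by (intro mult_nonneg_nonneg infsum_nonneg) auto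
    qed
    then show "\<kappa> / (C * j\<^sup>2) * (L2_norm f)\<^sup>2 \<le> (\<Sum>\<^sub>\<infinity>k\<in>int_vectors. (cmod (L2_inner f (G k)))\<^sup>2)"
      unfolding S_def[symmetric] using C j by (simp add: pos_divide_le_eq mult.commute)
  qed
qed

end

section \<open>Obstruction at and above the critical density\<close>

text \<open>Up to a constant, the frame inequality for the part of \<open>L\<^sup>2\<close> represented by functions \<open>F\<close> of one variable.\<close>

definition gauss_shift_bounded :: "real \<Rightarrow> real \<Rightarrow> real \<Rightarrow> (complex \<Rightarrow> complex) \<Rightarrow> bool" where
  "gauss_shift_bounded a b M F \<longleftrightarrow> (\<forall>\<tau> L. finite L \<longrightarrow> L \<subseteq> rect_lattice a b \<longrightarrow>
     (\<Sum>l\<in>L. (cmod (F (l + \<tau>)))\<^sup>2 * exp (- pi * (cmod (l + \<tau>))\<^sup>2)) \<le> M * (\<Sum>\<^sub>\<infinity>l\<in>rect_lattice a b. (cmod (F l))\<^sup>2 * exp (- pi * (cmod l)\<^sup>2)))"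

lemma gauss_weight_le:
  fixes K \<gamma> :: real
  assumes "cmod F \<le> K * exp (\<gamma> * (cmod z)\<^sup>2)"
  shows "(cmod F)\<^sup>2 * exp (- pi * (cmod z)\<^sup>2) \<le> K\<^sup>2 * exp (- (pi - 2 * \<gamma>) * (cmod z)\<^sup>2)"
proof -
  have "(cmod F)\<^sup>2 \<le> (K * exp (\<gamma> * (cmod z)\<^sup>2))\<^sup>2" by (rule power_mono[OF assms]) simp
  then have "(cmod F)\<^sup>2 * exp (- pi * (cmod z)\<^sup>2) \<le> (K * exp (\<gamma> * (cmod z)\<^sup>2))\<^sup>2 * exp (- pi * (cmod z)\<^sup>2)"
    by (rule mult_right_mono) simp
  also have "\<dots> = K\<^sup>2 * exp (2 * (\<gamma> * (cmod z)\<^sup>2) + - pi * (cmod z)\<^sup>2)"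
    by (simp only: power_mult_distrib exp_add exp_double mult.assoc)
  also have "2 * (\<gamma> * (cmod z)\<^sup>2) + - pi * (cmod z)\<^sup>2 = - (pi - 2 * \<gamma>) * (cmod z)\<^sup>2"
    by (simp add: algebra_simps)
  finally show ?thesis .
qed

lemma gauss_weight_summable:
  fixes K \<gamma> :: real
  assumes ab: "a > 0" "b > 0" and \<gamma>: "\<gamma> < pi / 2" and F: "\<And>z. cmod (F z) \<le> K * exp (\<gamma> * (cmod z)\<^sup>2)"
  shows "(\<lambda>l. (cmod (F l))\<^sup>2 * exp (- pi * (cmod l)\<^sup>2)) summable_on rect_lattice a b"
proof (rule summable_on_comparison_test)
  show "(\<lambda>l. K\<^sup>2 * exp (- (pi - 2 * \<gamma>) * (cmod l)\<^sup>2)) summable_on rect_lattice a b"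
    by (intro summable_on_cmult_right rect_lattice_gauss_summable ab) (use \<gamma> in simp)
  show "(cmod (F l))\<^sup>2 * exp (- pi * (cmod l)\<^sup>2) \<le> K\<^sup>2 * exp (- (pi - 2 * \<gamma>) * (cmod l)\<^sup>2)" for l
    by (rule gauss_weight_le[OF F])
qed simp

text \<open>The common growth rate below \<open>pi / 2\<close> leaves a summable majorant
  \<open>q\<close> for the weighted squares. The right-hand side can thus be cut to a finite set
  \<open>T\<close> uniformly in \<open>n\<close>; the left-hand side is finite anyway, so pointwise
  limits suffice.\<close>

lemma gauss_shift_bounded_limit:
  fixes Fn :: "nat \<Rightarrow> complex \<Rightarrow> complex" and K \<gamma> :: real
  assumes ab: "a > 0" "b > 0" and M: "M \<ge> 0" and \<gamma>: "\<gamma> < pi / 2"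
    and dom: "\<And>n z. cmod (Fn n z) \<le> K * exp (\<gamma> * (cmod z)\<^sup>2)"
    and lim: "\<And>z. (\<lambda>n. Fn n z) \<longlonglongrightarrow> F z" and bounded: "\<And>n. gauss_shift_bounded a b M (Fn n)"
  shows "gauss_shift_bounded a b M F"
  unfolding gauss_shift_bounded_def
proof (intro allI impI)
  fix \<tau> L assume L: "finite L" "L \<subseteq> rect_lattice a b"
  define W where "W f l = (cmod (f l))\<^sup>2 * exp (- pi * (cmod l)\<^sup>2)" for f :: "complex \<Rightarrow> complex" and l
  define q where "q l = K\<^sup>2 * exp (- (pi - 2 * \<gamma>) * (cmod l)\<^sup>2)" for l :: complex
  have q: "q summable_on rect_lattice a b"
    unfolding q_def by (intro summable_on_cmult_right rect_lattice_gauss_summable ab) (use \<gamma> in simp)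
  have domF: "cmod (F z) \<le> K * exp (\<gamma> * (cmod z)\<^sup>2)" for z
    by (rule LIMSEQ_le_const2[OF tendsto_norm[OF lim]]) (use dom in auto)
  have Wn: "W (Fn n) summable_on rect_lattice a b" and WF: "W F summable_on rect_lattice a b" for n
    unfolding W_def using gauss_weight_summable[OF ab \<gamma> dom] gauss_weight_summable[OF ab \<gamma> domF] by auto
  have Wq: "W (Fn n) l \<le> q l" for n l unfolding W_def q_def by (rule gauss_weight_le[OF dom])
  have Wlim: "(\<lambda>n. W (Fn n) l) \<longlonglongrightarrow> W F l" for l
    unfolding W_def by (intro tendsto_intros lim)
  have W0: "W f l \<ge> 0" for f l by (simp add: W_def)
  have key: "(\<Sum>l\<in>L. W F (l + \<tau>)) \<le> M * infsum (W F) (rect_lattice a b) + M * \<delta>" if \<delta>: "\<delta> > 0" for \<delta>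
  proof -
    have "(sum q \<longlongrightarrow> infsum q (rect_lattice a b)) (finite_subsets_at_top (rect_lattice a b))"
      using has_sum_infsum[OF q] by (simp add: has_sum_def)
    then have "\<forall>\<^sub>F T in finite_subsets_at_top (rect_lattice a b). dist (sum q T) (infsum q (rect_lattice a b)) < \<delta>"
      using \<delta> by (rule tendstoD)
    then obtain T where T: "finite T" "T \<subseteq> rect_lattice a b" "dist (sum q T) (infsum q (rect_lattice a b)) < \<delta>"
      unfolding eventually_finite_subsets_at_top by blast
    have tail: "infsum q (rect_lattice a b - T) \<le> \<delta>"
      using T infsum_Diff[OF q _ T(2)] by (auto simp: dist_real_def)
    have "(\<Sum>l\<in>L. W (Fn n) (l + \<tau>)) \<le> M * ((\<Sum>l\<in>T. W (Fn n) l) + \<delta>)" for n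
    proof -
      have "infsum (W (Fn n)) (rect_lattice a b) = sum (W (Fn n)) T + infsum (W (Fn n)) (rect_lattice a b - T)"
        using infsum_Diff[OF Wn _ T(2)] T(1) by simp
      also have "infsum (W (Fn n)) (rect_lattice a b - T) \<le> infsum q (rect_lattice a b - T)"
        by (intro infsum_mono summable_on_subset_banach[OF q] summable_on_subset_banach[OF Wn] Wq) auto
      finally have "infsum (W (Fn n)) (rect_lattice a b) \<le> (\<Sum>l\<in>T. W (Fn n) l) + \<delta>" using tail by simp
      then have "M * infsum (W (Fn n)) (rect_lattice a b) \<le> M * ((\<Sum>l\<in>T. W (Fn n) l) + \<delta>)"
        using M by (rule mult_left_mono)
      moreover have "(\<Sum>l\<in>L. W (Fn n) (l + \<tau>)) \<le> M * infsum (W (Fn n)) (rect_lattice a b)"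
        using bounded[of n] L unfolding gauss_shift_bounded_def W_def by simp
      ultimately show ?thesis by linarith
    qed
    moreover have "(\<lambda>n. \<Sum>l\<in>L. W (Fn n) (l + \<tau>)) \<longlonglongrightarrow> (\<Sum>l\<in>L. W F (l + \<tau>))"
      by (intro tendsto_sum Wlim)
    moreover have "(\<lambda>n. M * ((\<Sum>l\<in>T. W (Fn n) l) + \<delta>)) \<longlonglongrightarrow> M * ((\<Sum>l\<in>T. W F l) + \<delta>)"
      by (intro tendsto_intros Wlim)
    ultimately have "(\<Sum>l\<in>L. W F (l + \<tau>)) \<le> M * ((\<Sum>l\<in>T. W F l) + \<delta>)"
      by (intro LIMSEQ_le) auto
    also have "\<dots> \<le> M * (infsum (W F) (rect_lattice a b) + \<delta>)"
      using M T W0 by (intro mult_left_mono add_right_mono finite_sum_le_infsum WF) auto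
    finally show ?thesis by (simp add: distrib_left)
  qed
  have "(\<Sum>l\<in>L. W F (l + \<tau>)) \<le> M * infsum (W F) (rect_lattice a b)"
  proof (rule field_le_epsilon)
    fix e :: real assume e: "e > 0"
    \<comment> \<open>The denominator \<open>M + 1\<close> covers the case
      \<open>M = 0\<close>.\<close>
    have "M * (e / (M + 1)) \<le> e" using M e by (simp add: pos_divide_le_eq mult.commute)
    then show "(\<Sum>l\<in>L. W F (l + \<tau>)) \<le> M * infsum (W F) (rect_lattice a b) + e"
      using key[of "e / (M + 1)"] M e by simp
  qed
  then show "(\<Sum>l\<in>L. (cmod (F (l + \<tau>)))\<^sup>2 * exp (- pi * (cmod (l + \<tau>))\<^sup>2)) \<le> M * (\<Sum>\<^sub>\<infinity>l\<in>rect_lattice a b. (cmod (F l))\<^sup>2 * exp (- pi * (cmod l)\<^sup>2))"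
    unfolding W_def .
qed

text \<open>The monomial \<open>z\<close> is the limit of \<open>(exp (h * z) - 1) / h\<close> for
  \<open>h\<close> tending to 0, and a polynomial in this quotient is an exponential sum.\<close>

lemma gauss_shift_bounded_polynomial:
  fixes d :: "nat \<Rightarrow> complex"
  assumes ab: "a > 0" "b > 0" and M: "M \<ge> 0"
    and exps: "\<And>n c w. gauss_shift_bounded a b M (\<lambda>z. \<Sum>j\<le>(n::nat). c j * exp (w j * z))"
  shows "gauss_shift_bounded a b M (\<lambda>z. \<Sum>n\<le>N. d n * z ^ n)"
proof -
  define h where "h m = (1 / of_nat (Suc m) :: complex)" for m :: nat
  have hnz: "h m \<noteq> 0" for m by (simp add: h_def del: of_nat_Suc)
  have hnorm: "cmod (h m) = 1 / (real m + 1)" for m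
    unfolding h_def norm_divide norm_of_nat by simp
  have h1: "cmod (h m) \<le> 1" for m by (simp add: hnorm)
  define E where "E m z = (exp (h m * z) - 1) / h m" for m z
  have Ebound: "cmod (E m z) \<le> exp (2 * cmod z)" for m z
  proof -
    have "cmod (exp (h m * z) - (\<Sum>i\<le>0. (h m * z) ^ i / fact i)) \<le> exp (cmod (h m * z)) * cmod (h m * z) ^ Suc 0 / fact 0"
      by (rule Taylor_exp_field)
    then have "cmod (exp (h m * z) - 1) \<le> exp (cmod (h m * z)) * (cmod (h m) * cmod z)" by (simp add: norm_mult)
    then have "cmod (E m z) \<le> exp (cmod (h m * z)) * (cmod (h m) * cmod z) / cmod (h m)"
      unfolding E_def norm_divide by (intro divide_right_mono) auto
    also have "\<dots> = exp (cmod (h m * z)) * cmod z" using hnz[of m] by simp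
    also have "\<dots> \<le> exp (cmod z) * exp (cmod z)"
    proof (intro mult_mono)
      show "exp (cmod (h m * z)) \<le> exp (cmod z)"
        using mult_right_mono[OF h1[of m], of "cmod z"] by (simp add: norm_mult)
      show "cmod z \<le> exp (cmod z)" using exp_ge_add_one_self[of "cmod z"] by linarith
    qed auto
    finally show ?thesis by (simp only: exp_double power2_eq_square)
  qed
  have Elim: "(\<lambda>m. E m z) \<longlonglongrightarrow> z" for z
  proof (rule LIM_zero_cancel)
    have le: "cmod (E m z - z) \<le> exp (cmod z) * (cmod z)\<^sup>2 * (1 / (real m + 1))" for m
    proof -
      have "cmod (exp (h m * z) - (\<Sum>i\<le>1. (h m * z) ^ i / fact i)) \<le> exp (cmod (h m * z)) * cmod (h m * z) ^ Suc 1 / fact 1"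
        by (rule Taylor_exp_field)
      then have 1: "cmod (exp (h m * z) - 1 - h m * z) \<le> exp (cmod (h m * z)) * (cmod (h m * z))\<^sup>2"
        by (simp add: diff_diff_eq numeral_2_eq_2)
      have "E m z - z = (exp (h m * z) - 1 - h m * z) / h m" using hnz[of m] by (simp add: E_def diff_divide_distrib)
      then have "cmod (E m z - z) \<le> exp (cmod (h m * z)) * (cmod (h m * z))\<^sup>2 / cmod (h m)"
        using 1 by (simp add: norm_divide divide_right_mono)
      also have "\<dots> = exp (cmod (h m * z)) * (cmod z)\<^sup>2 * cmod (h m)"
        using hnz[of m] by (simp add: norm_mult power2_eq_square)
      also have "\<dots> \<le> exp (cmod z) * (cmod z)\<^sup>2 * cmod (h m)"
        using mult_right_mono[OF h1[of m], of "cmod z"] by (intro mult_right_mono) (auto simp: norm_mult)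
      finally show ?thesis by (simp add: hnorm)
    qed
    have "(\<lambda>m. exp (cmod z) * (cmod z)\<^sup>2 * (1 / (real m + 1))) \<longlonglongrightarrow> 0" by real_asymp
    then show "(\<lambda>m. E m z - z) \<longlonglongrightarrow> 0"
      by (rule Lim_null_comparison[OF always_eventually[OF allI[OF le]]])
  qed
  show ?thesis
  \<comment> \<open>Any rate below \<open>pi / 2\<close> would do; 1 is available because
    \<open>pi > 2\<close>. The constant \<open>exp (N^2)\<close> comes from
    \<open>2 N |z| \<le> N^2 + |z|^2\<close>.\<close>
  proof (rule gauss_shift_bounded_limit[OF ab M, of 1 _ "(\<Sum>n\<le>N. cmod (d n)) * exp ((real N)\<^sup>2)"])
    show "1 < pi / 2" using pi_gt3 by simp
    show "(\<lambda>m. \<Sum>n\<le>N. d n * E m z ^ n) \<longlonglongrightarrow> (\<Sum>n\<le>N. d n * z ^ n)" for z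
      by (intro tendsto_intros Elim)
    show "gauss_shift_bounded a b M (\<lambda>z. \<Sum>n\<le>N. d n * E m z ^ n)" for m
    proof -
      define q where "q = (\<Sum>n\<le>N. smult (d n / h m ^ n) ([:-1, 1:] ^ n))"
      have "(\<Sum>n\<le>N. d n * E m z ^ n) = poly q (exp (h m * z))" for z
        by (simp add: q_def poly_sum E_def power_divide)
      also have "\<dots> z = (\<Sum>j\<le>degree q. coeff q j * exp (of_nat j * h m * z))" for z
        by (simp add: poly_altdef mult.assoc exp_of_nat_mult)
      finally show ?thesis by (simp only: exps)
    qed
    show "cmod (\<Sum>n\<le>N. d n * E m z ^ n) \<le> (\<Sum>n\<le>N. cmod (d n)) * exp ((real N)\<^sup>2) * exp (1 * (cmod z)\<^sup>2)" for m z
    proof -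
      have "cmod (E m z ^ n) \<le> exp ((real N)\<^sup>2 + (cmod z)\<^sup>2)" if "n \<le> N" for n
      proof -
        have "cmod (E m z ^ n) \<le> exp (2 * cmod z) ^ n"
          unfolding norm_power by (intro power_mono Ebound) simp
        also have "\<dots> \<le> exp (2 * cmod z) ^ N" using that by (intro power_increasing) auto
        also have "\<dots> = exp (real N * (2 * cmod z))" by (simp add: exp_of_nat_mult)
        also have "\<dots> \<le> exp ((real N)\<^sup>2 + (cmod z)\<^sup>2)"
          using sum_squares_bound[of "real N" "cmod z"] by simp
        finally show ?thesis .
      qed
      then have "cmod (\<Sum>n\<le>N. d n * E m z ^ n) \<le> (\<Sum>n\<le>N. cmod (d n) * exp ((real N)\<^sup>2 + (cmod z)\<^sup>2))"
        by (intro sum_norm_le) (auto simp: norm_mult intro!: mult_left_mono)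
      then show ?thesis by (simp add: exp_add sum_distrib_right mult.assoc)
    qed
  qed
qed

text \<open>Taylor polynomials converge pointwise, but a common Gaussian majorant is required.
  Cauchy's estimate on the circle of radius \<open>s * r\<close> with \<open>s > 1\<close> bounds
  the terms by a geometric sequence at the price of a slightly larger rate.\<close>

lemma gauss_shift_bounded_entire:
  fixes K \<gamma> :: real
  assumes ab: "a > 0" "b > 0" and M: "M \<ge> 0"
    and exps: "\<And>n c w. gauss_shift_bounded a b M (\<lambda>z. \<Sum>j\<le>(n::nat). c j * exp (w j * z))"
    and hol: "F holomorphic_on UNIV" and \<gamma>: "0 < \<gamma>" "\<gamma> < pi / 2"
    and F: "\<And>z. cmod (F z) \<le> K * exp (\<gamma> * (cmod z)\<^sup>2)"
  shows "gauss_shift_bounded a b M F"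
proof -
  define d where "d n = (deriv ^^ n) F 0 / fact n" for n
  define \<gamma>' where "\<gamma>' = (\<gamma> + pi / 2) / 2"
  \<comment> \<open>Chosen so that \<open>\<gamma> * s^2 = \<gamma>'\<close>, where
    \<open>\<gamma>'\<close> is the midpoint between \<open>\<gamma>\<close> and
    \<open>pi / 2\<close>.\<close>
  define s where "s = sqrt (\<gamma>' / \<gamma>)"
  have \<gamma>': "\<gamma> < \<gamma>'" "\<gamma>' < pi / 2" using \<gamma> by (auto simp: \<gamma>'_def)
  have s: "s > 1" "\<gamma> * s\<^sup>2 = \<gamma>'" using \<gamma> \<gamma>' by (auto simp: s_def)
  have K: "K \<ge> 0" using order_trans[OF norm_ge_zero F[of 0]] by simp
  have coeff: "cmod (d n) * r ^ n \<le> K * exp (\<gamma>' * r\<^sup>2) * (1 / s) ^ n" if "r \<ge> 0" for n r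
  proof (cases "r = 0")
    case True
    have "cmod (d 0) \<le> K" using F[of 0] by (simp add: d_def)
    then show ?thesis using True K s by (cases n) auto
  next
    case False
    then have r: "r > 0" using that by simp
    have "cmod ((deriv ^^ n) F 0) \<le> fact n * (K * exp (\<gamma> * (s * r)\<^sup>2)) / (s * r) ^ n"
    proof (rule Cauchy_inequality)
      show "F holomorphic_on ball 0 (s * r)" "continuous_on (cball 0 (s * r)) F"
        using hol holomorphic_on_subset holomorphic_on_imp_continuous_on by blast+
      show "0 < s * r" using s r by simp
      show "cmod (F x) \<le> K * exp (\<gamma> * (s * r)\<^sup>2)" if "cmod (0 - x) = s * r" for x
        using F[of x] that by simp
    qed
    then have "cmod (d n) \<le> K * exp (\<gamma> * (s * r)\<^sup>2) / (s * r) ^ n"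
      unfolding d_def norm_divide by (simp add: pos_divide_le_eq mult.commute)
    then have "cmod (d n) * r ^ n \<le> K * exp (\<gamma> * (s * r)\<^sup>2) / (s * r) ^ n * r ^ n"
      using r by (intro mult_right_mono) auto
    also have "\<dots> = K * exp (\<gamma> * (s * r)\<^sup>2) * (1 / s) ^ n"
      using r by (simp add: power_mult_distrib power_one_over)
    also have "\<gamma> * (s * r)\<^sup>2 = \<gamma>' * r\<^sup>2" using s(2) by (simp add: power_mult_distrib mult.assoc[symmetric])
    finally show ?thesis .
  qed
  show ?thesis
  proof (rule gauss_shift_bounded_limit[OF ab M \<gamma>'(2), of _ "K * (1 / (1 - 1 / s))"])
    show "gauss_shift_bounded a b M (\<lambda>z. \<Sum>n\<le>N. d n * z ^ n)" for N
      by (rule gauss_shift_bounded_polynomial[OF ab M exps])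
    show "(\<lambda>N. \<Sum>n\<le>N. d n * z ^ n) \<longlonglongrightarrow> F z" for z
    proof -
      have "(\<lambda>n. (deriv ^^ n) F 0 / fact n * (z - 0) ^ n) sums F z"
        by (rule holomorphic_power_series[where r = "cmod z + 1"]) (use hol holomorphic_on_subset in auto)
      then show ?thesis by (simp add: sums_def_le d_def)
    qed
    show "cmod (\<Sum>n\<le>N. d n * z ^ n) \<le> K * (1 / (1 - 1 / s)) * exp (\<gamma>' * (cmod z)\<^sup>2)" for N z
    proof -
      have "cmod (\<Sum>n\<le>N. d n * z ^ n) \<le> (\<Sum>n\<le>N. K * exp (\<gamma>' * (cmod z)\<^sup>2) * (1 / s) ^ n)"
        using coeff[of "cmod z"] by (intro sum_norm_le) (simp add: norm_mult norm_power)
      also have "\<dots> = K * exp (\<gamma>' * (cmod z)\<^sup>2) * (\<Sum>n\<le>N. (1 / s) ^ n)" by (simp add: sum_distrib_left)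
      also have "\<dots> \<le> K * exp (\<gamma>' * (cmod z)\<^sup>2) * (1 / (1 - 1 / s))"
      proof (rule mult_left_mono)
        have "(\<Sum>n\<le>N. (1 / s) ^ n) \<le> suminf (\<lambda>n. (1 / s) ^ n)"
          by (rule sum_le_suminf) (use s in \<open>auto intro!: summable_geometric\<close>)
        also have "\<dots> = 1 / (1 - 1 / s)" by (rule suminf_geometric) (use s in simp)
        finally show "(\<Sum>n\<le>N. (1 / s) ^ n) \<le> 1 / (1 - 1 / s)" .
      qed (use K in simp)
      finally show ?thesis by (simp only: mult_ac)
    qed
  qed
qed

text \<open>Above area 1 the lattice side vanishes for \<open>S\<close> and the shifted side does
  not. At area 1 put \<open>\<epsilon> = 1 - s\<close>: periodicity gives
  \<open>P (s * l) = P (- \<epsilon> * l)\<close>, which is at most a multiple of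
  \<open>\<epsilon> |l|\<close>. Together with the damping left by \<open>s < 1\<close>, the
  weighted lattice sum stays below a constant as \<open>s\<close> tends to 1. On the shifted side
  every term tends to the same positive number \<open>(P \<tau>)^2\<close>, and there are
  arbitrarily many terms.\<close>

lemma (in sigma_function) not_gauss_shift_bounded:
  assumes ab1: "a * b \<ge> 1" and M: "M \<ge> 0"
    and exps: "\<And>n c w. gauss_shift_bounded a b M (\<lambda>z. \<Sum>j\<le>(n::nat). c j * exp (w j * z))"
  shows False
proof -
  have "\<exists>B>0. \<forall>u. P u \<le> B" by (rule P_bounded) auto
  then obtain B where B: "B > 0" "\<And>u. P u \<le> B" by blast
  \<comment> \<open>Midpoint between two lattice points, hence not a zero of
    \<open>S\<close>.\<close>
  define \<tau> where "\<tau> = Complex (a / 2) 0"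
  have P\<tau>: "P \<tau> > 0"
  proof -
    have "\<tau> \<notin> rect_lattice a b"
    proof
      assume "\<tau> \<in> rect_lattice a b"
      then obtain m where "a / 2 = a * of_int m" by (auto simp: rect_lattice_def \<tau>_def)
      then have "real_of_int (2 * m) = of_int 1" using ab by simp
      then have "2 * m = 1" by (simp only: of_int_eq_iff)
      then show False by presburger
    qed
    then show ?thesis using P_eq_0[of \<tau>] P_nonneg[of \<tau>] by simp
  qed
  have S_le: "cmod (S u) \<le> B * exp (pi / (2 * a * b) * (cmod u)\<^sup>2)" for u
    unfolding S_eq by (intro mult_right_mono B) simp
  show False
  proof (cases "a * b > 1")
    case True
    have "gauss_shift_bounded a b M S"
    proof (rule gauss_shift_bounded_entire[OF ab M exps hol _ _ S_le])
      show "0 < pi / (2 * a * b)" using ab by simp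
      show "pi / (2 * a * b) < pi / 2" using True ab by (simp add: field_simps)
    qed
    then have "(\<Sum>l\<in>{0}. (cmod (S (l + \<tau>)))\<^sup>2 * exp (- pi * (cmod (l + \<tau>))\<^sup>2)) \<le> M * (\<Sum>\<^sub>\<infinity>l\<in>rect_lattice a b. (cmod (S l))\<^sup>2 * exp (- pi * (cmod l)\<^sup>2))"
      unfolding gauss_shift_bounded_def using rect_lattice_0 by blast
    also have "(\<Sum>\<^sub>\<infinity>l\<in>rect_lattice a b. (cmod (S l))\<^sup>2 * exp (- pi * (cmod l)\<^sup>2)) = 0"
      by (rule infsum_0) (simp add: zero)
    finally have "S \<tau> = 0" by (simp add: mult_le_0_iff)
    then show False using P\<tau> by (simp add: P_def)
  next
    case False
    then have ab_eq: "a * b = 1" using ab1 by simp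
    then have c: "pi / (2 * a * b) = pi / 2" by (simp add: mult.assoc)
    have lip: "\<exists>Q>0. \<forall>u. P u \<le> Q * cmod u"
    proof -
      have S0: "S 0 = 0" by (simp add: zero rect_lattice_0)
      have "continuous_on (cball 0 1) (deriv S)"
        by (rule continuous_on_subset[OF holomorphic_on_imp_continuous_on[OF holomorphic_deriv[OF hol open_UNIV]]]) simp
      then have "bounded (deriv S ` cball 0 1)"
        by (intro compact_imp_bounded compact_continuous_image compact_cball)
      then obtain Q where Q: "\<And>u. u \<in> cball 0 1 \<Longrightarrow> cmod (deriv S u) \<le> Q"
        unfolding bounded_iff by blast
      have "P u \<le> (\<bar>Q\<bar> + B) * cmod u" for u
      proof (cases "cmod u \<le> 1")
        case True
        have "cmod (S u - S 0) \<le> Q * cmod (u - 0)"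
          by (rule field_differentiable_bound[where S = "cball 0 1" and f' = "deriv S"])
            (use True Q in \<open>auto intro: has_field_derivative_at_within[OF S_deriv]\<close>)
        then have "cmod (S u) \<le> Q * cmod u" using S0 by simp
        moreover have "P u \<le> cmod (S u)" unfolding P_def using ab by (intro mult_left_le) auto
        moreover have "Q * cmod u \<le> (\<bar>Q\<bar> + B) * cmod u" using B(1) by (intro mult_right_mono) auto
        ultimately show ?thesis by linarith
      next
        case False
        have "B * 1 \<le> (\<bar>Q\<bar> + B) * cmod u" using False B(1) by (intro mult_mono) auto
        then show ?thesis using B(2)[of u] by simp
      qed
      moreover have "\<bar>Q\<bar> + B > 0" using B(1) by simp
      ultimately show ?thesis by blast
    qed
    then obtain Q where Q: "Q > 0" "\<And>u. P u \<le> Q * cmod u" by blast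
    define R0 where "R0 = Q\<^sup>2 * ((exp 1 * (2 + 1 / a)) * (exp 1 * (2 + 1 / b)))"
    have main: "(\<Sum>l\<in>L. (cmod (S (s * (l + \<tau>))))\<^sup>2 * exp (- pi * (cmod (l + \<tau>))\<^sup>2)) \<le> M * R0"
      if L: "finite L" "L \<subseteq> rect_lattice a b" and s: "0 < s" "s < 1" for L and s :: real
    proof -
      define \<epsilon> where "\<epsilon> = 1 - s"
      have \<epsilon>: "0 < \<epsilon>" "\<epsilon> < 1" using s by (auto simp: \<epsilon>_def)
      have growth: "cmod (S (of_real s * z)) \<le> B * exp (pi / 2 * s\<^sup>2 * (cmod z)\<^sup>2)" for z
        using S_le[of "of_real s * z"] unfolding c by (simp add: norm_mult power_mult_distrib mult.assoc)
      have \<gamma>: "pi / 2 * s\<^sup>2 < pi / 2" "0 < pi / 2 * s\<^sup>2" using s by (auto simp: power_less_one_iff)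
      have "gauss_shift_bounded a b M (\<lambda>z. S (of_real s * z))"
      proof (rule gauss_shift_bounded_entire[OF ab M exps _ \<gamma>(2,1) growth])
        show "(\<lambda>z. S (of_real s * z)) holomorphic_on UNIV"
          using holomorphic_on_compose_gen[OF _ hol, of "\<lambda>z. of_real s * z" UNIV] by (auto simp: o_def intro!: holomorphic_intros)
      qed
      then have "(\<Sum>l\<in>L. (cmod (S (of_real s * (l + \<tau>))))\<^sup>2 * exp (- pi * (cmod (l + \<tau>))\<^sup>2))
          \<le> M * (\<Sum>\<^sub>\<infinity>l\<in>rect_lattice a b. (cmod (S (of_real s * l)))\<^sup>2 * exp (- pi * (cmod l)\<^sup>2))"
        unfolding gauss_shift_bounded_def using L by blast
      also have "\<dots> \<le> M * R0"
      proof (intro mult_left_mono M infsum_le_finite_sums)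
        show "(\<lambda>l. (cmod (S (of_real s * l)))\<^sup>2 * exp (- pi * (cmod l)\<^sup>2)) summable_on rect_lattice a b"
          by (rule gauss_weight_summable[OF ab \<gamma>(1) growth])
        fix F assume F: "finite F" "F \<subseteq> rect_lattice a b"
        have "(cmod (S (of_real s * l)))\<^sup>2 * exp (- pi * (cmod l)\<^sup>2) \<le> Q\<^sup>2 * \<epsilon> * exp (- \<epsilon> * (cmod l)\<^sup>2)" if l: "l \<in> F" for l
        proof -
          have "P (of_real s * l) = P (of_real s * l - l)" using P_periodic'[of l] l F by auto
          also have "of_real s * l - l = of_real (- \<epsilon>) * l" by (simp add: \<epsilon>_def algebra_simps)
          also have "P (of_real (- \<epsilon>) * l) \<le> Q * (\<epsilon> * cmod l)" using Q(2)[of "of_real (- \<epsilon>) * l"] \<epsilon> by (simp add: norm_mult)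
          finally have "(P (of_real s * l))\<^sup>2 \<le> (Q * (\<epsilon> * cmod l))\<^sup>2" by (intro power_mono P_nonneg)
          moreover have "(cmod (S (of_real s * l)))\<^sup>2 * exp (- pi * (cmod l)\<^sup>2) = (P (of_real s * l))\<^sup>2 * exp (pi * (s\<^sup>2 - 1) * (cmod l)\<^sup>2)"
            unfolding S_eq c unfolding power_mult_distrib exp_double[symmetric] mult.assoc exp_add[symmetric]
            by (simp add: norm_mult power_mult_distrib algebra_simps)
          ultimately have "(cmod (S (of_real s * l)))\<^sup>2 * exp (- pi * (cmod l)\<^sup>2) \<le> (Q * (\<epsilon> * cmod l))\<^sup>2 * exp (pi * (s\<^sup>2 - 1) * (cmod l)\<^sup>2)"
            by (simp add: mult_right_mono)
          also have "\<dots> \<le> (Q * (\<epsilon> * cmod l))\<^sup>2 * exp (- (2 * \<epsilon>) * (cmod l)\<^sup>2)"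
          proof -
            \<comment> \<open>The damping rate is
              \<open>pi * (1 - s^2) = pi * \<epsilon> * (1 + s)\<close>. The rate
              \<open>2 * \<epsilon>\<close> is split below: one half absorbs the factor
              \<open>\<epsilon> |l|^2\<close>, the other remains for summation.\<close>
            have "2 * \<epsilon> \<le> 3 * \<epsilon> * (1 + s)" using \<epsilon> s by (simp add: mult_left_mono)
            also have "\<dots> \<le> pi * \<epsilon> * (1 + s)" using pi_gt3 \<epsilon> s by (intro mult_right_mono) auto
            also have "\<dots> = - (pi * (s\<^sup>2 - 1))" by (simp add: \<epsilon>_def power2_eq_square algebra_simps)
            finally have "pi * (s\<^sup>2 - 1) * (cmod l)\<^sup>2 \<le> - (2 * \<epsilon>) * (cmod l)\<^sup>2" by (intro mult_right_mono) auto
            then show ?thesis by (intro mult_left_mono) auto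
          qed
          also have "\<dots> = Q\<^sup>2 * \<epsilon> * ((\<epsilon> * (cmod l)\<^sup>2) * exp (- (2 * \<epsilon>) * (cmod l)\<^sup>2))"
            by (simp add: power_mult_distrib power2_eq_square mult_ac)
          also have "\<dots> \<le> Q\<^sup>2 * \<epsilon> * exp (- \<epsilon> * (cmod l)\<^sup>2)"
          proof -
            have "\<epsilon> * (cmod l)\<^sup>2 \<le> exp (\<epsilon> * (cmod l)\<^sup>2)" using exp_ge_add_one_self[of "\<epsilon> * (cmod l)\<^sup>2"] by linarith
            then have "(\<epsilon> * (cmod l)\<^sup>2) * exp (- (2 * \<epsilon>) * (cmod l)\<^sup>2) \<le> exp (\<epsilon> * (cmod l)\<^sup>2) * exp (- (2 * \<epsilon>) * (cmod l)\<^sup>2)"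
              by (intro mult_right_mono) auto
            also have "\<dots> = exp (- \<epsilon> * (cmod l)\<^sup>2)" unfolding exp_add[symmetric] by (simp add: algebra_simps)
            finally show ?thesis using \<epsilon> by (intro mult_left_mono) auto
          qed
          finally show ?thesis .
        qed
        then have "(\<Sum>l\<in>F. (cmod (S (of_real s * l)))\<^sup>2 * exp (- pi * (cmod l)\<^sup>2)) \<le> Q\<^sup>2 * \<epsilon> * (\<Sum>l\<in>F. exp (- \<epsilon> * (cmod l)\<^sup>2))"
          unfolding sum_distrib_left by (rule sum_mono)
        also have "\<dots> \<le> Q\<^sup>2 * \<epsilon> * ((exp 1 * (2 + 1 / sqrt (\<epsilon> * a\<^sup>2))) * (exp 1 * (2 + 1 / sqrt (\<epsilon> * b\<^sup>2))))"
          using \<epsilon> by (intro mult_left_mono rect_lattice_gauss_sum_bound ab F) auto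
        \<comment> \<open>The two one-dimensional sums each cost \<open>1 / sqrt \<epsilon>\<close>,
          which the surviving factor \<open>\<epsilon>\<close> compensates exactly. This is why the
          constant \<open>R0\<close> is independent of \<open>s\<close>.\<close>
        also have "\<dots> \<le> Q\<^sup>2 * \<epsilon> * ((exp 1 * ((2 + 1 / a) / sqrt \<epsilon>)) * (exp 1 * ((2 + 1 / b) / sqrt \<epsilon>)))"
        proof -
          have "2 + 1 / sqrt (\<epsilon> * x\<^sup>2) \<le> (2 + 1 / x) / sqrt \<epsilon>" if x: "x > 0" for x
          proof -
            have "2 \<le> 2 / sqrt \<epsilon>" using \<epsilon> by (simp add: le_divide_eq)
            moreover have "1 / sqrt (\<epsilon> * x\<^sup>2) = 1 / x / sqrt \<epsilon>" using x by (simp add: real_sqrt_mult)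
            ultimately show ?thesis by (simp add: add_divide_distrib)
          qed
          then show ?thesis using \<epsilon> ab by (intro mult_left_mono mult_mono) auto
        qed
        also have "\<dots> = R0"
        proof -
          have "sqrt \<epsilon> * sqrt \<epsilon> = \<epsilon>" using \<epsilon> by simp
          then show ?thesis unfolding R0_def using \<epsilon> by (simp add: field_simps)
        qed
        finally show "(\<Sum>l\<in>F. (cmod (S (of_real s * l)))\<^sup>2 * exp (- pi * (cmod l)\<^sup>2)) \<le> R0" .
      qed
      finally show ?thesis .
    qed
    have card: "real (card L) * (P \<tau>)\<^sup>2 \<le> M * R0" if L: "finite L" "L \<subseteq> rect_lattice a b" for L
    proof -
      have "((\<lambda>s. \<Sum>l\<in>L. (cmod (S (of_real s * (l + \<tau>))))\<^sup>2 * exp (- pi * (cmod (l + \<tau>))\<^sup>2))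
          \<longlongrightarrow> (\<Sum>l\<in>L. (cmod (S (of_real 1 * (l + \<tau>))))\<^sup>2 * exp (- pi * (cmod (l + \<tau>))\<^sup>2))) (at_left 1)"
        by (intro tendsto_intros isCont_tendsto_compose[of _ S]) (use cont[of UNIV] in \<open>auto simp: continuous_on_eq_continuous_at\<close>)
      moreover have "\<forall>\<^sub>F s in at_left (1::real). (\<Sum>l\<in>L. (cmod (S (of_real s * (l + \<tau>))))\<^sup>2 * exp (- pi * (cmod (l + \<tau>))\<^sup>2)) \<le> M * R0"
        by (rule eventually_mono[OF eventually_at_left_real[OF zero_less_one]]) (use main[OF L] in auto)
      ultimately have "(\<Sum>l\<in>L. (cmod (S (of_real 1 * (l + \<tau>))))\<^sup>2 * exp (- pi * (cmod (l + \<tau>))\<^sup>2)) \<le> M * R0"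
        by (rule tendsto_upperbound) simp
      moreover have "(cmod (S (of_real 1 * (l + \<tau>))))\<^sup>2 * exp (- pi * (cmod (l + \<tau>))\<^sup>2) = (P \<tau>)\<^sup>2" if "l \<in> L" for l
      proof -
        have "(P (\<tau> + l))\<^sup>2 = (cmod (S (of_real 1 * (l + \<tau>))))\<^sup>2 * exp (- pi * (cmod (l + \<tau>))\<^sup>2)"
          unfolding P_def power_mult_distrib exp_double[symmetric] by (simp add: add.commute ab_eq mult.assoc)
        then show ?thesis using P_periodic[of l \<tau>] that L by auto
      qed
      ultimately show ?thesis by simp
    qed
    obtain n :: nat where n: "M * R0 < real n * (P \<tau>)\<^sup>2" using reals_Archimedean3[of "(P \<tau>)\<^sup>2"] P\<tau> by auto
    \<comment> \<open>The points of one row suffice, as only the number of terms matters.\<close>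
    define L where "L = (\<lambda>m::nat. Complex (a * of_int (int m)) (b * of_int 0)) ` {..<n}"
    have "L \<subseteq> rect_lattice a b" unfolding L_def by (intro image_subsetI rect_latticeI)
    moreover have "card L = n" unfolding L_def using ab by (subst card_image) (auto simp: inj_on_def)
    ultimately show False using card[of L] n by (simp add: L_def)
  qed
qed

section \<open>From the lower frame bound to an inequality for exponential sums\<close>

context coherent_system
begin

text \<open>A real index, in general not an integer vector, whose phase space point has the complex
  coordinate \<open>w\<close> in direction \<open>i0\<close> and 0 in all others. It serves both for
  coherent states and for shifts.\<close>

definition axis_vector :: "'d \<Rightarrow> complex \<Rightarrow> real ^ ('d + 'd)" where
  "axis_vector i0 w = (\<chi> j. case j of Inl i \<Rightarrow> if i = i0 then Re w / al i0 else 0 | Inr i \<Rightarrow> if i = i0 then - Im w / be i0 else 0)"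

lemma u_axis_vector: "u (axis_vector i0 w) i = (if i = i0 then w else 0)"
  using nz by (simp add: phase_coord_def axis_vector_def complex_eq_iff)

lemma \<theta>_nz: "\<theta> k \<noteq> 0"
  using \<theta>_norm[of k] by auto

text \<open>By the kernel formula the coherent state at the axis point \<open>cnj w / pi\<close> has
  the samples \<open>exp (w * u k i0)\<close>, up to \<open>\<theta>\<close> factors. Linear
  combinations realise every exponential sum in one coordinate.\<close>

lemma exponential_samples:
  fixes co w :: "nat \<Rightarrow> complex"
  obtains f where "f \<in> L2" "\<And>k. L2_inner f (G k) = of_real c * \<theta> k * (\<Sum>j\<le>n. co j * exp (w j * u k i0))"
proof -
  define v where "v j = axis_vector i0 (cnj (w j) / of_real pi)" for j
  define f where "f = (\<lambda>t. \<Sum>j\<le>n. (co j / cnj (\<theta> (v j))) * G (v j) t)"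
  show ?thesis
  proof
    show "f \<in> L2" unfolding f_def by (intro L2_sum G_L2)
    fix k
    have "(\<Sum>i\<in>UNIV. u k i * cnj (u (v j) i)) = u k i0 * (w j / of_real pi)" for j
    proof -
      have "(\<Sum>i\<in>UNIV. u k i * cnj (u (v j) i)) = (\<Sum>i\<in>UNIV. if i = i0 then u k i0 * (w j / of_real pi) else 0)"
        unfolding v_def u_axis_vector by (intro sum.cong) auto
      then show ?thesis by simp
    qed
    then have ker: "L2_inner (G (v j)) (G k) = of_real c * \<theta> k * cnj (\<theta> (v j)) * exp (w j * u k i0)" for j
      unfolding kernel by (simp add: mult.commute[of "w j"])
    have "L2_inner f (G k) = (\<Sum>j\<le>n. (co j / cnj (\<theta> (v j))) * L2_inner (G (v j)) (G k))"
      unfolding f_def by (rule L2_inner_sum_left) (rule G_L2)+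
    also have "\<dots> = (\<Sum>j\<le>n. of_real c * \<theta> k * (co j * exp (w j * u k i0)))"
      unfolding ker using \<theta>_nz by (intro sum.cong) auto
    finally show "L2_inner f (G k) = of_real c * \<theta> k * (\<Sum>j\<le>n. co j * exp (w j * u k i0))"
      by (simp add: sum_distrib_left)
  qed
qed

text \<open>The redundant factor 1 is the growth rate, kept to match the shape required by
  \<open>gauss_weight_summable\<close>.\<close>

lemma exponential_sum_growth:
  fixes co w :: "nat \<Rightarrow> complex"
  shows "cmod (\<Sum>j\<le>n. co j * exp (w j * z)) \<le> (\<Sum>j\<le>n. cmod (co j) * exp ((cmod (w j))\<^sup>2)) * exp (1 * (cmod z)\<^sup>2)"
proof -
  have "cmod (co j * exp (w j * z)) \<le> cmod (co j) * exp ((cmod (w j))\<^sup>2) * exp (1 * (cmod z)\<^sup>2)" for j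
  proof -
    have "Re (w j * z) \<le> cmod (w j) * cmod z" using complex_Re_le_cmod[of "w j * z"] by (simp add: norm_mult)
    also have "\<dots> \<le> (cmod (w j))\<^sup>2 + 1 * (cmod z)\<^sup>2"
      using sum_squares_bound[of "cmod (w j)" "cmod z"] mult_nonneg_nonneg[OF norm_ge_zero[of "w j"] norm_ge_zero[of z]] by linarith
    finally have "exp (Re (w j * z)) \<le> exp ((cmod (w j))\<^sup>2) * exp (1 * (cmod z)\<^sup>2)" by (simp only: exp_le_cancel_iff flip: exp_add)
    then show ?thesis unfolding norm_mult norm_exp_eq_Re mult.assoc by (intro mult_left_mono) auto
  qed
  then have "cmod (\<Sum>j\<le>n. co j * exp (w j * z)) \<le> (\<Sum>j\<le>n. cmod (co j) * exp ((cmod (w j))\<^sup>2) * exp (1 * (cmod z)\<^sup>2))"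
    by (intro sum_norm_le) auto
  then show ?thesis by (simp only: sum_distrib_right)
qed

text \<open>For \<open>f\<close> built from one coordinate, the samples factor into a planar weight
  \<open>W\<close> and plain Gaussians in the other coordinates. The frame bound estimates the norm
  of \<open>f\<close> by the full lattice sum, which produces the constant \<open>Q\<close> of the
  other coordinates. The Bessel bound for the shifted lattice estimates the shifted planar sum by
  the same norm.\<close>

lemma frame_imp_gauss_shift_bounded:
  assumes C1: "C1 > 0" "\<And>f. f \<in> L2 \<Longrightarrow> C1 * (L2_norm f)\<^sup>2 \<le> (\<Sum>\<^sub>\<infinity>k\<in>int_vectors. (cmod (L2_inner f (G k)))\<^sup>2)"
  obtains M where "M \<ge> 0" "\<And>(n::nat) co w. gauss_shift_bounded \<bar>al i0\<bar> \<bar>be i0\<bar> M (\<lambda>z. \<Sum>j\<le>n. co j * exp (w j * z))"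
proof -
  obtain M where M: "M > 0"
    "\<And>t f F. f \<in> L2 \<Longrightarrow> finite F \<Longrightarrow> F \<subseteq> int_vectors \<Longrightarrow> (\<Sum>k\<in>F. (cmod (L2_inner f (G (k + t))))\<^sup>2) \<le> M * (L2_norm f)\<^sup>2"
    using bessel by blast
  obtain M2 where summ: "\<And>f. f \<in> L2 \<Longrightarrow> (\<lambda>k. (cmod (L2_inner f (G k)))\<^sup>2) summable_on int_vectors"
    using frame_upper_bound by blast
  define Mg where "Mg i = (\<Sum>\<^sub>\<infinity>l\<in>Lam i. exp (- pi * (cmod l)\<^sup>2))" for i
  have Mg: "(\<Sum>l\<in>F. exp (- pi * (cmod l)\<^sup>2)) \<le> Mg i" if "finite F" "F \<subseteq> Lam i" for i F
    unfolding Mg_def using that by (intro finite_sum_le_infsum rect_lattice_gauss_summable pos) auto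
  have Mg0: "Mg i \<ge> 0" for i unfolding Mg_def by (intro infsum_nonneg) auto
  define Q where "Q = (\<Prod>i\<in>UNIV - {i0}. Mg i)"
  have Q: "Q \<ge> 0" unfolding Q_def by (intro prod_nonneg) (auto simp: Mg0)
  show ?thesis
  proof
    show "M / C1 * Q \<ge> 0" using M C1 Q by simp
    fix n :: nat and co w :: "nat \<Rightarrow> complex"
    define F where "F z = (\<Sum>j\<le>n. co j * exp (w j * z))" for z
    define W where "W l = (cmod (F l))\<^sup>2 * exp (- pi * (cmod l)\<^sup>2)" for l
    have Wsum: "W summable_on Lam i0"
      unfolding W_def F_def by (rule gauss_weight_summable[OF pos _ exponential_sum_growth]) (use pi_gt3 in simp)
    obtain f where f: "f \<in> L2" "\<And>k. L2_inner f (G k) = of_real c * \<theta> k * F (u k i0)"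
      using exponential_samples[where n = n and co = co and w = w and ?i0.0 = i0] unfolding F_def by metis
    have sample: "(cmod (L2_inner f (G k)))\<^sup>2 = c\<^sup>2 * (\<Prod>i\<in>UNIV. if i = i0 then W (u k i) else exp (- pi * (cmod (u k i))\<^sup>2))" for k
    proof -
      have "(cmod (L2_inner f (G k)))\<^sup>2 = c\<^sup>2 * ((cmod (\<theta> k))\<^sup>2 * (cmod (F (u k i0)))\<^sup>2)"
        unfolding f(2) norm_mult norm_of_real by (simp add: power_mult_distrib)
      also have "(cmod (\<theta> k))\<^sup>2 = (\<Prod>i\<in>UNIV. exp (- pi * (cmod (u k i))\<^sup>2))"
        unfolding \<theta>_norm exp_double[symmetric] by (simp add: exp_sum[symmetric] sum_distrib_left)
      also have "\<dots> * (cmod (F (u k i0)))\<^sup>2 = W (u k i0) * (\<Prod>i\<in>UNIV - {i0}. exp (- pi * (cmod (u k i))\<^sup>2))"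
        unfolding W_def by (subst prod.remove[of _ i0]) auto
      also have "\<dots> = (\<Prod>i\<in>UNIV. if i = i0 then W (u k i) else exp (- pi * (cmod (u k i))\<^sup>2))"
        by (subst prod.remove[of UNIV i0]) (auto intro!: prod.cong)
      finally show ?thesis .
    qed
    have upper: "(\<Sum>\<^sub>\<infinity>k\<in>int_vectors. (cmod (L2_inner f (G k)))\<^sup>2) \<le> c\<^sup>2 * (infsum W (Lam i0) * Q)"
    proof (rule infsum_le_finite_sums[OF summ[OF f(1)]])
      fix F' :: "(real ^ ('d + 'd)) set" assume F': "finite F'" "F' \<subseteq> int_vectors"
      have "(\<Sum>k\<in>F'. \<Prod>i\<in>UNIV. if i = i0 then W (u k i) else exp (- pi * (cmod (u k i))\<^sup>2))
          \<le> (\<Prod>i\<in>UNIV. if i = i0 then infsum W (Lam i0) else Mg i)"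
      proof (rule sum_prod_bound[OF _ _ F'])
        show "(if i = i0 then W l else exp (- pi * (cmod l)\<^sup>2)) \<ge> 0" for i l by (simp add: W_def)
        show "(\<Sum>l\<in>B. if i = i0 then W l else exp (- pi * (cmod l)\<^sup>2)) \<le> (if i = i0 then infsum W (Lam i0) else Mg i)"
          if "finite B" "B \<subseteq> Lam i" for i B
          using that Mg finite_sum_le_infsum[OF Wsum, of B] by (auto simp: W_def)
      qed
      also have "\<dots> = infsum W (Lam i0) * Q"
        unfolding Q_def by (subst prod.remove[of UNIV i0]) (auto intro!: prod.cong)
      finally show "(\<Sum>k\<in>F'. (cmod (L2_inner f (G k)))\<^sup>2) \<le> c\<^sup>2 * (infsum W (Lam i0) * Q)"
        unfolding sample sum_distrib_left[symmetric] by (rule mult_left_mono) simp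
    qed
    show "gauss_shift_bounded \<bar>al i0\<bar> \<bar>be i0\<bar> (M / C1 * Q) (\<lambda>z. \<Sum>j\<le>n. co j * exp (w j * z))"
      unfolding gauss_shift_bounded_def
    proof (intro allI impI)
      fix \<tau> L assume L: "finite L" "L \<subseteq> Lam i0"
      \<comment> \<open>Lattice indices whose other coordinates vanish. On the Bessel side this
        subfamily suffices, because the remaining terms are nonnegative.\<close>
      define kk where "kk l = inv_into int_vectors (\<lambda>k i. u k i) (\<lambda>i. if i = i0 then l else 0)" for l
      have mem: "(\<lambda>i. if i = i0 then l else 0) \<in> (\<lambda>k i. u k i) ` int_vectors" if "l \<in> L" for l
        using that L bij_betw_imp_surj_on[OF lattice_bij] by (auto simp: rect_lattice_0)
      have kk: "kk l \<in> int_vectors" "u (kk l) i = (if i = i0 then l else 0)" if "l \<in> L" for l i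
        unfolding kk_def by (rule inv_into_into[OF mem[OF that]], rule fun_cong[OF f_inv_into_f[OF mem[OF that]]])
      have inj: "inj_on kk L"
      proof (rule inj_onI)
        fix l l' assume ll: "l \<in> L" "l' \<in> L" and eq: "kk l = kk l'"
        have "l = u (kk l) i0" by (simp only: kk(2)[OF ll(1)] refl if_True)
        also have "\<dots> = l'" unfolding eq by (simp only: kk(2)[OF ll(2)] refl if_True)
        finally show "l = l'" .
      qed
      have term_eq: "(cmod (L2_inner f (G (kk l + axis_vector i0 \<tau>))))\<^sup>2 = c\<^sup>2 * W (l + \<tau>)" if "l \<in> L" for l
      proof -
        have uk: "u (kk l + axis_vector i0 \<tau>) i = (if i = i0 then l + \<tau> else 0)" for i
          using kk(2)[OF that] by (simp add: u_add u_axis_vector)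
        have "(\<Prod>i\<in>UNIV. if i = i0 then W (if i = i0 then l + \<tau> else 0) else exp (- pi * (cmod (if i = i0 then l + \<tau> else 0))\<^sup>2)) = (\<Prod>i\<in>UNIV. if i = i0 then W (l + \<tau>) else 1)"
          by (intro prod.cong) auto
        then show ?thesis unfolding sample uk by simp
      qed
      have "c\<^sup>2 * (\<Sum>l\<in>L. W (l + \<tau>)) = (\<Sum>k\<in>kk ` L. (cmod (L2_inner f (G (k + axis_vector i0 \<tau>))))\<^sup>2)"
        unfolding sum.reindex[OF inj] o_def sum_distrib_left by (intro sum.cong) (auto simp: term_eq)
      also have "\<dots> \<le> M * (L2_norm f)\<^sup>2"
        using L kk(1) by (intro M(2) f) auto
      also have "\<dots> = M / C1 * (C1 * (L2_norm f)\<^sup>2)" using C1(1) by simp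
      also have "\<dots> \<le> M / C1 * (c\<^sup>2 * (infsum W (Lam i0) * Q))"
        using M(1) C1(1) order_trans[OF C1(2)[OF f(1)] upper] by (intro mult_left_mono) auto
      also have "\<dots> = c\<^sup>2 * (M / C1 * Q * infsum W (Lam i0))" by (simp only: mult_ac)
      finally have "(\<Sum>l\<in>L. W (l + \<tau>)) \<le> M / C1 * Q * infsum W (Lam i0)"
        using c by (simp only: mult_le_cancel_left_pos zero_less_power)
      then show "(\<Sum>l\<in>L. (cmod (\<Sum>j\<le>n. co j * exp (w j * (l + \<tau>))))\<^sup>2 * exp (- pi * (cmod (l + \<tau>))\<^sup>2))
          \<le> M / C1 * Q * (\<Sum>\<^sub>\<infinity>l\<in>Lam i0. (cmod (\<Sum>j\<le>n. co j * exp (w j * l)))\<^sup>2 * exp (- pi * (cmod l)\<^sup>2))"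
        unfolding W_def F_def .
    qed
  qed
qed

lemma frame_necessity:
  assumes C1: "C1 > 0" "\<And>f. f \<in> L2 \<Longrightarrow> C1 * (L2_norm f)\<^sup>2 \<le> (\<Sum>\<^sub>\<infinity>k\<in>int_vectors. (cmod (L2_inner f (G k)))\<^sup>2)"
  shows "\<bar>al i * be i\<bar> < 1"
proof (rule ccontr)
  assume "\<not> \<bar>al i * be i\<bar> < 1"
  then have ge: "\<bar>al i\<bar> * \<bar>be i\<bar> \<ge> 1" by (simp add: abs_mult)
  obtain M where M: "M \<ge> 0" "\<And>(n::nat) co w. gauss_shift_bounded \<bar>al i\<bar> \<bar>be i\<bar> M (\<lambda>z. \<Sum>j\<le>n. co j * exp (w j * z))"
    using frame_imp_gauss_shift_bounded[OF C1, of i] by metis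
  obtain S where "sigma_function \<bar>al i\<bar> \<bar>be i\<bar> S" using sigma_function_obtain[OF pos] by blast
  then show False by (rule sigma_function.not_gauss_shift_bounded[OF _ ge M])
qed

end

section \<open>Gabor frames of Gaussians\<close>

lemma inner_matrix_sandwich:
  fixes S T X :: "real ^ 'd ^ 'd::finite"
  shows "(S *v s) \<bullet> (X *v (T *v t)) = s \<bullet> ((transpose S ** X ** T) *v t)"
  unfolding matrix_vector_mul_assoc[symmetric] by (simp only: dot_lmul_matrix[symmetric] vector_transpose_matrix)

lemma norm_power2_Plus: "(norm (v :: real ^ ('d::finite + 'd)))\<^sup>2 = (norm (\<chi> i. v $ Inl i))\<^sup>2 + (norm (\<chi> i. v $ Inr i))\<^sup>2"
  by (simp add: power2_norm_eq_inner inner_vec_def sum_UNIV_Plus)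

lemma (in coherent_system) dist2_lower_bound:
  obtains \<mu> where "\<mu> > 0" "\<And>k k'. \<mu> * (norm (k - k'))\<^sup>2 \<le> dist2 k k'"
proof -
  define \<mu> where "\<mu> = Min ((\<lambda>i. min ((al i)\<^sup>2) ((be i)\<^sup>2)) ` UNIV)"
  have le: "\<mu> \<le> min ((al i)\<^sup>2) ((be i)\<^sup>2)" for i unfolding \<mu>_def by (rule Min_le) auto
  show ?thesis
  proof
    show "\<mu> > 0" unfolding \<mu>_def using nz by (subst Min_gr_iff) auto
    fix k k' :: "real ^ ('d + 'd)"
    have "\<mu> * (norm (k - k'))\<^sup>2 = (\<Sum>i\<in>UNIV. \<mu> * (k $ Inl i - k' $ Inl i)\<^sup>2 + \<mu> * (k $ Inr i - k' $ Inr i)\<^sup>2)"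
      unfolding norm_power2_Plus power2_norm_eq_inner inner_vec_def by (simp add: sum.distrib distrib_left sum_distrib_left power2_eq_square)
    also have "\<dots> \<le> (\<Sum>i\<in>UNIV. (al i)\<^sup>2 * (k $ Inl i - k' $ Inl i)\<^sup>2 + (be i)\<^sup>2 * (k $ Inr i - k' $ Inr i)\<^sup>2)"
      using le by (intro sum_mono add_mono mult_right_mono) auto
    also have "\<dots> = dist2 k k'"
      unfolding dist2_def cmod_power2 by (intro sum.cong) (simp_all add: phase_coord_def power2_eq_square algebra_simps)
    finally show "\<mu> * (norm (k - k'))\<^sup>2 \<le> dist2 k k'" .
  qed
qed

text \<open>Since coherent states are indexed by all real vectors, the whole short-time Fourier
  transform consists of inner products with members of the same family: the point
  \<open>(x, \<omega>)\<close> has the index \<open>A^(-1) (x, \<omega>)\<close>.\<close>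

lemma gabor_frame_gaussian_iff:
  fixes A :: "real ^ ('d::finite + 'd) ^ ('d + 'd)"
  assumes sys: "coherent_system al be (\<lambda>k. tf_shift (A *v k) g) \<theta> c" and A: "invertible A"
    and g: "g \<in> borel_measurable borel" "integrable lborel (\<lambda>t. (cmod (g t))\<^sup>2)" "\<And>t. cmod (g t) \<le> B"
      "(LBINT t. (cmod (g t))\<^sup>2) = c"
  shows "gabor_frame A g \<longleftrightarrow> (\<forall>i. \<bar>al i * be i\<bar> < 1)"
proof -
  interpret coherent_system al be "\<lambda>k. tf_shift (A *v k) g" \<theta> c by (rule sys)
  have gL2: "g \<in> L2" by (rule L2_of_borel[OF g(1,2)])
  obtain M where M: "M > 0" "\<And>f. f \<in> L2 \<Longrightarrow> (\<lambda>k. (cmod (L2_inner f (tf_shift (A *v k) g)))\<^sup>2) summable_on int_vectors"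
    "\<And>f. f \<in> L2 \<Longrightarrow> (\<Sum>\<^sub>\<infinity>k\<in>int_vectors. (cmod (L2_inner f (tf_shift (A *v k) g)))\<^sup>2) \<le> M * (L2_norm f)\<^sup>2"
    using frame_upper_bound by blast
  show ?thesis
  proof
    assume "gabor_frame A g"
    then obtain C1 where C1: "C1 > 0" "\<And>f. f \<in> L2 \<Longrightarrow> C1 * (L2_norm f)\<^sup>2 \<le> (\<Sum>\<^sub>\<infinity>k\<in>int_vectors. (cmod (L2_inner f (tf_shift (A *v k) g)))\<^sup>2)"
      unfolding gabor_frame_def by blast
    show "\<forall>i. \<bar>al i * be i\<bar> < 1"
      by (intro allI frame_necessity[OF C1])
  next
    assume lt: "\<forall>i. \<bar>al i * be i\<bar> < 1"
    obtain \<kappa> where \<kappa>: "\<kappa> > 0"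
      "\<And>(f :: real ^ 'd \<Rightarrow> complex) g B. f \<in> L2 \<Longrightarrow> g \<in> borel_measurable borel \<Longrightarrow> integrable lborel (\<lambda>t. (cmod (g t))\<^sup>2) \<Longrightarrow>
        (\<And>t. cmod (g t) \<le> B) \<Longrightarrow>
        ennreal (\<kappa> * (L2_norm f)\<^sup>2 * (LBINT t. (cmod (g t))\<^sup>2))
          \<le> (\<integral>\<^sup>+x. \<integral>\<^sup>+\<omega>. ennreal ((cmod (L2_inner f (\<lambda>t. exp (2 * of_real pi * \<i> * of_real (t \<bullet> \<omega>)) * g (t - x))))\<^sup>2) \<partial>lborel \<partial>lborel)"
      using stft_lower_bound[where 'd = 'd] by blast
    obtain \<mu> where \<mu>: "\<mu> > 0" "\<And>k k'. \<mu> * (norm (k - k'))\<^sup>2 \<le> dist2 k k'" using dist2_lower_bound by metis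
    obtain N where N: "N > 0" "\<And>v. norm (A *v v) \<le> norm v * N"
      using bounded_linear.pos_bounded[OF matrix_vector_mul_bounded_linear[of A]] by metis
    define \<zeta> where "\<zeta> x \<omega> = matrix_inv A *v (\<chi> j. case j of Inl i \<Rightarrow> x $ i | Inr i \<Rightarrow> \<omega> $ i)" for x \<omega> :: "real ^ 'd"
    have A\<zeta>: "A *v \<zeta> x \<omega> = (\<chi> j. case j of Inl i \<Rightarrow> x $ i | Inr i \<Rightarrow> \<omega> $ i)" for x \<omega>
      unfolding \<zeta>_def matrix_vector_mul_assoc matrix_inv_inverse(1)[OF A] by simp
    have shift: "tf_shift (A *v \<zeta> x \<omega>) g = (\<lambda>t. exp (2 * of_real pi * \<i> * of_real (t \<bullet> \<omega>)) * g (t - x))" for x \<omega>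
      unfolding tf_shift_def A\<zeta> Let_def by simp
    have dist: "\<mu> / N\<^sup>2 * ((norm (x - (\<chi> i. (A *v k) $ Inl i)))\<^sup>2 + (norm (\<omega> - (\<chi> i. (A *v k) $ Inr i)))\<^sup>2) \<le> dist2 (\<zeta> x \<omega>) k" for x \<omega> k
    proof -
      have "(norm (x - (\<chi> i. (A *v k) $ Inl i)))\<^sup>2 + (norm (\<omega> - (\<chi> i. (A *v k) $ Inr i)))\<^sup>2 = (norm (A *v (\<zeta> x \<omega> - k)))\<^sup>2"
        unfolding norm_power2_Plus matrix_vector_mult_diff_distrib A\<zeta>
        by (intro arg_cong2[where f = "\<lambda>s t. (norm s)\<^sup>2 + (norm t)\<^sup>2"]) (simp_all add: vec_eq_iff)
      also have "\<dots> \<le> (norm (\<zeta> x \<omega> - k) * N)\<^sup>2" by (intro power_mono N) simp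
      finally have "\<mu> / N\<^sup>2 * ((norm (x - (\<chi> i. (A *v k) $ Inl i)))\<^sup>2 + (norm (\<omega> - (\<chi> i. (A *v k) $ Inr i)))\<^sup>2) \<le> \<mu> / N\<^sup>2 * (norm (\<zeta> x \<omega> - k) * N)\<^sup>2"
        using \<mu>(1) by (intro mult_left_mono) auto
      also have "\<dots> = \<mu> * (norm (\<zeta> x \<omega> - k))\<^sup>2" using N(1) by (simp add: power_mult_distrib)
      also have "\<dots> \<le> dist2 (\<zeta> x \<omega>) k" by (rule \<mu>(2))
      finally show ?thesis .
    qed
    have stft: "ennreal (\<kappa> * c * (L2_norm f)\<^sup>2) \<le> (\<integral>\<^sup>+x. \<integral>\<^sup>+\<omega>. ennreal ((cmod (L2_inner f (tf_shift (A *v \<zeta> x \<omega>) g)))\<^sup>2) \<partial>lborel \<partial>lborel)"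
      if "f \<in> L2" for f
    proof -
      show ?thesis unfolding shift using \<kappa>(2)[OF that g(1,2,3)] unfolding g(4) by (simp only: mult_ac)
    qed
    have \<kappa>c: "\<kappa> * c > 0" and \<rho>: "\<mu> / N\<^sup>2 > 0" using \<kappa>(1) c \<mu>(1) N(1) by simp_all
    obtain C1 where C1: "C1 > 0" "\<And>f. f \<in> L2 \<Longrightarrow> C1 * (L2_norm f)\<^sup>2 \<le> (\<Sum>\<^sub>\<infinity>k\<in>int_vectors. (cmod (L2_inner f (tf_shift (A *v k) g)))\<^sup>2)"
      using frame_lower_bound[OF spec[OF lt] \<kappa>c \<rho> dist stft] by blast
    show "gabor_frame A g"
      unfolding gabor_frame_def using gL2 C1 M by blast
  qed
qed

text \<open>Here \<open>A\<close> is a symplectic matrix times the diagonal scaling by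
  \<open>al\<close> and \<open>be\<close>. The symplectic part is absorbed by the choice of
  \<open>X\<close> and \<open>Y\<close>, so the Gram matrix sees only the scaled integer
  coordinates.\<close>

lemma gabor_frame_symplectic_gaussian_iff:
  fixes S11 S12 S21 S22 :: "real ^ 'd ^ 'd::finite" and al be :: "'d \<Rightarrow> real" and C :: complex
  assumes M: "transpose S11 ** S21 = transpose S21 ** S11" "transpose S11 ** S22 - transpose S21 ** S12 = mat 1"
      "transpose S12 ** S22 = transpose S22 ** S12"
    and nz: "\<And>i. al i \<noteq> 0" "\<And>i. be i \<noteq> 0" "C \<noteq> 0"
  defines "X \<equiv> matrix_inv (S11 ** transpose S11 + S12 ** transpose S12)"
  defines "Y \<equiv> - ((S21 ** transpose S11 + S22 ** transpose S12) ** X)"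
  defines "A \<equiv> block_matrix (S11 ** diag al) (S12 ** diag be) (S21 ** diag al) (S22 ** diag be)"
  defines "g \<equiv> gen_gaussian C X Y"
  assumes A: "invertible A"
  shows "gabor_frame A g \<longleftrightarrow> (\<forall>i. \<bar>al i * be i\<bar> < 1)"
proof -
  note sr = symplectic_relations[OF M, folded X_def, folded Y_def]
  have posX: "\<forall>t. t \<noteq> 0 \<longrightarrow> t \<bullet> (X *v t) > 0" using sr(4) by blast
  define p where "p k = (\<chi> i. al i * k $ Inl i)" for k :: "real ^ ('d + 'd)"
  define q where "q k = (\<chi> i. be i * k $ Inr i)" for k :: "real ^ ('d + 'd)"
  define x where "x k = S11 *v p k + S12 *v q k" for k
  define w where "w k = S21 *v p k + S22 *v q k" for k
  \<comment> \<open>With \<open>(x, w)\<close> the symplectic image of \<open>(p, q)\<close>, the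
    relations for \<open>S21 + Y S11\<close> and \<open>S22 + Y S12\<close> identify this as the
    vector with \<open>w + Y x = X y\<close>.\<close>
  define y where "y k = S11 *v q k - S12 *v p k" for k
  have neg: "(- B) *v t = - (B *v t)" for B :: "real ^ 'd ^ 'd" and t
    by (simp add: vec_eq_iff matrix_vector_mult_def sum_negf)
  have rel: "w k + Y *v x k = X *v y k" for k
  proof -
    have "w k + Y *v x k = (S21 + Y ** S11) *v p k + (S22 + Y ** S12) *v q k"
      unfolding w_def x_def by (simp add: matrix_vector_right_distrib matrix_vector_mult_add_rdistrib matrix_vector_mul_assoc)
    also have "\<dots> = X *v y k"
      unfolding sr(5,6) y_def neg by (simp add: matrix_vector_mult_diff_distrib matrix_vector_mul_assoc)
    finally show ?thesis .
  qed
  note c0 = gaussian_kernel(1)[where w = w and x = x and y = y, OF sr(2) posX sr(3) rel]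
  note gk = gaussian_kernel(2-7)[where w = w and x = x and y = y and C = C, OF sr(2) posX sr(3) rel, folded g_def]
  define e where "e s t = s \<bullet> ((transpose S11 ** X ** S11) *v t)" for s t
  define e' where "e' s t = s \<bullet> ((transpose S12 ** X ** S12) *v t)" for s t
  define h where "h s t = s \<bullet> ((transpose S11 ** X ** S12) *v t)" for s t
  have e: "e s t + e' s t = s \<bullet> t" for s t
    unfolding e_def e'_def inner_add_right[symmetric] matrix_vector_mult_add_rdistrib[symmetric] sr(7) by simp
  note expand = inner_add_left inner_add_right inner_diff_left inner_diff_right matrix_vector_right_distrib matrix_vector_mult_diff_distrib
    inner_matrix_sandwich
  \<comment> \<open>The map from \<open>(p, q)\<close> to \<open>(x, y)\<close> is an isometry for
    the form of \<open>X\<close>: the diagonal terms combine by \<open>e\<close>, and the mixed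
    terms cancel by \<open>sr(8)\<close>.\<close>
  have re: "x k \<bullet> (X *v x k') + y k \<bullet> (X *v y k') = p k \<bullet> p k' + q k \<bullet> q k'" for k k'
    unfolding x_def y_def expand sr(8)[symmetric]
    using e[of "p k" "p k'"] e[of "q k" "q k'"] unfolding e_def e'_def by linarith
  have im: "x k \<bullet> (X *v y k') - y k \<bullet> (X *v x k') = p k \<bullet> q k' - q k \<bullet> p k'" for k k'
    unfolding x_def y_def expand sr(8)[symmetric]
    using e[of "p k" "q k'"] e[of "q k" "p k'"] unfolding e_def e'_def by linarith
  have ph: "Complex (p k \<bullet> p k' + q k \<bullet> q k') (p k \<bullet> q k' - q k \<bullet> p k') = (\<Sum>i\<in>UNIV. phase_coord al be k i * cnj (phase_coord al be k' i))" for k k'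
    by (simp add: complex_eq_iff phase_coord_def p_def q_def inner_vec_def sum.distrib sum_subtractf)
  have ph_norm: "p k \<bullet> p k + q k \<bullet> q k = (\<Sum>i\<in>UNIV. (cmod (phase_coord al be k i))\<^sup>2)" for k
    unfolding cmod_power2 by (simp add: phase_coord_def p_def q_def inner_vec_def sum.distrib power2_eq_square)
  have xk: "(\<chi> i. (A *v k) $ Inl i) = x k" "(\<chi> i. (A *v k) $ Inr i) = w k" for k
    unfolding A_def x_def w_def p_def q_def block_matrix_vector_nth
    by (simp_all add: vec_eq_iff diag_vec flip: matrix_vector_mul_assoc)
  have shift: "tf_shift (A *v k) g = (\<lambda>t. exp (2 * complex_of_real pi * \<i> * of_real (t \<bullet> w k)) * g (t - x k))" for k
    unfolding tf_shift_def xk Let_def ..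
  define c where "c = (cmod C)\<^sup>2 * (LBINT t. exp (- (2 * pi * (t \<bullet> (X *v t)))))"
  show ?thesis
  proof (rule gabor_frame_gaussian_iff[OF _ A gk(1,2,3)])
    show "coherent_system al be (\<lambda>k. tf_shift (A *v k) g)
      (\<lambda>k. exp (Complex (- pi / 2 * (x k \<bullet> (X *v x k) + y k \<bullet> (X *v y k))) (- pi * (x k \<bullet> (X *v y k) - x k \<bullet> (Y *v x k))))) c"
    proof
      show "al i \<noteq> 0" "be i \<noteq> 0" for i by (rule nz)+
      show "c > 0" unfolding c_def using c0 nz(3) by simp
      show "tf_shift (A *v k) g \<in> L2" for k unfolding shift by (rule gk(5))
      show "L2_inner (tf_shift (A *v k') g) (tf_shift (A *v k) g) = of_real c *
          exp (Complex (- pi / 2 * (x k \<bullet> (X *v x k) + y k \<bullet> (X *v y k))) (- pi * (x k \<bullet> (X *v y k) - x k \<bullet> (Y *v x k)))) *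
          cnj (exp (Complex (- pi / 2 * (x k' \<bullet> (X *v x k') + y k' \<bullet> (X *v y k'))) (- pi * (x k' \<bullet> (X *v y k') - x k' \<bullet> (Y *v x k'))))) *
          exp (of_real pi * (\<Sum>i\<in>UNIV. phase_coord al be k i * cnj (phase_coord al be k' i)))" for k k'
        using gk(6)[of k' k] unfolding shift c_def re im ph .
      show "cmod (exp (Complex (- pi / 2 * (x k \<bullet> (X *v x k) + y k \<bullet> (X *v y k))) (- pi * (x k \<bullet> (X *v y k) - x k \<bullet> (Y *v x k)))))
          = exp (- pi / 2 * (\<Sum>i\<in>UNIV. (cmod (phase_coord al be k i))\<^sup>2))" for k
        unfolding norm_exp_eq_Re re ph_norm by simp
    qed
    show "(LBINT t. (cmod (g t))\<^sup>2) = c" unfolding c_def by (rule gk(4))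
  qed
qed

text \<open>The form \<open>A^T J A\<close> is invertible because \<open>A\<close> and
  \<open>J\<close> are, while a zero diagonal entry of \<open>K\<close> would make it annihilate a
  basis vector.\<close>

lemma symplectic_form_diagonal_nz:
  fixes A :: "real ^ ('d::finite + 'd) ^ ('d + 'd)" and K :: "real ^ 'd ^ 'd"
  assumes A: "invertible A" and eq: "transpose A ** symplectic_J ** A = block_matrix 0 K (- K) 0" and K: "diagonal_matrix K"
  shows "K $ i $ i \<noteq> 0"
proof
  assume 0: "K $ i $ i = 0"
  define Z where "Z = block_matrix 0 K (- K) 0"
  have "symplectic_J ** (- symplectic_J) = (mat 1 :: real ^ ('d + 'd) ^ ('d + 'd))"
    "(- symplectic_J) ** symplectic_J = (mat 1 :: real ^ ('d + 'd) ^ ('d + 'd))"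
  proof -
    have "- symplectic_J = (block_matrix 0 (- mat 1) (mat 1) 0 :: real ^ ('d + 'd) ^ ('d + 'd))"
      by (simp add: symplectic_J_def vec_eq_Plus)
    then show "symplectic_J ** (- symplectic_J) = (mat 1 :: real ^ ('d + 'd) ^ ('d + 'd))"
      "(- symplectic_J) ** symplectic_J = (mat 1 :: real ^ ('d + 'd) ^ ('d + 'd))"
      by (simp_all add: symplectic_J_def block_matrix_mult block_matrix_one matrix_mult_distribs)
  qed
  then have "invertible (symplectic_J :: real ^ ('d + 'd) ^ ('d + 'd))"
    unfolding invertible_def by blast
  then have "invertible Z"
    unfolding Z_def eq[symmetric] by (intro invertible_mult transpose_invertible A)
  then have inv: "matrix_inv Z ** Z = mat 1" by (rule matrix_inv_inverse)
  have Ki: "K $ a $ i = 0" for a using K 0 by (cases "a = i") (auto simp: diagonal_matrix_def)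
  have "Z *v axis (Inr i) 1 = 0"
    unfolding matrix_vector_mult_basis column_def vec_eq_Plus by (simp add: Z_def Ki)
  then have "axis (Inr i) 1 = (0 :: real ^ ('d + 'd))"
    using arg_cong[OF inv, of "\<lambda>M. M *v axis (Inr i) 1"] by (simp flip: matrix_vector_mul_assoc)
  then show False by (simp add: axis_eq_0_iff)
qed

theorem theorem4p2:
  fixes A :: "real ^ ('d::finite + 'd) ^ ('d + 'd)"
    and A11 A12 A21 A22 K D X Y :: "real ^ 'd ^ 'd"
    and C :: complex
  assumes "invertible A"
    and "transpose A ** symplectic_J ** A = block_matrix 0 K (- K) 0"
    and "diagonal_matrix K"
    and "A = block_matrix A11 A12 A21 A22"
    and "diagonal_matrix D" and "invertible D"
    and "X = matrix_inv (A11 ** (D ** D) ** transpose A11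
           + A12 ** (matrix_inv (D ** K) ** matrix_inv (D ** K)) ** transpose A12)"
    and "Y = - ((A21 ** (D ** D) ** transpose A11
           + A22 ** (matrix_inv (D ** K) ** matrix_inv (D ** K)) ** transpose A12) ** X)"
    and "C \<noteq> 0"
  shows "invertible (D ** K)
    \<and> invertible (A11 ** (D ** D) ** transpose A11
           + A12 ** (matrix_inv (D ** K) ** matrix_inv (D ** K)) ** transpose A12)
    \<and> (gabor_frame A (gen_gaussian C X Y) \<longleftrightarrow> (\<forall>i. \<bar>K $ i $ i\<bar> < 1))"
proof -
  define k where "k i = K $ i $ i" for i
  define d where "d i = D $ i $ i" for i
  have K: "K = diag k" unfolding k_def by (rule diag_of_diagonal_matrix[OF assms(3)])
  have D: "D = diag d" unfolding d_def by (rule diag_of_diagonal_matrix[OF assms(5)])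
  have k: "k i \<noteq> 0" for i unfolding k_def by (rule symplectic_form_diagonal_nz[OF assms(1-3)])
  have d: "d i \<noteq> 0" for i using assms(6) unfolding D by (rule diag_invertible_nz)
  \<comment> \<open>Diagonal of \<open>(D K)^(-1)\<close>. Scaling the column blocks of
    \<open>A\<close> by \<open>D\<close> and by this matrix turns the form with block
    \<open>K\<close> into \<open>J\<close>, since \<open>d * k * e = 1\<close>. The squares in the
    formulas for \<open>X\<close> and \<open>Y\<close> arise as one factor from each of two such
    blocks.\<close>
  define e where "e i = 1 / (d i * k i)" for i
  have DK: "D ** K = diag (\<lambda>i. d i * k i)" unfolding D K by (rule diag_mult)
  have inv: "invertible (D ** K)" "matrix_inv (D ** K) = diag e"
    unfolding DK e_def using invertible_diag[of "\<lambda>i. d i * k i"] d k by auto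
  define S11 S12 S21 S22 where "S11 = A11 ** D" and "S12 = A12 ** diag e" and "S21 = A21 ** D" and "S22 = A22 ** diag e"
  have form: "transpose A11 ** A21 - transpose A21 ** A11 = 0" "transpose A11 ** A22 - transpose A21 ** A12 = K"
    "transpose A12 ** A22 - transpose A22 ** A12 = 0"
    using assms(2) unfolding assms(4) symplectic_J_def
    by (simp_all add: transpose_block_matrix block_matrix_mult block_matrix_eq_iff matrix_mult_distribs)
  have tS: "transpose S11 = D ** transpose A11" "transpose S12 = diag e ** transpose A12"
    "transpose S21 = D ** transpose A21" "transpose S22 = diag e ** transpose A22"
    by (simp_all add: S11_def S12_def S21_def S22_def matrix_transpose_mul transpose_diag D)
  have M: "transpose S11 ** S21 = transpose S21 ** S11" "transpose S11 ** S22 - transpose S21 ** S12 = mat 1"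
    "transpose S12 ** S22 = transpose S22 ** S12"
  proof -
    have "transpose S11 ** S21 - transpose S21 ** S11 = D ** (transpose A11 ** A21 - transpose A21 ** A11) ** D"
      unfolding tS unfolding S21_def S11_def by (simp add: matrix_mult_distribs matrix_mul_assoc)
    then show "transpose S11 ** S21 = transpose S21 ** S11" by (simp add: form)
    have "transpose S12 ** S22 - transpose S22 ** S12 = diag e ** (transpose A12 ** A22 - transpose A22 ** A12) ** diag e"
      unfolding tS unfolding S22_def S12_def by (simp add: matrix_mult_distribs matrix_mul_assoc)
    then show "transpose S12 ** S22 = transpose S22 ** S12" by (simp add: form)
    have "transpose S11 ** S22 - transpose S21 ** S12 = D ** (transpose A11 ** A22 - transpose A21 ** A12) ** diag e"
      unfolding tS unfolding S22_def S12_def by (simp add: matrix_mult_distribs matrix_mul_assoc)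
    also have "\<dots> = mat 1"
      unfolding form DK diag_mult using d k by (simp add: e_def diag_one)
    finally show "transpose S11 ** S22 - transpose S21 ** S12 = mat 1" .
  qed
  have P: "A11 ** (D ** D) ** transpose A11 + A12 ** (matrix_inv (D ** K) ** matrix_inv (D ** K)) ** transpose A12
      = S11 ** transpose S11 + S12 ** transpose S12"
    "A21 ** (D ** D) ** transpose A11 + A22 ** (matrix_inv (D ** K) ** matrix_inv (D ** K)) ** transpose A12
      = S21 ** transpose S11 + S22 ** transpose S12"
    unfolding tS inv(2) unfolding S11_def S12_def S21_def S22_def by (simp_all add: matrix_mul_assoc)
  \<comment> \<open>The inverse scalings, which return from the symplectic matrix to
    \<open>A\<close>. Their product is the diagonal entry of \<open>K\<close>, whatever
    \<open>D\<close> is.\<close>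
  define al be where "al i = 1 / d i" and "be i = d i * k i" for i
  have one: "D ** diag al = mat 1" "diag e ** diag be = mat 1"
    unfolding D diag_mult al_def be_def e_def using d k by (simp_all add: diag_one)
  have A: "A = block_matrix (S11 ** diag al) (S12 ** diag be) (S21 ** diag al) (S22 ** diag be)"
    unfolding assms(4) S11_def S12_def S21_def S22_def by (simp add: one flip: matrix_mul_assoc)
  have nz: "al i \<noteq> 0" "be i \<noteq> 0" for i using d k by (auto simp: al_def be_def)
  have XY: "X = matrix_inv (S11 ** transpose S11 + S12 ** transpose S12)"
    "Y = - ((S21 ** transpose S11 + S22 ** transpose S12) ** X)"
    using assms(7,8) unfolding P by simp_all
  have "gabor_frame A (gen_gaussian C X Y) \<longleftrightarrow> (\<forall>i. \<bar>al i * be i\<bar> < 1)"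
    by (rule gabor_frame_symplectic_gaussian_iff[where al = al and be = be, OF M nz assms(9), folded XY(1), folded XY(2) A, OF assms(1)])
  also have "\<dots> \<longleftrightarrow> (\<forall>i. \<bar>K $ i $ i\<bar> < 1)" using d by (simp add: al_def be_def k_def)
  finally show ?thesis using inv(1) symplectic_relations(1)[OF M] unfolding P by simp
qed

end
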